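(* Assume that the target density $f=F'$ satisfies $$\int_0^\infty\sqrt{x}\,f(x)\,dx<\infty\quad\text{and}\quad\int_0^\infty\Big(f(x)+\frac{x}{2}f'(x)\Big)^2dx<\infty.$$ Then, as $n\to\infty$, $$\mathrm{MISE}(\hat F_{n,b}^{\mathrm{Gam}}) = \int_0^\infty\mathrm{Var}(\hat F_{n,b}^{\mathrm{Gam}}(x))\,dx+\int_0^\infty\big(\mathrm{Bias}[\hat F_{n,b}^{\mathrm{Gam}}(x)]\big)^2dx$$ $$= n^{-1}\int_0^\infty F(x)(1-F(x))\,dx - n^{-1}b^{1/2}\int_0^\infty\frac{\sqrt{x}\,f(x)}{\sqrt{\pi}}\,dx + b^2\int_0^\infty\Big(f(x)+\frac{x}{2}f'(x)\Big)^2dx + o(n^{-1}b^{1/2})+o(b^2).$$ In particular, if $\int_0^\infty(f(x)+\frac{x}{2}f'(x))^2dx>0$, the asymptotically optimal choice of $b$, with respect to $\mathrm{MISE}$, is $$b_{\mathrm{opt}} = n^{-2/3}\left[\frac{4\int_0^\infty(f(x)+\frac{x}{2}f'(x))^2dx}{\int_0^\infty\sqrt{x}\,f(x)/\sqrt{\pi}\,dx}\right]^{-2/3},$$ with $$\mathrm{MISE}(\hat F_{n,b_{\mathrm{opt}}}^{\mathrm{Gam}}) = n^{-1}\int_0^\infty F(x)(1-F(x))\,dx - n^{-4/3}\,\frac34\left[\frac{\big(\int_0^\infty\sqrt{x}\,f(x)/\sqrt{\pi}\,dx\big)^4}{4\int_0^\infty(f(x)+\frac{x}{2}f'(x))^2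dx}\right]^{1/3}+o(n^{-4/3}).$$
   Context: $F$ is a cumulative distribution function supported on $[0,\infty)$ having two continuous and bounded derivatives; $f=F'$. $X_1,X_2,\dots$ are i.i.d. with c.d.f. $F$. The smoothing parameter $b=b_n>0$ satisfies $b\to0$ as $n\to\infty$. The Gamma kernel c.d.f. estimator is, for $x\in(0,\infty)$, $$\hat F_{n,b}^{\mathrm{Gam}}(x):=\frac1n\sum_{i=1}^n\overline K_{\mathrm{Gam}}(X_i\mid b^{-1}x+1,\,b),\qquad \overline K_{\mathrm{Gam}}(t\mid\alpha,\theta):=\frac{\Gamma(\alpha,t/\theta)}{\Gamma(\alpha)},\quad \alpha,\theta>0,$$ where $\Gamma(\alpha,z):=\int_z^\infty t^{\alpha-1}e^{-t}\,dt$ and $\Gamma(\alpha):=\Gamma(\alpha,0)$. For an estimator $\hat F$, $\mathrm{Bias}[\hat F(x)]:=\mathbb{E}[\hat F(x)]-F(x)$ and $\mathrm{MISE}(\hat F):=\mathbb{E}\int_0^\infty(\hat F(x)-F(x))^2dx$. "Asymptotically optimal choice of $b$ with respect to MISE" means the minimizer over $b>0$ of the expansion of the MISE with the error terms $o(n^{-1}b^{1/2})$ and $o(b^2)$ dropped. Notation: $u=o(v)$ means $\lim|u/v|=0$ as $n\to\infty$. *)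

theory Defs
  imports "HOL-Probability.Probability" "HOL-Library.Landau_Symbols"
begin

definition upper_Gamma :: "real \<Rightarrow> real \<Rightarrow> real" where
  "upper_Gamma \<alpha> z = (LBINT t:{z..}. t powr (\<alpha> - 1) * exp (- t))"

text \<open>The complete Gamma function below is the library's; this is the convention
  \<open>\<Gamma>(\<alpha>) = \<Gamma>(\<alpha>, 0)\<close>.\<close>

lemma upper_Gamma_0:
  assumes "\<alpha> > 0"
  shows "upper_Gamma \<alpha> 0 = Gamma \<alpha>"
proof -
  have eq: "t powr (\<alpha> - 1) * exp (- t) = t powr (\<alpha> - 1) / exp t" for t :: real
    by (simp add: exp_minus field_simps)
  have "(\<lambda>t. t powr (\<alpha> - 1) / exp t) absolutely_integrable_on {0..}"
    using Gamma_integral_real[OF assms]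
    by (intro nonnegative_absolutely_integrable_1) auto
  then have "integral {0..} (\<lambda>t. t powr (\<alpha> - 1) / exp t)
      = (LINT t:{0..}|lebesgue. t powr (\<alpha> - 1) / exp t)"
    by (rule set_lebesgue_integral_eq_integral(2)[symmetric])
  also have "\<dots> = (LBINT t:{0..}. t powr (\<alpha> - 1) / exp t)"
    unfolding set_lebesgue_integral_def by (intro integral_completion) measurable
  finally show ?thesis
    using Gamma_integral_real[OF assms]
    by (simp add: upper_Gamma_def eq integral_unique)
qed

definition Kbar_Gam :: "real \<Rightarrow> real \<Rightarrow> real \<Rightarrow> real" where
  "Kbar_Gam t \<alpha> \<theta> = upper_Gamma \<alpha> (t / \<theta>) / Gamma \<alpha>"

definition Fhat_Gam :: "(nat \<Rightarrow> 'a \<Rightarrow> real) \<Rightarrow> nat \<Rightarrow> real \<Rightarrow> real \<Rightarrow> 'a \<Rightarrow> real" where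
  "Fhat_Gam X n b x \<omega> = 1 / real n * (\<Sum>i=1..n. Kbar_Gam (X i \<omega>) (x / b + 1) b)"

definition Bias :: "'a measure \<Rightarrow> (real \<Rightarrow> 'a \<Rightarrow> real) \<Rightarrow> (real \<Rightarrow> real) \<Rightarrow> real \<Rightarrow> real" where
  "Bias M Fh F x = prob_space.expectation M (Fh x) - F x"

text \<open>Integrals that may be infinite take values in \<^typ>\<open>ennreal\<close>: square-root moments
  do not force \<open>\<integral> F (1 - F)\<close>, hence the MISE, to be finite.\<close>

definition MISE :: "'a measure \<Rightarrow> (real \<Rightarrow> 'a \<Rightarrow> real) \<Rightarrow> (real \<Rightarrow> real) \<Rightarrow> ennreal" where
  "MISE M Fh F = (\<integral>\<^sup>+\<omega>. (\<integral>\<^sup>+x\<in>{0<..}. ennreal ((Fh x \<omega> - F x)\<^sup>2) \<partial>lborel) \<partial>M)"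

definition int_FF :: "(real \<Rightarrow> real) \<Rightarrow> ennreal" where
  "int_FF F = (\<integral>\<^sup>+x\<in>{0<..}. ennreal (F x * (1 - F x)) \<partial>lborel)"

definition var_const :: "(real \<Rightarrow> real) \<Rightarrow> real" where
  "var_const f = (LBINT x:{0<..}. sqrt x * f x / sqrt pi)"

definition bias_const :: "(real \<Rightarrow> real) \<Rightarrow> (real \<Rightarrow> real) \<Rightarrow> real" where
  "bias_const f f' = (LBINT x:{0<..}. (f x + x / 2 * f' x)\<^sup>2)"

text \<open>The expansion of the MISE without its error terms. Only the first summand can be
  infinite, so the extended real arithmetic never meets \<open>\<infinity> - \<infinity>\<close>.\<close>

definition MISE_main :: "(real \<Rightarrow> real) \<Rightarrow> (real \<Rightarrow> real) \<Rightarrow> (real \<Rightarrow> real) \<Rightarrow> nat \<Rightarrow> real \<Rightarrow> ereal" where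
  "MISE_main F f f' n b =
     ereal (1 / real n) * enn2ereal (int_FF F)
     - ereal (1 / real n * sqrt b * var_const f)
     + ereal (b\<^sup>2 * bias_const f f')"

definition asymp_optimal :: "(real \<Rightarrow> real) \<Rightarrow> (real \<Rightarrow> real) \<Rightarrow> (real \<Rightarrow> real) \<Rightarrow> nat \<Rightarrow> real \<Rightarrow> bool" where
  "asymp_optimal F f f' n = is_arg_min (MISE_main F f f' n) (\<lambda>b. b > 0)"

definition b_opt :: "(real \<Rightarrow> real) \<Rightarrow> (real \<Rightarrow> real) \<Rightarrow> nat \<Rightarrow> real" where
  "b_opt f f' n =
     real n powr (- (2 / 3)) * (4 * bias_const f f' / var_const f) powr (- (2 / 3))"

end

theory Submission
  imports Defs "HOL-Real_Asymp.Real_Asymp"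
begin

text \<open>
  As a function of \<open>t\<close>, the kernel \<open>Kbar_Gam t (x / b + 1) b\<close> is the survival function of a Gamma variable \<open>T\<close>
  with mean \<open>x + b\<close> and variance \<open>b (x + b)\<close>; it differs from the indicator of \<open>t < x\<close> by an error
  \<open>Kerr b x t\<close> whose first moments are explicit. Integrating the error against \<open>f\<close> gives the bias
  \<open>b (f x + x f' x / 2) + o(b)\<close>, and integrating the error of the squared kernel gives
  \<open>- \<surd>b \<surd>x f x / \<surd>\<pi> + o(\<surd>b)\<close>, because \<open>E (min T T')\<close> for independent copies is a quotient of Gamma
  functions, estimated by log-convexity.

  These limits are pointwise in \<open>x\<close>. They pass to the integral over \<open>x\<close> because the rescaled integrands
  are bounded on bounded intervals and uniformly small at infinity. The latter rests on a Chernoff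
  bound: \<open>Kerr b x t\<close> decays exponentially in \<open>\<bar>x - t\<bar> / \<surd>(b (t + b))\<close>, so that after exchanging the
  integrals the tails are controlled by \<open>\<integral> \<surd>(t + 1) f t dt\<close> and \<open>\<integral> (s + 1)\<^sup>2 (f' s)\<^sup>2 ds\<close>. The second integral
  is finite since \<open>f\<close>, being a bounded density, is square integrable, hence so is
  \<open>x f' x = 2 (f x + x f' x / 2) - 2 f x\<close>.
\<close>

section \<open>The survival function of the Gamma distribution\<close>

text \<open>A finite square-root moment does not make \<open>F * (1 - F)\<close> integrable, so the
  MISE may be infinite and integrals cannot simply be subtracted. What stays finite is the
  difference between \<open>n\<close> times the variance and \<open>F * (1 - F)\<close>; it enters
  as an integrable real perturbation of a possibly infinite non-negative integral. The kernel width
  at \<open>x\<close> is of order sqrt(b(x+b)) and grows with \<open>x\<close>, so no fixed majorant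
  of the rescaled errors is at hand; after an exchange of integrals the exponential rate can be
  frozen at a point other than the integration variable. The squared bias is quadratic in the kernel
  and must first be made linear in the square of \<open>f'\<close>, which Cauchy--Schwarz achieves
  with a weight of known total mass. The constants have a probabilistic reading: E T - x = b gives
  the term \<open>f x\<close>, half of E (T - x)^2 = b(x + 2b) gives \<open>x / 2 * f' x\<close>,
  and E min(T, T') = E T - E|T - T'|/2 gives the square-root term, half the mean difference of two
  nearly normal variables of variance about b x.\<close>

lemma set_has_integral_of_nn:
  fixes g :: "real \<Rightarrow> real"
  assumes [measurable]: "g \<in> borel_measurable borel" "S \<in> sets borel"
    and "\<And>x. x \<in> S \<Longrightarrow> 0 \<le> g x" and "(\<integral>\<^sup>+x\<in>S. ennreal (g x) \<partial>lborel) = ennreal r" "0 \<le> r"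
  shows "set_integrable lborel S g" "(LBINT x:S. g x) = r"
proof -
  have "has_bochner_integral lborel (\<lambda>x. indicator S x *\<^sub>R g x) r"
  proof (rule has_bochner_integral_nn_integral)
    show "(\<integral>\<^sup>+x. ennreal (indicator S x *\<^sub>R g x) \<partial>lborel) = ennreal r"
      unfolding assms(4)[symmetric] by (intro nn_integral_cong) (auto simp: indicator_def)
  qed (use assms in \<open>auto simp: indicator_def\<close>)
  then show "set_integrable lborel S g" "(LBINT x:S. g x) = r"
    by (auto simp: set_integrable_def set_lebesgue_integral_def has_bochner_integral_iff)
qed

lemma set_nn_integral_of_integrable:
  fixes g :: "real \<Rightarrow> real"
  assumes "set_integrable lborel S g" "\<And>x. x \<in> S \<Longrightarrow> 0 \<le> g x"
  shows "(\<integral>\<^sup>+x\<in>S. ennreal (g x) \<partial>lborel) = ennreal (LBINT x:S. g x)"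
proof -
  have "(\<integral>\<^sup>+x\<in>S. ennreal (g x) \<partial>lborel) = (\<integral>\<^sup>+x. ennreal (indicator S x *\<^sub>R g x) \<partial>lborel)"
    by (intro nn_integral_cong) (auto simp: indicator_def)
  also have "\<dots> = ennreal (LBINT x:S. g x)"
    using assms unfolding set_integrable_def set_lebesgue_integral_def
    by (intro nn_integral_eq_integral) (auto simp: indicator_def)
  finally show ?thesis .
qed

text \<open>Because the integrand is non-negative, convergence of the antiderivative at both ends
  already yields integrability; the moments below need only a derivative and two limits.\<close>

lemma FTC_halfline_nonneg:
  fixes g G :: "real \<Rightarrow> real"
  assumes "\<And>x. x > 0 \<Longrightarrow> DERIV G x :> g x" "\<And>x. x > 0 \<Longrightarrow> isCont g x"
    and "\<And>x. x > 0 \<Longrightarrow> 0 \<le> g x"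
    and "(G \<longlongrightarrow> A) (at_right 0)" "(G \<longlongrightarrow> B) at_top"
  shows "set_integrable lborel {0<..} g" "(LBINT x:{0<..}. g x) = B - A"
proof -
  have e: "einterval 0 \<infinity> = {0<..}"
    by (auto simp: einterval_def zero_ereal_def)
  have a: "((G \<circ> real_of_ereal) \<longlongrightarrow> A) (at_right 0)"
    unfolding zero_ereal_def by (subst ereal_tendsto_simps1) (use assms(4) in simp)
  have b: "((G \<circ> real_of_ereal) \<longlongrightarrow> B) (at_left \<infinity>)"
    by (subst ereal_tendsto_simps1) (use assms(5) in simp)
  have "set_integrable lborel (einterval 0 \<infinity>) g" "(LBINT x=0..\<infinity>. g x) = B - A"
    by (rule interval_integral_FTC_nonneg[OF _ _ _ _ a b]; use assms in \<open>auto simp: zero_ereal_def\<close>)+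
  then show "set_integrable lborel {0<..} g" "(LBINT x:{0<..}. g x) = B - A"
    by (simp_all add: e interval_lebesgue_integral_def)
qed

text \<open>A linear substitution, carried out for non-negative integrals so that finiteness and
  value come together. The scale \<open>c = 1\<close> normalises the density,
  \<open>1 - \<theta>\<close> and \<open>1 + \<theta>\<close> evaluate exponential tilts, and
  \<open>c = 2\<close> belongs to the squared density.\<close>

lemma Gamma_scaled_integral:
  assumes "\<alpha> > 0" "c > (0::real)"
  shows "set_integrable lborel {0<..} (\<lambda>t. t powr (\<alpha> - 1) * exp (- (c * t)))" (is "?I")
    and "(LBINT t:{0<..}. t powr (\<alpha> - 1) * exp (- (c * t))) = Gamma \<alpha> / c powr \<alpha>" (is "?E")
proof -
  have "(\<integral>\<^sup>+t\<in>{0<..}. ennreal (t powr (\<alpha> - 1) * exp (- (c * t))) \<partial>lborel)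
      = ennreal (Gamma \<alpha> / c powr \<alpha>)"
  proof -
    have "ennreal (Gamma \<alpha>) = (\<integral>\<^sup>+t. ennreal (indicator {0..} t * t powr (\<alpha> - 1) / exp t) \<partial>lborel)"
      using Gamma_conv_nn_integral_real[OF assms(1)] by simp
    also have "\<dots> = ennreal c *
        (\<integral>\<^sup>+t. ennreal (indicator {0..} (c * t) * (c * t) powr (\<alpha> - 1) / exp (c * t)) \<partial>lborel)"
      by (subst nn_integral_real_affine[where c = c and t = 0]) (use assms in auto)
    also have "(\<integral>\<^sup>+t. ennreal (indicator {0..} (c * t) * (c * t) powr (\<alpha> - 1) / exp (c * t)) \<partial>lborel)
        = (\<integral>\<^sup>+t. ennreal (c powr (\<alpha> - 1)) *
            (ennreal (t powr (\<alpha> - 1) * exp (- (c * t))) * indicator {0<..} t) \<partial>lborel)"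
    proof (intro nn_integral_cong)
      fix t :: real
      show "ennreal (indicator {0..} (c * t) * (c * t) powr (\<alpha> - 1) / exp (c * t)) =
         ennreal (c powr (\<alpha> - 1)) *
            (ennreal (t powr (\<alpha> - 1) * exp (- (c * t))) * indicator {0<..} t)"
      proof (cases "t > 0")
        case True
        then show ?thesis using assms
          by (simp add: powr_mult ennreal_mult'[symmetric] exp_minus field_simps)
      next
        case False
        \<comment> \<open>At \<open>t = 0\<close> the left indicator is still 1, but
          \<open>0 powr (\<alpha> - 1)\<close> is 0 for every exponent.\<close>
        then show ?thesis using assms
          by (cases "t = 0") (auto simp: indicator_def zero_le_mult_iff)
      qed
    qed
    also have "\<dots> = ennreal (c powr (\<alpha> - 1)) *
          (\<integral>\<^sup>+t\<in>{0<..}. ennreal (t powr (\<alpha> - 1) * exp (- (c * t))) \<partial>lborel)"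
      by (intro nn_integral_cmult) measurable
    finally have "ennreal (Gamma \<alpha>) = ennreal (c powr \<alpha>) *
        (\<integral>\<^sup>+t\<in>{0<..}. ennreal (t powr (\<alpha> - 1) * exp (- (c * t))) \<partial>lborel)" (is "_ = _ * ?J")
      using assms by (simp add: mult.assoc[symmetric] ennreal_mult'[symmetric] powr_diff field_simps)
    then have "ennreal (1 / c powr \<alpha>) * ennreal (Gamma \<alpha>)
        = ennreal (1 / c powr \<alpha>) * (ennreal (c powr \<alpha>) * ?J)"
      by simp
    also have "\<dots> = ?J"
      using assms by (simp add: mult.assoc[symmetric] ennreal_mult'[symmetric])
    finally show ?thesis using assms by (simp add: ennreal_mult'[symmetric])
  qed
  from set_has_integral_of_nn[OF _ _ _ this] assms show ?I ?E by (auto simp: Gamma_real_nonneg)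
qed

section \<open>The unit-scale Gamma density, its survival function and exponential tail
  bounds\<close>

lemma Gamma_real_neq_0: "\<alpha> > 0 \<Longrightarrow> Gamma (\<alpha> :: real) \<noteq> 0"
  using Gamma_real_pos[of \<alpha>] by linarith

definition gamma_pdf :: "real \<Rightarrow> real \<Rightarrow> real" where
  "gamma_pdf \<alpha> t = t powr (\<alpha> - 1) * exp (- t) / Gamma \<alpha>"

definition gamma_sf :: "real \<Rightarrow> real \<Rightarrow> real" where
  "gamma_sf \<alpha> z = upper_Gamma \<alpha> z / Gamma \<alpha>"

lemma gamma_pdf_nonneg: "\<alpha> > 0 \<Longrightarrow> 0 \<le> gamma_pdf \<alpha> t"
  by (simp add: gamma_pdf_def Gamma_real_nonneg)

lemma isCont_gamma_pdf: "t > 0 \<Longrightarrow> isCont (gamma_pdf \<alpha>) t"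
  unfolding gamma_pdf_def[abs_def] by (cases "Gamma \<alpha> = 0") (auto intro!: continuous_intros)

lemma borel_measurable_gamma_pdf [measurable]: "gamma_pdf \<alpha> \<in> borel_measurable borel"
  unfolding gamma_pdf_def[abs_def] by measurable

lemma gamma_pdf_integral:
  assumes "\<alpha> > 0"
  shows "set_integrable lborel {0<..} (gamma_pdf \<alpha>)" "(LBINT t:{0<..}. gamma_pdf \<alpha> t) = 1"
  using Gamma_scaled_integral[OF assms, of 1] Gamma_real_pos[OF assms]
  unfolding gamma_pdf_def[abs_def] by (simp_all add: set_integrable_def)

text \<open>Size biasing: a factor \<open>t\<close> raises the shape by one. This closes the
  integrations by parts for the moments.\<close>

lemma gamma_pdf_Suc:
  assumes "\<alpha> > 0" "t > 0"
  shows "t * gamma_pdf \<alpha> t = \<alpha> * gamma_pdf (\<alpha> + 1) t"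
proof -
  have "Gamma (\<alpha> + 1) = \<alpha> * Gamma \<alpha>" "Gamma \<alpha> \<noteq> 0"
    using assms by (auto simp: Gamma_real_neq_0 nonpos_Ints_def intro!: Gamma_plus1)
  then show ?thesis
    using assms by (simp add: gamma_pdf_def powr_diff)
qed

lemma gamma_sf_eq:
  assumes "\<alpha> > 0"
  shows "gamma_sf \<alpha> z = (LBINT t:{z..}. gamma_pdf \<alpha> t)"
  by (simp add: gamma_sf_def upper_Gamma_def gamma_pdf_def[abs_def])

lemma gamma_sf_complement:
  assumes "\<alpha> > 0" "z > 0"
  shows "1 - gamma_sf \<alpha> z = (LBINT t:{0<..<z}. gamma_pdf \<alpha> t)"
proof -
  have i: "set_integrable lborel {0<..<z} (gamma_pdf \<alpha>)" "set_integrable lborel {z..} (gamma_pdf \<alpha>)"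
    by (rule set_integrable_subset[OF gamma_pdf_integral(1)[OF assms(1)]]; use assms in auto)+
  have "{0<..<z} \<union> {z..} = {0<..}" using assms by auto
  moreover have "(LBINT t:{0<..<z} \<union> {z..}. gamma_pdf \<alpha> t) =
      (LBINT t:{0<..<z}. gamma_pdf \<alpha> t) + (LBINT t:{z..}. gamma_pdf \<alpha> t)"
    by (intro set_integral_Un i) auto
  ultimately show ?thesis
    using gamma_pdf_integral(2)[OF assms(1)] by (simp add: gamma_sf_eq[OF assms(1)])
qed

lemma gamma_sf_bounds:
  assumes "\<alpha> > 0" "z \<ge> 0"
  shows "0 \<le> gamma_sf \<alpha> z" "gamma_sf \<alpha> z \<le> 1"
proof -
  show "0 \<le> gamma_sf \<alpha> z"
    unfolding gamma_sf_eq[OF assms(1)] set_lebesgue_integral_def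
    using assms by (intro Bochner_Integration.integral_nonneg) (auto simp: indicator_def gamma_pdf_nonneg)
  have "0 \<le> 1 - gamma_sf \<alpha> z" if "z > 0"
    unfolding gamma_sf_complement[OF assms(1) that] set_lebesgue_integral_def
    using assms by (intro Bochner_Integration.integral_nonneg) (auto simp: indicator_def gamma_pdf_nonneg)
  moreover have "gamma_sf \<alpha> 0 = 1"
    using assms by (simp add: gamma_sf_def upper_Gamma_0 Gamma_real_neq_0)
  ultimately show "gamma_sf \<alpha> z \<le> 1" using assms by (cases "z = 0") auto
qed

lemma DERIV_gamma_sf:
  assumes "\<alpha> > 0" "z > 0"
  shows "(gamma_sf \<alpha> has_real_derivative - gamma_pdf \<alpha> z) (at z)"
proof -
  let ?p = "gamma_pdf \<alpha>"
  \<comment> \<open>The base point \<open>z/2\<close> stays away from 0, where the density is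
    unbounded if \<open>\<alpha> < 1\<close>.\<close>
  have "continuous_on {z/2..2*z} ?p"
    using assms by (intro continuous_at_imp_continuous_on ballI isCont_gamma_pdf) auto
  then have "((\<lambda>u. LBINT y=z/2..u. ?p y) has_vector_derivative ?p z) (at z within {z/2..2*z})"
    by (intro interval_integral_FTC2) (use assms in auto)
  then have "((\<lambda>u. LBINT y=z/2..u. ?p y) has_vector_derivative ?p z) (at z within {z/2<..<2*z})"
    by (rule has_vector_derivative_within_subset) auto
  then have "((\<lambda>u. LBINT y=z/2..u. ?p y) has_real_derivative ?p z) (at z)"
    using assms
    by (subst (asm) has_vector_derivative_within_open)
      (auto simp: has_real_derivative_iff_has_vector_derivative)
  then have "((\<lambda>u. gamma_sf \<alpha> (z/2) - (LBINT y=z/2..u. ?p y)) has_real_derivative - ?p z) (at z)"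
    by (auto intro!: derivative_eq_intros)
  then show ?thesis
  proof (rule DERIV_cong_ev[THEN iffD1, rotated 3])
    have "gamma_sf \<alpha> (z/2) - (LBINT y=z/2..u. ?p y) = gamma_sf \<alpha> u" if "u > z/2" for u
    proof -
      have i: "set_integrable lborel {z/2..<u} ?p" "set_integrable lborel {u..} ?p"
        by (rule set_integrable_subset[OF gamma_pdf_integral(1)[OF assms(1)]]; use assms that in auto)+
      have "{z/2..<u} \<union> {u..} = {z/2..}" using that by auto
      moreover have "(LBINT t:{z/2..<u} \<union> {u..}. ?p t) =
          (LBINT t:{z/2..<u}. ?p t) + (LBINT t:{u..}. ?p t)"
        by (intro set_integral_Un i) auto
      ultimately show ?thesis
        using that by (simp add: gamma_sf_eq[OF assms(1)] interval_integral_Ico)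
    qed
    moreover have "eventually (\<lambda>u. u > z/2) (nhds z)"
      using assms by (intro order_tendstoD(1)[OF filterlim_ident]) auto
    ultimately show "\<forall>\<^sub>F u in nhds z. gamma_sf \<alpha> (z/2) - (LBINT y=z/2..u. ?p y) = gamma_sf \<alpha> u"
      by (auto elim: eventually_mono)
  qed auto
qed

text \<open>Chernoff bound for the upper tail: on \<open>t \<ge> z\<close> the factor
  \<open>exp (\<theta> * (t - z))\<close> is at least 1, and the tilted integral is
  \<open>(1 - \<theta>) powr (- \<alpha>)\<close>. The range \<open>\<theta> \<le> 1/2\<close> is
  where \<open>ln (1 - \<theta>) \<ge> - \<theta> - 2 * \<theta>\<^sup>2\<close> is used.\<close>

lemma gamma_sf_le_exp:
  assumes "\<alpha> > 0" "z \<ge> 0" "0 < \<theta>" "\<theta> \<le> 1/2"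
  shows "gamma_sf \<alpha> z \<le> exp (\<alpha> * (\<theta> + 2 * \<theta>\<^sup>2) - \<theta> * z)"
proof -
  let ?h = "\<lambda>t. t powr (\<alpha> - 1) * exp (- ((1 - \<theta>) * t))"
  note h = Gamma_scaled_integral[OF assms(1), of "1 - \<theta>"]
  have Gp: "Gamma \<alpha> > 0" using assms by (simp add: Gamma_real_pos)
  then have Gn: "Gamma \<alpha> \<noteq> 0" by linarith
  have p: "set_integrable lborel {z..} (gamma_pdf \<alpha>)" if "z > 0"
    by (rule set_integrable_subset[OF gamma_pdf_integral(1)[OF assms(1)]]) (use that in auto)
  have main: "gamma_sf \<alpha> z \<le> exp (\<alpha> * (\<theta> + 2 * \<theta>\<^sup>2) - \<theta> * z)" if z: "z > 0"
  proof -
    have "gamma_sf \<alpha> z \<le> (LBINT t:{0<..}. exp (- \<theta> * z) / Gamma \<alpha> * ?h t)"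
      unfolding gamma_sf_eq[OF assms(1)] set_lebesgue_integral_def
    proof (rule integral_mono)
      show "integrable lborel (\<lambda>x. indicat_real {z..} x *\<^sub>R gamma_pdf \<alpha> x)"
        using p[OF z] by (simp add: set_integrable_def)
      show "integrable lborel (\<lambda>x. indicat_real {0<..} x *\<^sub>R (exp (- \<theta> * z) / Gamma \<alpha> * ?h x))"
        using h(1) assms unfolding set_integrable_def[symmetric] by (intro set_integrable_mult_right) auto
      fix t :: real
      have "exp (-t) \<le> exp (- \<theta> * z) * exp (- ((1 - \<theta>) * t))" if "z \<le> t"
      proof -
        have "\<theta> * z \<le> \<theta> * t" using that assms by (intro mult_left_mono) auto
        then show ?thesis by (simp add: exp_add[symmetric] algebra_simps)
      qed
      then have "z \<le> t \<Longrightarrow> t powr (\<alpha> - 1) * exp (-t) \<le> t powr (\<alpha> - 1) * (exp (- \<theta> * z) * exp (- ((1 - \<theta>) * t)))"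
        by (intro mult_left_mono) auto
      then show "indicat_real {z..} t *\<^sub>R gamma_pdf \<alpha> t \<le> indicat_real {0<..} t *\<^sub>R (exp (- \<theta> * z) / Gamma \<alpha> * ?h t)"
        using z Gp by (auto simp: indicator_def gamma_pdf_def field_simps)
    qed
    also have "\<dots> = exp (- \<theta> * z) / (1 - \<theta>) powr \<alpha>"
      using h(2) assms Gn by simp
    also have "\<dots> = exp (- \<theta> * z - \<alpha> * ln (1 - \<theta>))"
      using assms by (simp add: powr_def exp_diff)
    also have "\<dots> \<le> exp (\<alpha> * (\<theta> + 2 * \<theta>\<^sup>2) - \<theta> * z)"
    proof -
      have "- \<theta> - 2 * \<theta>\<^sup>2 \<le> ln (1 - \<theta>)" using assms by (intro ln_one_minus_pos_lower_bound) auto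
      then have "\<alpha> * (- \<theta> - 2 * \<theta>\<^sup>2) \<le> \<alpha> * ln (1 - \<theta>)" using assms by (intro mult_left_mono) auto
      then show ?thesis by (simp add: algebra_simps)
    qed
    finally show ?thesis .
  qed
  \<comment> \<open>The main argument compares \<open>{z..}\<close> with \<open>{0<..}\<close> and
    hence needs \<open>z > 0\<close>; at 0 the exponent is non-negative and the trivial bound 1
    suffices.\<close>
  show ?thesis
  proof (cases "z = 0")
    case True
    have "gamma_sf \<alpha> z \<le> 1" using gamma_sf_bounds assms by blast
    also have "\<dots> \<le> exp (\<alpha> * (\<theta> + 2 * \<theta>\<^sup>2) - \<theta> * z)" using True assms by simp
    finally show ?thesis .
  qed (use main assms in auto)
qed

text \<open>Lower-tail counterpart with the tilt \<open>exp (\<theta> * (z - t))\<close>, which is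
  at least 1 for \<open>t \<le> z\<close>; the second-order loss is that of
  \<open>ln (1 + \<theta>) \<ge> \<theta> - \<theta>\<^sup>2\<close>.\<close>

lemma gamma_cdf_le_exp:
  assumes "\<alpha> > 0" "z > 0" "0 < \<theta>" "\<theta> \<le> 1"
  shows "1 - gamma_sf \<alpha> z \<le> exp (\<theta> * z - \<alpha> * (\<theta> - \<theta>\<^sup>2))"
proof -
  let ?h = "\<lambda>t. t powr (\<alpha> - 1) * exp (- ((1 + \<theta>) * t))"
  note h = Gamma_scaled_integral[OF assms(1), of "1 + \<theta>"]
  have Gp: "Gamma \<alpha> > 0" using assms by (simp add: Gamma_real_pos)
  then have Gn: "Gamma \<alpha> \<noteq> 0" by linarith
  have p: "set_integrable lborel {0<..<z} (gamma_pdf \<alpha>)"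
    by (rule set_integrable_subset[OF gamma_pdf_integral(1)[OF assms(1)]]) auto
  have "1 - gamma_sf \<alpha> z \<le> (LBINT t:{0<..}. exp (\<theta> * z) / Gamma \<alpha> * ?h t)"
    unfolding gamma_sf_complement[OF assms(1,2)] set_lebesgue_integral_def
  proof (rule integral_mono)
    show "integrable lborel (\<lambda>x. indicat_real {0<..<z} x *\<^sub>R gamma_pdf \<alpha> x)"
      using p by (simp add: set_integrable_def)
    show "integrable lborel (\<lambda>x. indicat_real {0<..} x *\<^sub>R (exp (\<theta> * z) / Gamma \<alpha> * ?h x))"
      using h(1) assms unfolding set_integrable_def[symmetric] by (intro set_integrable_mult_right) auto
    fix t :: real
    have "exp (-t) \<le> exp (\<theta> * z) * exp (- ((1 + \<theta>) * t))" if "t \<le> z"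
    proof -
      have "\<theta> * t \<le> \<theta> * z" using that assms by (intro mult_left_mono) auto
      then show ?thesis by (simp add: exp_add[symmetric] algebra_simps)
    qed
    then have "t \<le> z \<Longrightarrow> t powr (\<alpha> - 1) * exp (-t) \<le> t powr (\<alpha> - 1) * (exp (\<theta> * z) * exp (- ((1 + \<theta>) * t)))"
      by (intro mult_left_mono) auto
    then show "indicat_real {0<..<z} t *\<^sub>R gamma_pdf \<alpha> t \<le> indicat_real {0<..} t *\<^sub>R (exp (\<theta> * z) / Gamma \<alpha> * ?h t)"
      using Gp by (auto simp: indicator_def gamma_pdf_def field_simps)
  qed
  also have "\<dots> = exp (\<theta> * z) / (1 + \<theta>) powr \<alpha>"
    using h(2) assms Gn by simp
  also have "\<dots> = exp (\<theta> * z - \<alpha> * ln (1 + \<theta>))"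
    using assms by (simp add: powr_def exp_diff)
  also have "\<dots> \<le> exp (\<theta> * z - \<alpha> * (\<theta> - \<theta>\<^sup>2))"
  proof -
    have "\<theta> - \<theta>\<^sup>2 \<le> ln (1 + \<theta>)" using assms by (intro ln_one_plus_pos_lower_bound) auto
    then have "\<alpha> * (\<theta> - \<theta>\<^sup>2) \<le> \<alpha> * ln (1 + \<theta>)" using assms by (intro mult_left_mono) auto
    then show ?thesis by simp
  qed
  finally show ?thesis .
qed

text \<open>Transferred from the complex formula: positive reals avoid the poles, and
  \<open>complex_of_real\<close> is injective.\<close>

lemma Gamma_legendre_duplication_real:
  assumes "z > (0 :: real)"
  shows "Gamma z * Gamma (z + 1 / 2) = 2 powr (1 - 2 * z) * sqrt pi * Gamma (2 * z)"
proof -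
  have "complex_of_real z \<notin> \<int>\<^sub>\<le>\<^sub>0" "complex_of_real (z + 1 / 2) \<notin> \<int>\<^sub>\<le>\<^sub>0"
    unfolding of_real_in_nonpos_Ints_iff using assms by (auto simp: nonpos_Ints_def)
  then have "Gamma (complex_of_real z) * Gamma (complex_of_real (z + 1 / 2)) =
      exp (complex_of_real ((1 - 2 * z) * ln 2)) * of_real (sqrt pi) * Gamma (complex_of_real (2 * z))"
    using Gamma_legendre_duplication[of "complex_of_real z"] by simp
  then have "complex_of_real (Gamma z * Gamma (z + 1 / 2)) =
      complex_of_real (exp ((1 - 2 * z) * ln 2) * sqrt pi * Gamma (2 * z))"
    by (simp only: Gamma_complex_of_real exp_of_real of_real_mult[symmetric])
  then show ?thesis by (simp only: of_real_eq_iff powr_def) simp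
qed

text \<open>The Chernoff bound at \<open>\<theta> = 1/2\<close> leaves
  \<open>exp (\<alpha> - t / 2)\<close>, which beats every power of \<open>t\<close>.\<close>

lemma gamma_sf_tendsto_0:
  assumes "\<alpha> > 0"
  shows "((\<lambda>t. t ^ m * gamma_sf \<alpha> t) \<longlongrightarrow> 0) at_top"
proof (rule tendsto_sandwich)
  show "\<forall>\<^sub>F t in at_top. 0 \<le> t ^ m * gamma_sf \<alpha> t"
    using eventually_ge_at_top[of 0] by eventually_elim (use gamma_sf_bounds assms in auto)
  show "\<forall>\<^sub>F t in at_top. t ^ m * gamma_sf \<alpha> t \<le> t ^ m * exp (\<alpha> - t / 2)"
    using eventually_ge_at_top[of 0]
  proof eventually_elim
    case (elim t)
    then show ?case using gamma_sf_le_exp[of \<alpha> t "1/2"] assms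
      by (intro mult_left_mono) (auto simp: power2_eq_square)
  qed
  have "((\<lambda>t. t ^ m * exp (\<alpha> - t / 2)) \<longlongrightarrow> exp \<alpha> * 2 ^ m * 0) at_top"
  proof (rule Lim_transform_eventually)
    have "((\<lambda>t::real. (t / 2) ^ m / exp (t / 2)) \<longlongrightarrow> 0) at_top"
      by (rule filterlim_compose[OF tendsto_power_div_exp_0]) real_asymp
    then show "((\<lambda>t. exp \<alpha> * 2 ^ m * ((t / 2) ^ m / exp (t / 2))) \<longlongrightarrow> exp \<alpha> * 2 ^ m * 0) at_top"
      by (intro tendsto_intros)
    show "\<forall>\<^sub>F t in at_top. exp \<alpha> * 2 ^ m * ((t / 2) ^ m / exp (t / 2)) = t ^ m * exp (\<alpha> - t / 2)"
      by (auto simp: exp_diff power_divide)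
  qed
  then show "((\<lambda>t. t ^ m * exp (\<alpha> - t / 2)) \<longlongrightarrow> 0) at_top" by simp
qed simp

text \<open>For \<open>\<alpha> \<ge> 1\<close> the density is at most
  \<open>1 / Gamma \<alpha>\<close> on (0, 1), so the mass to the left of \<open>z\<close> is at
  most linear in \<open>z\<close>. The shapes occurring in the kernel are \<open>x / b + 1\<close>,
  all above 1.\<close>

lemma gamma_sf_tendsto_1:
  assumes "\<alpha> \<ge> 1"
  shows "(gamma_sf \<alpha> \<longlongrightarrow> 1) (at_right 0)"
proof (rule tendsto_sandwich)
  have Gp: "Gamma \<alpha> > 0" using assms by (simp add: Gamma_real_pos)
  have ev: "\<forall>\<^sub>F z in at_right 0. z \<in> {0<..<1::real}"
    by (rule eventually_at_right_real) simp
  show "\<forall>\<^sub>F z in at_right 0. gamma_sf \<alpha> z \<le> 1"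
    using ev by eventually_elim (use gamma_sf_bounds(2)[of \<alpha>] assms in auto)
  show "\<forall>\<^sub>F z in at_right 0. 1 - z / Gamma \<alpha> \<le> gamma_sf \<alpha> z"
    using ev
  proof eventually_elim
    case (elim z)
    then have "1 - gamma_sf \<alpha> z = (LBINT t:{0<..<z}. gamma_pdf \<alpha> t)"
      using assms by (intro gamma_sf_complement) auto
    also have "\<dots> \<le> (LBINT t:{0<..<z}. 1 / Gamma \<alpha>)"
      unfolding set_lebesgue_integral_def
    proof (rule integral_mono)
      show "integrable lborel (\<lambda>x. indicat_real {0<..<z} x *\<^sub>R gamma_pdf \<alpha> x)"
        unfolding set_integrable_def[symmetric]
        by (rule set_integrable_subset[OF gamma_pdf_integral(1)]) (use assms in auto)
      show "integrable lborel (\<lambda>x. indicat_real {0<..<z} x *\<^sub>R (1 / Gamma \<alpha>))"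
        using elim by (intro integrable_scaleR_left integrable_real_indicator) auto
      fix t
      have "t powr (\<alpha> - 1) * exp (- t) \<le> 1" if "0 < t" "t < z"
      proof -
        have "t powr (\<alpha> - 1) \<le> 1" using that elim assms by (intro powr_le1) auto
        moreover have "exp (- t) \<le> 1" using that by simp
        ultimately show ?thesis by (intro mult_le_one) auto
      qed
      then show "indicat_real {0<..<z} t *\<^sub>R gamma_pdf \<alpha> t \<le> indicat_real {0<..<z} t *\<^sub>R (1 / Gamma \<alpha>)"
        using Gp by (auto simp: indicator_def gamma_pdf_def divide_right_mono)
    qed
    also have "\<dots> = z / Gamma \<alpha>"
      using elim by (simp add: set_lebesgue_integral_def)
    finally show ?case by simp
  qed
  have "((\<lambda>z. 1 - z / Gamma \<alpha>) \<longlongrightarrow> 1 - 0 / Gamma \<alpha>) (at_right 0)"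
    using Gp by (intro tendsto_intros) auto
  then show "((\<lambda>z. 1 - z / Gamma \<alpha>) \<longlongrightarrow> 1) (at_right 0)" by simp
qed simp

section \<open>Exact integrals of the survival function and of its square\<close>

lemma isCont_gamma_sf: "\<alpha> > 0 \<Longrightarrow> z > 0 \<Longrightarrow> isCont (gamma_sf \<alpha>) z"
  using DERIV_gamma_sf DERIV_isCont by blast

text \<open>The tail formula for the mean. The antiderivative comes from integration by parts, with
  \<open>t * gamma_pdf \<alpha> t\<close> rewritten by size biasing; its boundary value at 0 is
  \<open>- \<alpha>\<close>.\<close>

lemma integral_gamma_sf:
  assumes "\<alpha> \<ge> 1"
  shows "set_integrable lborel {0<..} (gamma_sf \<alpha>)" "(LBINT t:{0<..}. gamma_sf \<alpha> t) = \<alpha>"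
proof -
  let ?G = "\<lambda>t. t * gamma_sf \<alpha> t - \<alpha> * gamma_sf (\<alpha> + 1) t"
  have a: "(?G \<longlongrightarrow> 0 * 1 - \<alpha> * 1) (at_right 0)"
    using assms by (intro tendsto_intros gamma_sf_tendsto_1) auto
  have b: "(?G \<longlongrightarrow> 0 - \<alpha> * 0) at_top"
    using assms gamma_sf_tendsto_0[of \<alpha> 1] gamma_sf_tendsto_0[of "\<alpha> + 1" 0]
    by (intro tendsto_intros) auto
  have d: "(?G has_real_derivative gamma_sf \<alpha> t) (at t)" if "t > 0" for t
  proof -
    have "(?G has_real_derivative (1 * gamma_sf \<alpha> t + - gamma_pdf \<alpha> t * t) - \<alpha> * - gamma_pdf (\<alpha> + 1) t) (at t)"
      using assms that by (intro DERIV_diff DERIV_mult DERIV_cmult DERIV_ident DERIV_gamma_sf) auto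
    then show ?thesis using gamma_pdf_Suc[of \<alpha> t] assms that by (simp add: algebra_simps)
  qed
  show "set_integrable lborel {0<..} (gamma_sf \<alpha>)" "(LBINT t:{0<..}. gamma_sf \<alpha> t) = \<alpha>"
    using FTC_halfline_nonneg[OF d _ _ a b] assms isCont_gamma_sf gamma_sf_bounds by auto
qed

text \<open>Half the second moment, by the same integration by parts with size biasing applied
  twice; hence the shape \<open>\<alpha> + 2\<close> in the correction.\<close>

lemma integral_id_gamma_sf:
  assumes "\<alpha> \<ge> 1"
  shows "set_integrable lborel {0<..} (\<lambda>t. t * gamma_sf \<alpha> t)"
    "(LBINT t:{0<..}. t * gamma_sf \<alpha> t) = \<alpha> * (\<alpha> + 1) / 2"
proof -
  let ?G = "\<lambda>t. (t\<^sup>2 * gamma_sf \<alpha> t - \<alpha> * (\<alpha> + 1) * gamma_sf (\<alpha> + 2) t) / 2"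
  have a: "(?G \<longlongrightarrow> (0\<^sup>2 * 1 - \<alpha> * (\<alpha> + 1) * 1) / 2) (at_right 0)"
    using assms by (intro tendsto_intros gamma_sf_tendsto_1) auto
  have b: "(?G \<longlongrightarrow> (0 - \<alpha> * (\<alpha> + 1) * 0) / 2) at_top"
    using assms gamma_sf_tendsto_0[of \<alpha> 2] gamma_sf_tendsto_0[of "\<alpha> + 2" 0]
    by (intro tendsto_intros) auto
  have d: "(?G has_real_derivative t * gamma_sf \<alpha> t) (at t)" if "t > 0" for t
  proof -
    have "(?G has_real_derivative ((2 * t) * gamma_sf \<alpha> t + - gamma_pdf \<alpha> t * t\<^sup>2
        - \<alpha> * (\<alpha> + 1) * - gamma_pdf (\<alpha> + 2) t) / 2) (at t)"
      using assms that
      by (intro DERIV_cdivide DERIV_diff DERIV_mult DERIV_cmult DERIV_gamma_sf)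
        (auto intro!: derivative_eq_intros)
    moreover have "t * (t * gamma_pdf \<alpha> t) = \<alpha> * (\<alpha> + 1) * gamma_pdf (\<alpha> + 2) t"
      using gamma_pdf_Suc[of \<alpha> t] gamma_pdf_Suc[of "\<alpha> + 1" t] assms that
      by (simp add: algebra_simps)
    ultimately show ?thesis by (simp add: algebra_simps power2_eq_square)
  qed
  have c: "isCont (\<lambda>t. t * gamma_sf \<alpha> t) t" if "t > 0" for t
    using isCont_gamma_sf[of \<alpha> t] assms that by (intro continuous_intros) auto
  show "set_integrable lborel {0<..} (\<lambda>t. t * gamma_sf \<alpha> t)"
    "(LBINT t:{0<..}. t * gamma_sf \<alpha> t) = \<alpha> * (\<alpha> + 1) / 2"
    using FTC_halfline_nonneg[OF d c _ a b] assms gamma_sf_bounds by auto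
qed

text \<open>The squared density is an unnormalised Gamma density of shape
  \<open>2 * \<alpha> + 1\<close> and rate 2. The duplication formula at
  \<open>\<alpha> + 1 / 2\<close> splits \<open>Gamma (2 * \<alpha> + 1)\<close>, cancelling one
  factor \<open>Gamma (\<alpha> + 1)\<close> and the power of 2.\<close>

lemma integral_gamma_pdf_square:
  assumes "\<alpha> \<ge> 1"
  shows "set_integrable lborel {0<..} (\<lambda>t. (gamma_pdf (\<alpha> + 1) t)\<^sup>2)"
    "(LBINT t:{0<..}. (gamma_pdf (\<alpha> + 1) t)\<^sup>2) = Gamma (\<alpha> + 1 / 2) / (2 * sqrt pi * Gamma (\<alpha> + 1))"
proof -
  have e: "(gamma_pdf (\<alpha> + 1) t)\<^sup>2 = (t powr ((2 * \<alpha> + 1) - 1) * exp (- (2 * t))) / (Gamma (\<alpha> + 1))\<^sup>2" for t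
  proof -
    have "(t powr \<alpha>)\<^sup>2 = t powr (2 * \<alpha>)"
      by (simp add: power2_eq_square powr_add[symmetric])
    moreover have "(exp (- t))\<^sup>2 = exp (- (2 * t))"
      by (simp add: power2_eq_square exp_add[symmetric])
    ultimately show ?thesis by (simp add: gamma_pdf_def power_divide power_mult_distrib)
  qed
  note I = Gamma_scaled_integral[of "2 * \<alpha> + 1" 2]
  show "set_integrable lborel {0<..} (\<lambda>t. (gamma_pdf (\<alpha> + 1) t)\<^sup>2)"
    unfolding e using I(1) assms by (intro set_integrable_divide) auto
  have a: "\<alpha> + 1 / 2 + 1 / 2 = \<alpha> + 1" "1 - 2 * (\<alpha> + 1 / 2) = - (2 * \<alpha>)" "2 * (\<alpha> + 1 / 2) = 2 * \<alpha> + 1"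
    by auto
  have "Gamma (\<alpha> + 1 / 2) * Gamma (\<alpha> + 1) = inverse (2 powr (2 * \<alpha>)) * sqrt pi * Gamma (2 * \<alpha> + 1)"
    using Gamma_legendre_duplication_real[of "\<alpha> + 1 / 2", unfolded a] assms by (simp add: powr_minus)
  then have L: "Gamma (\<alpha> + 1 / 2) * Gamma (\<alpha> + 1) * 2 powr (2 * \<alpha>) = sqrt pi * Gamma (2 * \<alpha> + 1)"
    by simp
  have "(LBINT t:{0<..}. (gamma_pdf (\<alpha> + 1) t)\<^sup>2)
      = Gamma (2 * \<alpha> + 1) / 2 powr (2 * \<alpha> + 1) / (Gamma (\<alpha> + 1))\<^sup>2"
    unfolding e using I(2) assms by simp
  also have "\<dots> = Gamma (\<alpha> + 1 / 2) / (2 * sqrt pi * Gamma (\<alpha> + 1))"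
  proof -
    have "Gamma (2 * \<alpha> + 1) = Gamma (\<alpha> + 1 / 2) * Gamma (\<alpha> + 1) * 2 powr (2 * \<alpha>) / sqrt pi"
      using L by simp
    then show ?thesis by (simp add: powr_add power2_eq_square)
  qed
  finally show "(LBINT t:{0<..}. (gamma_pdf (\<alpha> + 1) t)\<^sup>2) = Gamma (\<alpha> + 1 / 2) / (2 * sqrt pi * Gamma (\<alpha> + 1))" .
qed

text \<open>This is the mean of the minimum of two independent copies. Differentiating
  \<open>?G\<close> gives the squared survival function plus a multiple of \<open>gamma_pdf
  (\<alpha> + 1) t * (gamma_sf (\<alpha> + 1) t - gamma_sf \<alpha> t)\<close>; the bracket is again
  \<open>gamma_pdf (\<alpha> + 1) t\<close>, so the excess is a squared density, whose integral is
  known.\<close>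

lemma integral_gamma_sf_square:
  assumes "\<alpha> \<ge> 1"
  shows "set_integrable lborel {0<..} (\<lambda>t. (gamma_sf \<alpha> t)\<^sup>2)"
    "(LBINT t:{0<..}. (gamma_sf \<alpha> t)\<^sup>2) = \<alpha> - \<alpha> * Gamma (\<alpha> + 1 / 2) / (sqrt pi * Gamma (\<alpha> + 1))"
proof -
  let ?G = "\<lambda>t. t * (gamma_sf \<alpha> t)\<^sup>2 - \<alpha> * (gamma_sf (\<alpha> + 1) t)\<^sup>2"
  let ?g = "\<lambda>t. (gamma_sf \<alpha> t)\<^sup>2 + 2 * \<alpha> * (gamma_pdf (\<alpha> + 1) t)\<^sup>2"
  have a: "(?G \<longlongrightarrow> 0 * 1\<^sup>2 - \<alpha> * 1\<^sup>2) (at_right 0)"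
    using assms by (intro tendsto_intros gamma_sf_tendsto_1) auto
  have "(?G \<longlongrightarrow> 0 * 0 - \<alpha> * 0\<^sup>2) at_top"
    unfolding power2_eq_square[of "gamma_sf \<alpha> _"] mult.assoc[symmetric]
    using assms gamma_sf_tendsto_0[of \<alpha> 1] gamma_sf_tendsto_0[of \<alpha> 0] gamma_sf_tendsto_0[of "\<alpha> + 1" 0]
    by (intro tendsto_intros) auto
  then have b: "(?G \<longlongrightarrow> 0) at_top" by simp
  \<comment> \<open>The recursion of the incomplete Gamma function in normalised form: the
    difference of the two sides has derivative 0 and vanishes at infinity.\<close>
  have rec: "gamma_sf (\<alpha> + 1) t = gamma_sf \<alpha> t + gamma_pdf (\<alpha> + 1) t" if t: "t > 0" for t
  proof -
    let ?H = "\<lambda>t. gamma_sf (\<alpha> + 1) t - gamma_sf \<alpha> t - gamma_pdf (\<alpha> + 1) t"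
    have H: "(?H has_real_derivative 0) (at u)" if "u > 0" for u
    proof -
      have "(gamma_pdf (\<alpha> + 1) has_real_derivative
          (\<alpha> * u powr (\<alpha> - 1) * exp (- u) + - exp (- u) * u powr \<alpha>) / Gamma (\<alpha> + 1)) (at u)"
        unfolding gamma_pdf_def[abs_def]
        using that assms by (auto intro!: derivative_eq_intros simp: Gamma_real_neq_0 field_simps)
      moreover have "(\<alpha> * u powr (\<alpha> - 1) * exp (- u) + - exp (- u) * u powr \<alpha>) / Gamma (\<alpha> + 1)
          = gamma_pdf \<alpha> u - gamma_pdf (\<alpha> + 1) u"
      proof -
        have "gamma_pdf \<alpha> u = \<alpha> * gamma_pdf (\<alpha> + 1) u / u"
          using gamma_pdf_Suc[of \<alpha> u] that assms by (simp add: field_simps)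
        also have "\<dots> = \<alpha> * u powr (\<alpha> - 1) * exp (- u) / Gamma (\<alpha> + 1)"
          using that by (simp add: gamma_pdf_def powr_diff mult_ac)
        finally show ?thesis by (simp add: gamma_pdf_def diff_divide_distrib)
      qed
      ultimately have "(gamma_pdf (\<alpha> + 1) has_real_derivative gamma_pdf \<alpha> u - gamma_pdf (\<alpha> + 1) u) (at u)"
        by simp
      then have "(?H has_real_derivative - gamma_pdf (\<alpha> + 1) u - - gamma_pdf \<alpha> u
          - (gamma_pdf \<alpha> u - gamma_pdf (\<alpha> + 1) u)) (at u)"
        using that assms by (intro DERIV_diff DERIV_gamma_sf) auto
      then show ?thesis by simp
    qed
    have const: "?H u = ?H t" if "u \<ge> t" for u
    proof (cases "u = t")
      case False
      then have "t < u" using that by simp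
      moreover have "continuous_on {t..u} ?H"
        by (intro continuous_at_imp_continuous_on ballI) (use t in \<open>auto intro: DERIV_isCont[OF H]\<close>)
      ultimately show ?thesis
        by (rule DERIV_isconst_end) (use t H in auto)
    qed simp
    have "(?H \<longlongrightarrow> 0 - 0 - 0) at_top"
    proof (intro tendsto_diff)
      have "((\<lambda>t. t powr \<alpha> * exp (- t)) \<longlongrightarrow> 0) at_top"
        using assms by real_asymp
      from tendsto_divide_zero[OF this, of "Gamma (\<alpha> + 1)"]
      show "(gamma_pdf (\<alpha> + 1) \<longlongrightarrow> 0) at_top" by (simp add: gamma_pdf_def[abs_def])
    qed (use gamma_sf_tendsto_0[of _ 0] assms in auto)
    moreover have "(?H \<longlongrightarrow> ?H t) at_top"
      by (rule tendsto_eventually, rule eventually_mono[OF eventually_ge_at_top[of t]], rule const)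
    ultimately have "?H t = 0 - 0 - 0"
      by (rule tendsto_unique[OF trivial_limit_at_top_linorder, rotated])
    then show ?thesis by simp
  qed
  have d: "(?G has_real_derivative ?g t) (at t)" if "t > 0" for t
  proof -
    have D: "(?G has_real_derivative (1 * (gamma_sf \<alpha> t)\<^sup>2 + (of_nat 2 * (- gamma_pdf \<alpha> t * gamma_sf \<alpha> t ^ (2 - Suc 0))) * t)
       - \<alpha> * (of_nat 2 * (- gamma_pdf (\<alpha> + 1) t * gamma_sf (\<alpha> + 1) t ^ (2 - Suc 0)))) (at t)"
      using assms that
      by (intro DERIV_diff DERIV_mult DERIV_cmult DERIV_ident DERIV_power DERIV_gamma_sf) auto
    have "(1 * (gamma_sf \<alpha> t)\<^sup>2 + (of_nat 2 * (- gamma_pdf \<alpha> t * gamma_sf \<alpha> t ^ (2 - Suc 0))) * t)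
       - \<alpha> * (of_nat 2 * (- gamma_pdf (\<alpha> + 1) t * gamma_sf (\<alpha> + 1) t ^ (2 - Suc 0)))
       = (gamma_sf \<alpha> t)\<^sup>2 - 2 * (t * gamma_pdf \<alpha> t) * gamma_sf \<alpha> t
         + 2 * \<alpha> * gamma_pdf (\<alpha> + 1) t * (gamma_sf \<alpha> t + gamma_pdf (\<alpha> + 1) t)"
      using rec[OF that] by (simp add: algebra_simps)
    also have "\<dots> = ?g t"
      using gamma_pdf_Suc[of \<alpha> t] assms that by (simp add: algebra_simps power2_eq_square)
    finally show ?thesis by (rule DERIV_cong[OF D])
  qed
  have c: "isCont ?g t" if "t > 0" for t
    using isCont_gamma_sf[of \<alpha> t] isCont_gamma_pdf[of t] assms that by (intro continuous_intros) auto
  have p: "set_integrable lborel {0<..} (\<lambda>t. 2 * \<alpha> * (gamma_pdf (\<alpha> + 1) t)\<^sup>2)"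
    using integral_gamma_pdf_square(1)[OF assms] by (intro set_integrable_mult_right) auto
  have g: "set_integrable lborel {0<..} ?g" "(LBINT t:{0<..}. ?g t) = \<alpha>"
    using FTC_halfline_nonneg[OF d c _ a b] assms by auto
  show i: "set_integrable lborel {0<..} (\<lambda>t. (gamma_sf \<alpha> t)\<^sup>2)"
    using set_integral_diff(1)[OF g(1) p] by simp
  have "(LBINT t:{0<..}. ?g t) = (LBINT t:{0<..}. (gamma_sf \<alpha> t)\<^sup>2) + 2 * \<alpha> * (LBINT t:{0<..}. (gamma_pdf (\<alpha> + 1) t)\<^sup>2)"
    using set_integral_add(2)[OF i p] by simp
  then show "(LBINT t:{0<..}. (gamma_sf \<alpha> t)\<^sup>2) = \<alpha> - \<alpha> * Gamma (\<alpha> + 1 / 2) / (sqrt pi * Gamma (\<alpha> + 1))"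
    using g(2) integral_gamma_pdf_square(2)[OF assms] by (simp add: field_simps)
qed

lemma Gamma_half_ratio_le:
  assumes "\<alpha> > 0"
  shows "(Gamma (\<alpha> + 1 / 2))\<^sup>2 \<le> Gamma \<alpha> * Gamma (\<alpha> + 1 :: real)"
proof -
  have p: "Gamma (\<alpha> + 1 / 2) > 0" "Gamma (\<alpha> + 1) > 0" "Gamma \<alpha> > 0"
    using assms by (auto intro!: Gamma_real_pos)
  have "(ln \<circ> Gamma) ((1 - 1/2) *\<^sub>R \<alpha> + (1/2) *\<^sub>R (\<alpha> + 1))
      \<le> (1 - 1/2) * (ln \<circ> Gamma) \<alpha> + (1/2) * (ln \<circ> Gamma) (\<alpha> + 1)"
    using assms by (intro convex_onD[OF log_convex_Gamma_real]) auto
  then have "2 * ln (Gamma (\<alpha> + 1 / 2)) \<le> ln (Gamma \<alpha>) + ln (Gamma (\<alpha> + 1))"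
    by (simp add: field_simps)
  then have "ln ((Gamma (\<alpha> + 1 / 2))\<^sup>2) \<le> ln (Gamma \<alpha> * Gamma (\<alpha> + 1))"
    using ln_realpow[of "Gamma (\<alpha> + 1 / 2)" 2] ln_mult_pos[OF p(3,2)] by simp
  moreover have "(Gamma (\<alpha> + 1 / 2))\<^sup>2 > 0" "Gamma \<alpha> * Gamma (\<alpha> + 1) > 0"
    using p by simp_all
  ultimately show ?thesis by (simp only: ln_le_cancel_iff)
qed

text \<open>The midpoint inequality is used at \<open>\<alpha>\<close> and at
  \<open>\<alpha> + 1 / 2\<close>; the functional equation turns it into an upper and a lower bound.
  Both behave like \<open>1 / sqrt \<alpha>\<close>, which settles the ratio for growing
  shape.\<close>

lemma Gamma_half_ratio_bounds:
  assumes "\<alpha> > 0"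
  shows "Gamma (\<alpha> + 1 / 2) / Gamma (\<alpha> + 1) \<le> 1 / sqrt \<alpha>"
    and "1 / sqrt (\<alpha> + 1 / 2) \<le> Gamma (\<alpha> + 1 / 2) / Gamma (\<alpha> + 1 :: real)"
proof -
  have G: "Gamma (\<alpha> + 1) = \<alpha> * Gamma \<alpha>"
    and G': "Gamma (\<alpha> + 1 / 2 + 1) = (\<alpha> + 1 / 2) * Gamma (\<alpha> + 1 / 2)"
    by (rule Gamma_plus1; use assms in \<open>auto simp: nonpos_Ints_def\<close>)+
  have p: "Gamma (\<alpha> + 1 / 2) > 0" "Gamma (\<alpha> + 1) > 0" "Gamma \<alpha> > 0"
    using assms by (auto intro!: Gamma_real_pos)
  have "(Gamma (\<alpha> + 1 / 2))\<^sup>2 * \<alpha> \<le> Gamma (\<alpha> + 1) * Gamma (\<alpha> + 1)"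
    using mult_right_mono[OF Gamma_half_ratio_le[OF assms], of \<alpha>] assms G by (simp add: algebra_simps)
  then have "(Gamma (\<alpha> + 1 / 2) / Gamma (\<alpha> + 1))\<^sup>2 \<le> 1 / \<alpha>"
    using p assms by (simp add: power_divide field_simps power2_eq_square)
  then show "Gamma (\<alpha> + 1 / 2) / Gamma (\<alpha> + 1) \<le> 1 / sqrt \<alpha>"
    using real_le_rsqrt by (fastforce simp: real_sqrt_divide)
  have "(Gamma (\<alpha> + 1))\<^sup>2 \<le> Gamma (\<alpha> + 1 / 2) * ((\<alpha> + 1 / 2) * Gamma (\<alpha> + 1 / 2))"
    using Gamma_half_ratio_le[of "\<alpha> + 1 / 2"] assms G' by (simp add: algebra_simps)
  then have "1 / (\<alpha> + 1 / 2) \<le> (Gamma (\<alpha> + 1 / 2) / Gamma (\<alpha> + 1))\<^sup>2"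
    using p assms by (simp add: power_divide divide_simps power2_eq_square mult_ac)
  then show "1 / sqrt (\<alpha> + 1 / 2) \<le> Gamma (\<alpha> + 1 / 2) / Gamma (\<alpha> + 1)"
    using p by (metis real_le_lsqrt real_sqrt_divide real_sqrt_one divide_nonneg_pos less_imp_le)
qed

section \<open>The kernel error\<close>

lemma borel_measurable_Gamma_real [measurable]: "(Gamma :: real \<Rightarrow> real) \<in> borel_measurable borel"
proof -
  have "(rGamma :: real \<Rightarrow> real) \<in> borel_measurable borel"
    by (intro borel_measurable_continuous_onI continuous_on_rGamma)
  then have "(\<lambda>x::real. inverse (rGamma x)) \<in> borel_measurable borel" by measurable
  then show ?thesis by (simp add: rGamma_inverse_Gamma)
qed

text \<open>Joint measurability in all arguments is what the later exchanges of integrals rest on;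
  the half-line \<open>{z..}\<close> is treated as a predicate because its end point varies.\<close>

lemma borel_measurable_Kbar_Gam [measurable (raw)]:
  assumes [measurable]: "f \<in> borel_measurable N" "g \<in> borel_measurable N" "h \<in> borel_measurable N"
  shows "(\<lambda>w. Kbar_Gam (f w) (g w) (h w)) \<in> borel_measurable N"
proof -
  have [measurable]: "Measurable.pred (N \<Otimes>\<^sub>M borel) (\<lambda>(w, t). f w / h w \<le> t)"
    by measurable
  show ?thesis
    unfolding Kbar_Gam_def upper_Gamma_def set_lebesgue_integral_def atLeast_def by measurable
qed

definition Kerr :: "real \<Rightarrow> real \<Rightarrow> real \<Rightarrow> real" where
  "Kerr b x t = Kbar_Gam t (x / b + 1) b - indicator {..<x} t"

lemma borel_measurable_Kerr [measurable (raw)]: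
  assumes [measurable]: "f \<in> borel_measurable N" "g \<in> borel_measurable N" "h \<in> borel_measurable N"
  shows "(\<lambda>w. Kerr (h w) (f w) (g w)) \<in> borel_measurable N"
proof -
  have [measurable]: "Measurable.pred N (\<lambda>w. g w < f w)" by measurable
  show ?thesis unfolding Kerr_def lessThan_def by measurable
qed

text \<open>Not the square of \<open>Kerr\<close>: an indicator is its own square, so this is the
  error made by the squared kernel.\<close>

abbreviation Kerr_sq :: "real \<Rightarrow> real \<Rightarrow> real \<Rightarrow> real" where
  "Kerr_sq b x t \<equiv> (Kbar_Gam t (x / b + 1) b)\<^sup>2 - indicator {..<x} t"

lemma Kbar_Gam_eq: "Kbar_Gam t \<alpha> b = gamma_sf \<alpha> (t / b)"
  by (simp add: Kbar_Gam_def gamma_sf_def)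

context
  fixes b x :: real
  assumes b: "b > 0" and x: "x > 0"
begin

lemma Kbar_Gam_bounds:
  assumes "t \<ge> 0"
  shows "0 \<le> Kbar_Gam t (x / b + 1) b" "Kbar_Gam t (x / b + 1) b \<le> 1"
proof -
  have "x / b + 1 > 0" using b x by (simp add: add_pos_pos)
  then show "0 \<le> Kbar_Gam t (x / b + 1) b" "Kbar_Gam t (x / b + 1) b \<le> 1"
    unfolding Kbar_Gam_eq using gamma_sf_bounds[of "x / b + 1" "t / b"] assms b by auto
qed

lemma Kerr_abs_le_1:
  assumes "t \<ge> 0"
  shows "\<bar>Kerr b x t\<bar> \<le> 1"
  using Kbar_Gam_bounds[OF assms] by (auto simp: Kerr_def indicator_def)

text \<open>From \<open>x\<close> on, squaring decreases a number in [0, 1]; below \<open>x\<close>,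
  the inequality 1 - K^2 \<le> 2(1 - K) amounts to (1 - K)^2 \<ge> 0. Absolute bounds for the
  squared kernel thus reduce to those for \<open>Kerr\<close>.\<close>

lemma Kerr_square_le:
  assumes "t \<ge> 0"
  shows "\<bar>Kerr_sq b x t\<bar> \<le> 2 * \<bar>Kerr b x t\<bar>"
proof -
  let ?K = "Kbar_Gam t (x / b + 1) b"
  note K = Kbar_Gam_bounds[OF assms]
  have "?K\<^sup>2 \<le> ?K" using K by (simp add: power2_eq_square mult_left_le)
  moreover have "1 - ?K\<^sup>2 \<le> 2 * (1 - ?K)" using zero_le_power2[of "1 - ?K"] by (simp add: power2_diff)
  moreover have "?K\<^sup>2 \<ge> 0" by simp
  ultimately show ?thesis using K by (auto simp: Kerr_def indicator_def)
qed

text \<open>Chernoff with \<open>\<theta> = l * b\<close> and shape \<open>x / b + 1\<close>, whose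
  product is \<open>l * (x + b)\<close>; so \<open>l\<close> is a rate in the original scale. The
  summand \<open>l * b\<close> is due to the offset of the kernel mean \<open>x + b\<close> from
  \<open>x\<close>.\<close>

lemma Kerr_le_exp:
  assumes t: "t > 0" and l: "0 < l" "l * b \<le> 1 / 2"
  shows "\<bar>Kerr b x t\<bar> \<le> exp (l * b + 2 * l\<^sup>2 * b * (x + b) - l * \<bar>x - t\<bar>)"
proof -
  let ?a = "x / b + 1"
  have a: "?a > 0" using b x by (simp add: add_pos_pos)
  note K = Kbar_Gam_bounds[of t]
  have ab: "?a * (l * b) = l * (x + b)" using b by (simp add: field_simps)
  have ab2: "?a * (l * b)\<^sup>2 = l\<^sup>2 * b * (x + b)" using b by (simp add: field_simps power2_eq_square)
  have lb: "0 < l * b" using b l by simp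
  have tb: "l * b * (t / b) = l * t" using b by simp
  show ?thesis
  proof (cases "t < x")
    case True
    have "0 \<le> l\<^sup>2 * b * (x + b)" using b x by simp
    have "1 - gamma_sf ?a (t / b) \<le> exp (l * b * (t / b) - ?a * (l * b - (l * b)\<^sup>2))"
      using a b t l lb by (intro gamma_cdf_le_exp) auto
    also have "l * b * (t / b) - ?a * (l * b - (l * b)\<^sup>2) = l * t - l * (x + b) + l\<^sup>2 * b * (x + b)"
      unfolding right_diff_distrib tb ab ab2 by simp
    also have "exp \<dots> \<le> exp (l * b + 2 * l\<^sup>2 * b * (x + b) - l * \<bar>x - t\<bar>)"
      using True lb \<open>0 \<le> l\<^sup>2 * b * (x + b)\<close> by (simp add: algebra_simps)
    finally show ?thesis using True K t by (simp add: Kerr_def Kbar_Gam_eq)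
  next
    case False
    have "gamma_sf ?a (t / b) \<le> exp (?a * (l * b + 2 * (l * b)\<^sup>2) - l * b * (t / b))"
      using a b t l lb by (intro gamma_sf_le_exp) auto
    also have "?a * (l * b + 2 * (l * b)\<^sup>2) = ?a * (l * b) + 2 * (?a * (l * b)\<^sup>2)"
      by (simp add: algebra_simps)
    also have "\<dots> - l * b * (t / b) = l * b + 2 * l\<^sup>2 * b * (x + b) - l * \<bar>x - t\<bar>"
      unfolding tb ab ab2 using False by (simp add: algebra_simps)
    finally show ?thesis using False K t by (simp add: Kerr_def Kbar_Gam_eq)
  qed
qed

text \<open>The rate \<open>1 / (4 \<surd>(b (s + b)))\<close> is attached to an intermediate point \<open>s\<close> rather than
  to \<open>x\<close>, so that the bound can be integrated over \<open>x\<close> with a constant rate.\<close>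

lemma Kerr_le_exp_between:
  assumes t: "t > 0" and s: "s > 0" and btw: "x \<le> s \<and> s \<le> t \<or> t \<le> s \<and> s \<le> x"
    and l: "l = 1 / (4 * sqrt (b * (s + b)))"
  shows "\<bar>Kerr b x t\<bar> \<le> 2 * exp (- (l / 2) * \<bar>x - s\<bar>) * exp (- l * \<bar>s - t\<bar>)"
proof -
  have l0: "l > 0" using b s l by simp
  have le: "b \<le> sqrt (b * (s + b))" "sqrt (b * (s + b)) \<le> s + b"
    using b s by (auto intro!: real_le_rsqrt real_le_lsqrt simp: power2_eq_square)
  have r: "sqrt (b * (s + b)) > 0" using le b by linarith
  have lb: "l * b \<le> 1 / 4"
    using le(1) r unfolding l by simp
  \<comment> \<open>The rate is the inverse width at \<open>s\<close>, scaled so that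
    \<open>l * b\<close> is at most 1/4 and the quadratic Chernoff term equals 1/8 when
    \<open>x = s\<close>.\<close>
  have "l\<^sup>2 * (b * (s + b)) = 1 / 16"
    using b s unfolding l by (simp add: power_divide power_mult_distrib)
  then have l2: "l\<^sup>2 * b = 1 / (16 * (s + b))" using b s by (simp add: field_simps)
  have l3: "1 / (s + b) \<le> 4 * l"
    using le(2) r unfolding l by (simp add: frac_le)
  have xs: "(x - s) / 8 \<le> \<bar>x - s\<bar> / 8" by (rule divide_right_mono) auto
  \<comment> \<open>The quadratic term sits at \<open>x\<close> but the rate at \<open>s\<close>;
    the discrepancy is paid with half of the decay in \<open>\<bar>x - s\<bar>\<close>, which leaves
    \<open>l / 2\<close>.\<close>
  have "2 * l\<^sup>2 * b * (x + b) = 2 * (l\<^sup>2 * b) * (x + b)" by simp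
  also have "\<dots> = (x + b) / (8 * (s + b))" unfolding l2 using b s by (simp add: field_simps)
  also have "\<dots> = 1 / 8 + (x - s) / 8 * (1 / (s + b))" using b s by (simp add: field_simps)
  also have "(x - s) / 8 * (1 / (s + b)) \<le> \<bar>x - s\<bar> / 8 * (4 * l)"
    using l3 l0 b s xs by (intro mult_mono) auto
  finally have e: "2 * l\<^sup>2 * b * (x + b) \<le> 1 / 8 + (l / 2) * \<bar>x - s\<bar>" by (simp add: field_simps)
  have d: "\<bar>x - t\<bar> = \<bar>x - s\<bar> + \<bar>s - t\<bar>" using btw by auto
  have "\<bar>Kerr b x t\<bar> \<le> exp (l * b + 2 * l\<^sup>2 * b * (x + b) - l * \<bar>x - t\<bar>)"
    using t l0 lb by (intro Kerr_le_exp) auto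
  also have "\<dots> \<le> exp (1 / 2 + - (l / 2) * \<bar>x - s\<bar> + - l * \<bar>s - t\<bar>)"
    using lb e unfolding d by (simp add: algebra_simps)
  also have "\<dots> = exp (1 / 2) * exp (- (l / 2) * \<bar>x - s\<bar>) * exp (- l * \<bar>s - t\<bar>)"
    by (simp only: exp_add)
  also have "\<dots> \<le> 2 * exp (- (l / 2) * \<bar>x - s\<bar>) * exp (- l * \<bar>s - t\<bar>)"
    using exp_half_le2 by (intro mult_right_mono) auto
  finally show ?thesis .
qed

end

lemma nn_integral_exp_abs:
  assumes "\<mu> > 0"
  shows "(\<integral>\<^sup>+t. ennreal (exp (- \<mu> * \<bar>s - t\<bar>)) \<partial>lborel) = ennreal (2 / \<mu>)"
proof -
  have "((\<lambda>u::real. - exp (- (\<mu> * u)) / \<mu>) \<longlongrightarrow> - exp (- (\<mu> * 0)) / \<mu>) (at_right 0)"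
    using assms by (intro tendsto_intros) auto
  moreover have "((\<lambda>u::real. - exp (- (\<mu> * u)) / \<mu>) \<longlongrightarrow> 0) at_top"
    using assms by real_asymp
  moreover have "((\<lambda>u::real. - exp (- (\<mu> * u)) / \<mu>) has_real_derivative exp (- (\<mu> * u))) (at u)" for u
    using assms by (auto intro!: derivative_eq_intros)
  ultimately have I: "set_integrable lborel {0<..} (\<lambda>u. exp (- (\<mu> * u)))"
    "(LBINT u:{0<..}. exp (- (\<mu> * u))) = 1 / \<mu>"
    using FTC_halfline_nonneg[of "\<lambda>u. - exp (- (\<mu> * u)) / \<mu>" "\<lambda>u. exp (- (\<mu> * u))"]
    by (auto intro!: continuous_intros)
  have J: "(\<integral>\<^sup>+u\<in>{0<..}. ennreal (exp (- (\<mu> * u))) \<partial>lborel) = ennreal (1 / \<mu>)"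
    using set_nn_integral_of_integrable[OF I(1)] I(2) by simp
  have J': "(\<integral>\<^sup>+u\<in>{..<0}. ennreal (exp (\<mu> * u)) \<partial>lborel) = ennreal (1 / \<mu>)"
    unfolding J[symmetric]
    by (subst nn_integral_real_affine[where c = "-1" and t = 0]) (auto intro!: nn_integral_cong simp: indicator_def)
  have "(\<integral>\<^sup>+t. ennreal (exp (- \<mu> * \<bar>s - t\<bar>)) \<partial>lborel) = (\<integral>\<^sup>+u. ennreal (exp (- \<mu> * \<bar>u\<bar>)) \<partial>lborel)"
    by (subst nn_integral_real_affine[where c = 1 and t = s]) auto
  also have "\<dots> = (\<integral>\<^sup>+u. ennreal (exp (- (\<mu> * u))) * indicator {0<..} u + ennreal (exp (\<mu> * u)) * indicator {..<0} u \<partial>lborel)"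
    by (intro nn_integral_cong_AE, rule AE_mp[OF AE_lborel_singleton[of 0]]) (auto simp: indicator_def)
  also have "\<dots> = ennreal (1 / \<mu>) + ennreal (1 / \<mu>)"
    by (subst nn_integral_add) (use J J' in auto)
  also have "\<dots> = ennreal (2 / \<mu>)"
    using assms by (simp add: ennreal_plus[symmetric] del: ennreal_plus)
  finally show ?thesis .
qed

section \<open>Exact moments of the kernel error\<close>

lemma scaled_halfline_integral:
  fixes h :: "real \<Rightarrow> real"
  assumes "b > 0" "set_integrable lborel {0<..} h"
  shows "set_integrable lborel {0<..} (\<lambda>t. h (t / b))"
    "(LBINT t:{0<..}. h (t / b)) = b * (LBINT t:{0<..}. h t)"
proof -
  have i: "indicator {0<..} (0 + 1 / b * t) = (indicator {0<..} t :: real)" for t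
    using assms(1) by (auto simp: indicator_def zero_less_divide_iff)
  show "set_integrable lborel {0<..} (\<lambda>t. h (t / b))"
    using lborel_integrable_real_affine[OF assms(2)[unfolded set_integrable_def], of "1 / b" 0] assms(1)
    unfolding set_integrable_def i by simp
  show "(LBINT t:{0<..}. h (t / b)) = b * (LBINT t:{0<..}. h t)"
    using lborel_integral_real_affine[of "1 / b" "\<lambda>t. indicator {0<..} t *\<^sub>R h t" 0] assms(1)
    unfolding set_lebesgue_integral_def i by simp
qed

lemma integral_below:
  fixes g :: "real \<Rightarrow> real"
  assumes "x > 0" "continuous_on {0..x} g" "\<And>t. (G has_real_derivative g t) (at t)"
  shows "set_integrable lborel {0<..} (\<lambda>t. g t * indicator {..<x} t)"
    "(LBINT t:{0<..}. g t * indicator {..<x} t) = G x - G 0"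
proof -
  have e: "indicator {0<..} t *\<^sub>R (g t * indicator {..<x} t) = indicator {0<..<x} t *\<^sub>R g t" for t :: real
    by (auto simp: indicator_def)
  have "set_integrable lborel {0..x} g"
    by (rule borel_integrable_atLeastAtMost') (use assms in auto)
  then show "set_integrable lborel {0<..} (\<lambda>t. g t * indicator {..<x} t)"
    unfolding set_integrable_def e unfolding set_integrable_def[symmetric]
    by (rule set_integrable_subset) auto
  have "(LBINT t=0..x. g t) = G x - G 0"
    using assms unfolding zero_ereal_def
    by (intro interval_integral_FTC_finite)
      (auto simp: min_def max_def has_real_derivative_iff_has_vector_derivative[symmetric] intro: has_field_derivative_at_within)
  then show "(LBINT t:{0<..}. g t * indicator {..<x} t) = G x - G 0"
    using assms(1) unfolding set_lebesgue_integral_def e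
    by (simp add: interval_integral_Ioo zero_ereal_def set_lebesgue_integral_def)
qed

text \<open>With \<open>T\<close> the kernel variable, of mean \<open>x + b\<close> and second
  moment \<open>(x + b) * (x + 2 * b)\<close>, the three values are E T - x, half of E (T - x)^2,
  and E min(T, T') - x: each is a tail integral for \<open>T\<close> minus the same integral for a
  point mass at \<open>x\<close>.\<close>

lemma Kerr_moments:
  assumes b: "b > 0" and x: "x > 0"
  shows "set_integrable lborel {0<..} (Kerr b x)" "(LBINT t:{0<..}. Kerr b x t) = b"
    "set_integrable lborel {0<..} (\<lambda>t. (t - x) * Kerr b x t)"
    "(LBINT t:{0<..}. (t - x) * Kerr b x t) = b * (x + 2 * b) / 2"
    "set_integrable lborel {0<..} (\<lambda>t. Kerr_sq b x t)"
    "(LBINT t:{0<..}. Kerr_sq b x t)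
      = b - (x + b) / sqrt pi * (Gamma (x / b + 1 + 1 / 2) / Gamma (x / b + 1 + 1))"
proof -
  let ?a = "x / b + 1"
  have a: "?a \<ge> 1" using b x by simp
  note S = scaled_halfline_integral[OF b integral_gamma_sf(1)[OF a], unfolded integral_gamma_sf(2)[OF a]]
  note S1 = scaled_halfline_integral[OF b integral_id_gamma_sf(1)[OF a], unfolded integral_id_gamma_sf(2)[OF a]]
  note S2 = scaled_halfline_integral[OF b integral_gamma_sf_square(1)[OF a], unfolded integral_gamma_sf_square(2)[OF a]]
  have i: "set_integrable lborel {0<..} (\<lambda>t. 1 * indicator {..<x} t :: real)"
      "(LBINT t:{0<..}. 1 * indicator {..<x} t) = x - (0::real)"
    by (rule integral_below[OF x, where G = "\<lambda>t. t"]; auto intro!: continuous_intros derivative_eq_intros)+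
  have i1: "set_integrable lborel {0<..} (\<lambda>t. t * indicator {..<x} t :: real)"
      "(LBINT t:{0<..}. t * indicator {..<x} t) = x\<^sup>2 / 2 - (0::real)\<^sup>2 / 2"
    by (rule integral_below[OF x, where G = "\<lambda>t. t\<^sup>2 / 2"]; auto intro!: continuous_intros derivative_eq_intros)+
  have k1: "set_integrable lborel {0<..} (\<lambda>t. b * (t / b * gamma_sf ?a (t / b)))"
    using S1(1) by (intro set_integrable_mult_right) auto
  show K: "set_integrable lborel {0<..} (Kerr b x)"
    using set_integral_diff(1)[OF S(1) i(1)] by (simp add: Kerr_def[abs_def] Kbar_Gam_eq)
  show EK: "(LBINT t:{0<..}. Kerr b x t) = b"
    using set_integral_diff(2)[OF S(1) i(1)] b unfolding S(2) i(2)
    by (simp add: Kerr_def[abs_def] Kbar_Gam_eq field_simps)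
  have e: "t * Kerr b x t = b * (t / b * gamma_sf ?a (t / b)) - t * indicator {..<x} t" for t
    using b by (simp add: Kerr_def Kbar_Gam_eq algebra_simps)
  have tK: "set_integrable lborel {0<..} (\<lambda>t. t * Kerr b x t)"
    unfolding e using set_integral_diff(1)[OF k1 i1(1)] .
  have EtK: "(LBINT t:{0<..}. t * Kerr b x t) = b * (b * (?a * (?a + 1) / 2)) - x\<^sup>2 / 2"
    unfolding e set_integral_diff(2)[OF k1 i1(1)] set_integral_mult_right S1(2) i1(2) by simp
  have xK: "set_integrable lborel {0<..} (\<lambda>t. x * Kerr b x t)"
    using K by (intro set_integrable_mult_right) auto
  show "set_integrable lborel {0<..} (\<lambda>t. (t - x) * Kerr b x t)"
    using set_integral_diff(1)[OF tK xK] by (simp add: algebra_simps)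
  have "(LBINT t:{0<..}. (t - x) * Kerr b x t) = b * (b * (?a * (?a + 1) / 2)) - x\<^sup>2 / 2 - x * b"
    using set_integral_diff(2)[OF tK xK] EK EtK by (simp add: algebra_simps)
  also have "\<dots> = b * (x + 2 * b) / 2"
    using b by (simp add: field_simps power2_eq_square)
  finally show "(LBINT t:{0<..}. (t - x) * Kerr b x t) = b * (x + 2 * b) / 2" .
  show "set_integrable lborel {0<..} (\<lambda>t. Kerr_sq b x t)"
    using set_integral_diff(1)[OF S2(1) i(1)] by (simp add: Kbar_Gam_eq)
  have "b * (?a - ?a * Gamma (?a + 1 / 2) / (sqrt pi * Gamma (?a + 1))) - x
      = b - (x + b) / sqrt pi * (Gamma (?a + 1 / 2) / Gamma (?a + 1))"
  proof -
    have "b * ?a = x + b" using b by (simp add: field_simps)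
    then show ?thesis by (simp add: right_diff_distrib mult.assoc[symmetric] times_divide_eq_right)
  qed
  then show "(LBINT t:{0<..}. Kerr_sq b x t)
      = b - (x + b) / sqrt pi * (Gamma (x / b + 1 + 1 / 2) / Gamma (x / b + 1 + 1))"
    using set_integral_diff(2)[OF S2(1) i(1)] S2(2) i(2) by (simp add: Kbar_Gam_eq)
qed

section \<open>Integrated bounds on the kernel error\<close>

text \<open>Controls the error attached to \<open>s\<close> that reaches beyond \<open>A\<close>:
  equal to 1 for \<open>s \<ge> A\<close>, and tending to 0 as \<open>A\<close> grows. The 32 is 4 *
  8, an eighth of the rate \<open>1 / (4 * sqrt (b * (s + b)))\<close> with \<open>b\<close>
  replaced by 1.\<close>

definition tail_factor :: "real \<Rightarrow> real \<Rightarrow> real" where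
  "tail_factor A s = exp (- max 0 (A - s) / (32 * sqrt (s + 1)))"

lemma borel_measurable_tail_factor [measurable]: "tail_factor A \<in> borel_measurable borel"
  unfolding tail_factor_def[abs_def] by measurable

lemma tail_factor_bounds: "s \<ge> 0 \<Longrightarrow> 0 \<le> tail_factor A s" "s \<ge> 0 \<Longrightarrow> tail_factor A s \<le> 1"
  by (auto simp: tail_factor_def)

lemma tail_factor_tendsto:
  assumes "s \<ge> 0"
  shows "((\<lambda>A. tail_factor A s) \<longlongrightarrow> 0) at_top"
proof -
  have "32 * sqrt (s + 1) > 0" using assms by simp
  then show ?thesis unfolding tail_factor_def by real_asymp
qed

context
  fixes b s l :: real
  assumes b: "0 < b" "b \<le> 1" and s: "s > 0" and l: "l = 1 / (4 * sqrt (b * (s + b)))"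
begin

lemma rate_pos: "l > 0"
  using b s l by simp

lemma rate_square: "l\<^sup>2 = 1 / (16 * (b * (s + b)))"
  using b s unfolding l by (simp add: power_divide power_mult_distrib)

text \<open>The rate decreases in \<open>b\<close>, so its value at \<open>b = 1\<close> bounds it
  from below for all admissible \<open>b\<close>; beyond \<open>A\<close> the distance to
  \<open>s\<close> is at least \<open>A - s\<close>.\<close>

lemma exp_rate_le_tail_factor:
  assumes "A < x" "\<mu> \<ge> l / 8"
  shows "exp (- \<mu> * \<bar>x - s\<bar>) \<le> tail_factor A s"
proof -
  have r: "b * (s + b) \<le> s + 1" "b * (s + b) > 0"
    using b s mult_mono[of b 1 "s + b" "s + 1"] by auto
  then have "sqrt (b * (s + b)) \<le> sqrt (s + 1)" "0 < sqrt (b * (s + b))" by auto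
  then have "1 / (4 * sqrt (s + 1)) \<le> l"
    unfolding l by (intro divide_left_mono mult_pos_pos) auto
  then have m: "1 / (32 * sqrt (s + 1)) \<le> \<mu>" using assms(2) by simp
  have "max 0 (A - s) * (1 / (32 * sqrt (s + 1))) \<le> \<bar>x - s\<bar> * \<mu>"
    using m assms rate_pos s by (intro mult_mono) (auto simp: max_def)
  then show ?thesis by (simp add: tail_factor_def mult.commute)
qed

text \<open>The data point \<open>s\<close> serves as its own intermediate point, so the rate does
  not depend on the integration variable. Half of \<open>l / 2\<close> yields the tail factor, the
  other half is integrated; \<open>8 / l = 32 * sqrt (b * (s + b))\<close> supplies the factor
  \<open>sqrt b\<close>.\<close>

lemma nn_integral_Kerr_tail:
  assumes A: "A \<ge> 0"
  shows "(\<integral>\<^sup>+x\<in>{A<..}. ennreal \<bar>Kerr b x s\<bar> \<partial>lborel) \<le> ennreal (64 * sqrt b * (sqrt (s + 1) * tail_factor A s))"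
proof -
  note l0 = rate_pos
  have "(\<integral>\<^sup>+x\<in>{A<..}. ennreal \<bar>Kerr b x s\<bar> \<partial>lborel)
     \<le> (\<integral>\<^sup>+x. ennreal (2 * tail_factor A s) * ennreal (exp (- (l / 4) * \<bar>s - x\<bar>)) \<partial>lborel)"
  proof (intro nn_integral_mono)
    fix x :: real
    have "\<bar>Kerr b x s\<bar> \<le> 2 * tail_factor A s * exp (- (l / 4) * \<bar>s - x\<bar>)" if "x > A"
    proof -
      have "\<bar>Kerr b x s\<bar> \<le> 2 * exp (- (l / 2) * \<bar>x - s\<bar>) * exp (- l * \<bar>s - s\<bar>)"
        using that A b s l by (intro Kerr_le_exp_between) auto
      also have "\<dots> = 2 * exp (- (l / 4) * \<bar>x - s\<bar>) * exp (- (l / 4) * \<bar>s - x\<bar>)"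
        by (simp add: mult.assoc exp_add[symmetric] abs_minus_commute)
      also have "\<dots> \<le> 2 * tail_factor A s * exp (- (l / 4) * \<bar>s - x\<bar>)"
        using l0 by (intro mult_right_mono mult_left_mono exp_rate_le_tail_factor that) auto
      finally show ?thesis .
    qed
    then show "ennreal \<bar>Kerr b x s\<bar> * indicator {A<..} x
        \<le> ennreal (2 * tail_factor A s) * ennreal (exp (- (l / 4) * \<bar>s - x\<bar>))"
      using tail_factor_bounds(1)[of s A] s
      by (auto simp: indicator_def ennreal_mult'[symmetric] intro!: ennreal_leI)
  qed
  also have "\<dots> = ennreal (2 * tail_factor A s * (8 / l))"
    using nn_integral_exp_abs[of "l / 4" s] l0 tail_factor_bounds(1)[of s A] s
    by (subst nn_integral_cmult) (auto simp: ennreal_mult'[symmetric])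
  also have "\<dots> \<le> ennreal (64 * sqrt b * (sqrt (s + 1) * tail_factor A s))"
  proof (rule ennreal_leI)
    have "8 / l = 32 * (sqrt b * sqrt (s + b))" unfolding l by (simp add: real_sqrt_mult)
    also have "\<dots> \<le> 32 * (sqrt b * sqrt (s + 1))" using b s by (intro mult_left_mono) auto
    finally have "2 * tail_factor A s * (8 / l) \<le> 2 * tail_factor A s * (32 * (sqrt b * sqrt (s + 1)))"
      using tail_factor_bounds(1)[of s A] s by (intro mult_left_mono) auto
    then show "2 * tail_factor A s * (8 / l) \<le> 64 * sqrt b * (sqrt (s + 1) * tail_factor A s)"
      by (simp add: mult_ac)
  qed
  finally show ?thesis .
qed

text \<open>The decay in \<open>\<bar>s - t\<bar>\<close> is integrated away, that in
  \<open>\<bar>x - s\<bar>\<close> survives: error mass on the far side of \<open>s\<close> is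
  exponentially small in the distance from \<open>x\<close> to \<open>s\<close>.\<close>

lemma nn_integral_Kerr_beyond:
  assumes x: "x > 0"
  shows "(\<integral>\<^sup>+t\<in>{t. 0 < t \<and> (x \<le> s \<and> s \<le> t \<or> t \<le> s \<and> s \<le> x)}. ennreal \<bar>Kerr b x t\<bar> \<partial>lborel)
    \<le> ennreal (4 / l * exp (- (l / 2) * \<bar>x - s\<bar>))"
proof -
  note l0 = rate_pos
  have "(\<integral>\<^sup>+t\<in>{t. 0 < t \<and> (x \<le> s \<and> s \<le> t \<or> t \<le> s \<and> s \<le> x)}. ennreal \<bar>Kerr b x t\<bar> \<partial>lborel)
    \<le> (\<integral>\<^sup>+t. ennreal (2 * exp (- (l / 2) * \<bar>x - s\<bar>)) * ennreal (exp (- l * \<bar>s - t\<bar>)) \<partial>lborel)"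
  proof (intro nn_integral_mono)
    fix t :: real
    show "ennreal \<bar>Kerr b x t\<bar> * indicator {t. 0 < t \<and> (x \<le> s \<and> s \<le> t \<or> t \<le> s \<and> s \<le> x)} t
      \<le> ennreal (2 * exp (- (l / 2) * \<bar>x - s\<bar>)) * ennreal (exp (- l * \<bar>s - t\<bar>))"
    proof (cases "0 < t \<and> (x \<le> s \<and> s \<le> t \<or> t \<le> s \<and> s \<le> x)")
      case True
      then have "\<bar>Kerr b x t\<bar> \<le> 2 * exp (- (l / 2) * \<bar>x - s\<bar>) * exp (- l * \<bar>s - t\<bar>)"
        using b s x l by (intro Kerr_le_exp_between) auto
      then show ?thesis using True by (simp add: ennreal_mult'[symmetric] ennreal_leI)
    qed simp
  qed
  also have "\<dots> = ennreal (4 / l * exp (- (l / 2) * \<bar>x - s\<bar>))"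
    using nn_integral_exp_abs[of l s] l0
    by (subst nn_integral_cmult) (auto simp: ennreal_mult'[symmetric] mult_ac)
  finally show ?thesis .
qed

text \<open>The weight \<open>(x + 2 * b) / (2 * b)\<close> is what Cauchy--Schwarz will leave in
  front. The rate \<open>l / 2\<close> is split as l/4 + l/8 + l/8: against the growth of
  \<open>x\<close>, for the tail factor, and for the integration. Since 1/l^2 = 16 b (s + b), the
  negative powers of \<open>b\<close> cancel and the bound is free of \<open>b\<close>.\<close>

lemma nn_integral_Kerr_beyond_tail:
  assumes A: "A \<ge> 0"
  shows "(\<integral>\<^sup>+x\<in>{A<..}. ennreal ((x + 2 * b) / (2 * b)) *
      (\<integral>\<^sup>+t\<in>{t. 0 < t \<and> (x \<le> s \<and> s \<le> t \<or> t \<le> s \<and> s \<le> x)}. ennreal \<bar>Kerr b x t\<bar> \<partial>lborel) \<partial>lborel)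
    \<le> ennreal (9216 * ((s + 1)\<^sup>2 * tail_factor A s))" (is "?L \<le> _")
proof -
  note l0 = rate_pos
  let ?T = "tail_factor A s"
  have T: "?T \<ge> 0" using tail_factor_bounds s by auto
  have le: "sqrt (b * (s + b)) \<le> s + b"
    using b s by (auto intro!: real_le_lsqrt simp: power2_eq_square)
  let ?C = "36 * (s + b) / (b * l) * ?T"
  have "?L \<le> (\<integral>\<^sup>+x. ennreal ?C * ennreal (exp (- (l / 8) * \<bar>s - x\<bar>)) \<partial>lborel)"
  proof (intro nn_integral_mono)
    fix x :: real
    let ?w = "\<integral>\<^sup>+t\<in>{t. 0 < t \<and> (x \<le> s \<and> s \<le> t \<or> t \<le> s \<and> s \<le> x)}. ennreal \<bar>Kerr b x t\<bar> \<partial>lborel"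
    show "ennreal ((x + 2 * b) / (2 * b)) * ?w * indicator {A<..} x
      \<le> ennreal ?C * ennreal (exp (- (l / 8) * \<bar>s - x\<bar>))"
    proof (cases "x > A")
      case True
      define e where "e = exp (- (l / 4) * \<bar>x - s\<bar>)"
      \<comment> \<open>By \<open>y \<le> exp y\<close>, linear growth in
        \<open>\<bar>x - s\<bar>\<close> costs one inverse rate, which is at most of order
        \<open>s + b\<close>.\<close>
      have "l / 4 * \<bar>x - s\<bar> \<le> exp (l / 4 * \<bar>x - s\<bar>)"
        using exp_ge_add_one_self[of "l / 4 * \<bar>x - s\<bar>"] by linarith
      then have "\<bar>x - s\<bar> \<le> 4 / l * exp (l / 4 * \<bar>x - s\<bar>)"
        using l0 by (simp add: field_simps)
      also have "\<dots> = 16 * sqrt (b * (s + b)) * exp (l / 4 * \<bar>x - s\<bar>)" unfolding l by simp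
      also have "\<dots> \<le> 16 * (s + b) * exp (l / 4 * \<bar>x - s\<bar>)"
        using le by (intro mult_right_mono) auto
      finally have "\<bar>x - s\<bar> * e \<le> 16 * (s + b) * exp (l / 4 * \<bar>x - s\<bar>) * e"
        by (intro mult_right_mono) (auto simp: e_def)
      also have "\<dots> = 16 * (s + b)" by (simp add: e_def exp_minus)
      finally have 1: "\<bar>x - s\<bar> * e \<le> 16 * (s + b)" .
      have "e \<le> 1" using l0 by (simp add: e_def)
      then have 2: "(s + 2 * b) * e \<le> (s + 2 * b) * 1" using b s by (intro mult_left_mono) auto
      have "(x + 2 * b) * e \<le> (s + 2 * b + \<bar>x - s\<bar>) * e"
        by (intro mult_right_mono) (auto simp: e_def)
      also have "\<dots> \<le> 18 * (s + b)" using 1 2 s b by (simp add: distrib_right)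
      finally have 3: "(x + 2 * b) * e \<le> 18 * (s + b)" .
      have e2: "exp (- (l / 2) * \<bar>x - s\<bar>) = e * (exp (- (l / 8) * \<bar>x - s\<bar>) * exp (- (l / 8) * \<bar>s - x\<bar>))"
        by (simp add: e_def exp_add[symmetric] abs_minus_commute)
      have "ennreal ((x + 2 * b) / (2 * b)) * ?w * indicator {A<..} x
        \<le> ennreal ((x + 2 * b) / (2 * b)) * ennreal (4 / l * exp (- (l / 2) * \<bar>x - s\<bar>))"
        using nn_integral_Kerr_beyond[of x] True A by (auto intro!: mult_left_mono)
      also have "\<dots> = ennreal ((x + 2 * b) / (2 * b) * (4 / l * exp (- (l / 2) * \<bar>x - s\<bar>)))"
        using True A b by (intro ennreal_mult'[symmetric]) auto
      also have "(x + 2 * b) / (2 * b) * (4 / l * exp (- (l / 2) * \<bar>x - s\<bar>))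
          = 2 / (b * l) * ((x + 2 * b) * e) * (exp (- (l / 8) * \<bar>x - s\<bar>) * exp (- (l / 8) * \<bar>s - x\<bar>))"
        unfolding e2 using b l0 by (simp add: field_simps)
      also have "ennreal \<dots> \<le> ennreal (2 / (b * l) * (18 * (s + b)) * (?T * exp (- (l / 8) * \<bar>s - x\<bar>)))"
      proof (intro ennreal_leI mult_mono[OF mult_left_mono[OF 3] mult_right_mono])
        show "exp (- (l / 8) * \<bar>x - s\<bar>) \<le> ?T"
          using True by (intro exp_rate_le_tail_factor) auto
      qed (use b l0 s in auto)
      also have "2 / (b * l) * (18 * (s + b)) * (?T * exp (- (l / 8) * \<bar>s - x\<bar>)) = ?C * exp (- (l / 8) * \<bar>s - x\<bar>)"
        by simp
      also have "ennreal \<dots> = ennreal ?C * ennreal (exp (- (l / 8) * \<bar>s - x\<bar>))"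
        using T s b l0 by (intro ennreal_mult) auto
      finally show ?thesis .
    qed simp
  qed
  also have "\<dots> = ennreal (?C * (16 / l))"
    using nn_integral_exp_abs[of "l / 8" s] l0 T s b
    by (subst nn_integral_cmult) (auto simp: ennreal_mult'[symmetric])
  also have "?C * (16 / l) = 576 * (s + b) / (b * l\<^sup>2) * ?T"
    using l0 b by (simp add: power2_eq_square field_simps)
  also have "576 * (s + b) / (b * l\<^sup>2) * ?T = 9216 * ((s + b)\<^sup>2 * ?T)"
    unfolding rate_square using b s by (simp add: power2_eq_square) (simp add: algebra_simps)
  also have "ennreal \<dots> \<le> ennreal (9216 * ((s + 1)\<^sup>2 * ?T))"
    using b s T by (intro ennreal_leI mult_left_mono mult_right_mono power_mono) auto
  finally show ?thesis .
qed

end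

text \<open>One term of the exponential series at \<open>l / 2 * y\<close>: half of the rate pays
  for the power of \<open>y\<close>.\<close>

lemma power_mult_exp_le:
  assumes "l > 0" "y \<ge> (0::real)"
  shows "y ^ m * exp (- l * y) \<le> fact m * (2 / l) ^ m * exp (- (l / 2) * y)"
proof -
  have "z ^ m / fact m \<le> exp z" if "z \<ge> 0" for z :: real
  proof -
    have "(\<Sum>n\<in>{m}. z ^ n /\<^sub>R fact n) \<le> (\<Sum>n. z ^ n /\<^sub>R fact n)"
      by (rule sum_le_suminf[OF summable_exp_generic]) (use that in auto)
    also have "\<dots> = exp z" by (simp only: exp_def)
    finally show ?thesis by (simp add: divide_inverse mult.commute)
  qed
  from this[of "l / 2 * y"] have "(l / 2 * y) ^ m / fact m \<le> exp (l / 2 * y)"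
    using assms by simp
  then have "fact m * (2 / l) ^ m * ((l / 2 * y) ^ m / fact m) \<le> fact m * (2 / l) ^ m * exp (l / 2 * y)"
    using assms by (intro mult_left_mono) auto
  moreover have "fact m * (2 / l) ^ m * ((l / 2 * y) ^ m / fact m) = y ^ m"
    using assms by (simp add: power_mult_distrib power_divide)
  ultimately have "y ^ m * exp (- l * y) \<le> fact m * (2 / l) ^ m * exp (l / 2 * y) * exp (- l * y)"
    by (intro mult_right_mono) auto
  also have "\<dots> = fact m * (2 / l) ^ m * exp (- (l / 2) * y)"
    by (simp add: mult.assoc exp_add[symmetric] field_simps)
  finally show ?thesis .
qed

text \<open>With intermediate point \<open>s = x\<close> only the decay in
  \<open>\<bar>x - t\<bar>\<close> remains. Each power of the distance contributes one kernel width
  \<open>sqrt (b * (x + b))\<close>, and the integration one more.\<close>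

lemma Kerr_abs_moment:
  assumes b: "b > 0" and x: "x > 0"
  shows "(\<integral>\<^sup>+t\<in>{0<..}. ennreal (\<bar>t - x\<bar> ^ m * \<bar>Kerr b x t\<bar>) \<partial>lborel)
    \<le> ennreal (2 * fact m * (8 * sqrt (b * (x + b))) ^ m * (16 * sqrt (b * (x + b))))"
proof -
  define l where "l = 1 / (4 * sqrt (b * (x + b)))"
  have l0: "l > 0" using b x by (simp add: l_def)
  have "(\<integral>\<^sup>+t\<in>{0<..}. ennreal (\<bar>t - x\<bar> ^ m * \<bar>Kerr b x t\<bar>) \<partial>lborel)
    \<le> (\<integral>\<^sup>+t. ennreal (2 * (fact m * (2 / l) ^ m)) * ennreal (exp (- (l / 2) * \<bar>x - t\<bar>)) \<partial>lborel)"
  proof (intro nn_integral_mono)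
    fix t :: real
    show "ennreal (\<bar>t - x\<bar> ^ m * \<bar>Kerr b x t\<bar>) * indicator {0<..} t
        \<le> ennreal (2 * (fact m * (2 / l) ^ m)) * ennreal (exp (- (l / 2) * \<bar>x - t\<bar>))"
    proof (cases "t > 0")
      case True
      then have "\<bar>Kerr b x t\<bar> \<le> 2 * exp (- (l / 2) * \<bar>x - x\<bar>) * exp (- l * \<bar>x - t\<bar>)"
        using b x by (intro Kerr_le_exp_between) (auto simp: l_def)
      then have "\<bar>t - x\<bar> ^ m * \<bar>Kerr b x t\<bar> \<le> \<bar>t - x\<bar> ^ m * (2 * exp (- l * \<bar>x - t\<bar>))"
        by (intro mult_left_mono) auto
      also have "\<dots> \<le> 2 * (fact m * (2 / l) ^ m * exp (- (l / 2) * \<bar>x - t\<bar>))"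
        using power_mult_exp_le[OF l0, of "\<bar>x - t\<bar>" m] by (simp add: abs_minus_commute)
      finally show ?thesis using True l0 by (simp add: ennreal_mult'[symmetric] ennreal_leI)
    qed simp
  qed
  also have "\<dots> = ennreal (2 * (fact m * (2 / l) ^ m) * (4 / l))"
    using nn_integral_exp_abs[of "l / 2" x] l0
    by (subst nn_integral_cmult) (auto simp: ennreal_mult'[symmetric])
  also have "2 * (fact m * (2 / l) ^ m) * (4 / l) = 2 * fact m * (8 * sqrt (b * (x + b))) ^ m * (16 * sqrt (b * (x + b)))"
    by (simp add: l_def)
  finally show ?thesis .
qed

section \<open>Passing to the limit under tightness\<close>

lemma set_integral_tail_tendsto_0:
  fixes v :: "real \<Rightarrow> real"
  assumes "set_integrable lborel {0<..} v"
  shows "((\<lambda>A. LBINT x:{A<..}. \<bar>v x\<bar>) \<longlongrightarrow> 0) at_top"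
proof -
  have v: "integrable lborel (\<lambda>x. indicator {0<..} x *\<^sub>R v x)"
    using assms by (simp add: set_integrable_def)
  have "((\<lambda>A. LBINT x. indicator {A<..} x *\<^sub>R \<bar>indicator {0<..} x *\<^sub>R v x\<bar>) \<longlongrightarrow> (LBINT x::real. (0::real))) at_top"
  proof (rule integral_dominated_convergence_at_top[where w = "\<lambda>x. \<bar>indicator {0<..} x *\<^sub>R v x\<bar>"])
    show "AE x in lborel. ((\<lambda>A. indicator {A<..} x *\<^sub>R \<bar>indicator {0<..} x *\<^sub>R v x\<bar>) \<longlongrightarrow> 0) at_top"
    proof (intro AE_I2 tendsto_eventually)
      fix x :: real
      show "\<forall>\<^sub>F A in at_top. indicator {A<..} x *\<^sub>R \<bar>indicator {0<..} x *\<^sub>R v x\<bar> = 0"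
        using eventually_ge_at_top[of x] by eventually_elim auto
    qed
  qed (use v in \<open>auto simp: indicator_def intro!: eventuallyI\<close>)
  moreover have "\<forall>\<^sub>F A in at_top. (LBINT x. indicator {A<..} x *\<^sub>R \<bar>indicator {0<..} x *\<^sub>R v x\<bar>)
      = (LBINT x:{A<..}. \<bar>v x\<bar>)"
    using eventually_ge_at_top[of 0]
    by eventually_elim
      (auto simp: set_lebesgue_integral_def indicator_def intro!: Bochner_Integration.integral_cong)
  ultimately show ?thesis by (simp add: tendsto_cong)
qed

text \<open>Replaces dominated convergence when there is no common majorant: a constant handles each
  bounded interval, and a tail bound uniform in \<open>n\<close> handles the rest.\<close>

lemma tight_dominated_convergence:
  fixes u :: "nat \<Rightarrow> real \<Rightarrow> real" and v :: "real \<Rightarrow> real"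
  assumes [measurable]: "\<And>n. u n \<in> borel_measurable borel"
    and v: "set_integrable lborel {0<..} v"
    and lim: "\<And>x. x > 0 \<Longrightarrow> (\<lambda>n. u n x) \<longlonglongrightarrow> v x"
    and bdd: "\<And>A. \<exists>C. \<forall>n. \<forall>x\<in>{0<..A}. \<bar>u n x\<bar> \<le> C"
    and tail: "\<And>A n. A \<ge> 0 \<Longrightarrow> (\<integral>\<^sup>+x\<in>{A<..}. ennreal \<bar>u n x\<bar> \<partial>lborel) \<le> ennreal (\<tau> A)"
    and tau: "(\<tau> \<longlongrightarrow> 0) at_top"
  shows "set_integrable lborel {0<..} (u n)"
    and "(\<lambda>n. LBINT x:{0<..}. u n x) \<longlonglongrightarrow> (LBINT x:{0<..}. v x)"
proof -
  have int: "set_integrable lborel {A<..} (u n)" if "A \<ge> 0" for A n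
    unfolding set_integrable_def
  proof (rule integrableI_bounded)
    have "(\<integral>\<^sup>+x. ennreal (norm (indicator {A<..} x *\<^sub>R u n x)) \<partial>lborel)
      = (\<integral>\<^sup>+x\<in>{A<..}. ennreal \<bar>u n x\<bar> \<partial>lborel)"
      by (intro nn_integral_cong) (auto simp: indicator_def)
    also have "\<dots> \<le> ennreal (\<tau> A)" using tail[OF that] .
    also have "\<dots> < \<infinity>" by simp
    finally show "(\<integral>\<^sup>+x. ennreal (norm (indicator {A<..} x *\<^sub>R u n x)) \<partial>lborel) < \<infinity>" .
  qed measurable
  then show "set_integrable lborel {0<..} (u n)" by simp
  \<comment> \<open>\<open>ennreal (\<tau> A)\<close> is 0 for negative \<open>\<tau> A\<close>,
    hence the absolute value in the real form of the bound.\<close>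
  have tail': "\<bar>LBINT x:{A<..}. u n x\<bar> \<le> \<bar>\<tau> A\<bar>" if "A \<ge> 0" for A n
  proof -
    have "ennreal (LBINT x:{A<..}. \<bar>u n x\<bar>) = (\<integral>\<^sup>+x\<in>{A<..}. ennreal \<bar>u n x\<bar> \<partial>lborel)"
      using set_nn_integral_of_integrable[of "{A<..}" "\<lambda>x. \<bar>u n x\<bar>"] set_integrable_abs[OF int[OF that]] by simp
    then have "(LBINT x:{A<..}. \<bar>u n x\<bar>) \<le> \<bar>\<tau> A\<bar>"
      using tail[OF that, of n] by (metis abs_ge_self abs_ge_zero ennreal_le_iff ennreal_leI order_trans)
    moreover have "\<bar>LBINT x:{A<..}. u n x\<bar> \<le> (LBINT x:{A<..}. \<bar>u n x\<bar>)"
      using set_integral_norm_bound[OF int[OF that, of n]] by simp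
    ultimately show ?thesis by linarith
  qed
  show "(\<lambda>n. LBINT x:{0<..}. u n x) \<longlonglongrightarrow> (LBINT x:{0<..}. v x)"
  proof (rule tendstoI)
    fix e :: real assume e: "e > 0"
    have "\<forall>\<^sub>F A in at_top. \<bar>\<tau> A\<bar> < e / 4" "\<forall>\<^sub>F A in at_top. \<bar>LBINT x:{A<..}. \<bar>v x\<bar>\<bar> < e / 4"
      using tendstoD[OF tau, of "e / 4"] tendstoD[OF set_integral_tail_tendsto_0[OF v], of "e / 4"] e
      by (auto simp: dist_real_def)
    \<comment> \<open>One cut-off serves the tails of all \<open>u n\<close> and of
      \<open>v\<close>; uniformity of the tail bound allows it to be fixed before
      \<open>n\<close>.\<close>
    then have "\<forall>\<^sub>F A in at_top. \<bar>\<tau> A\<bar> < e / 4 \<and> \<bar>LBINT x:{A<..}. \<bar>v x\<bar>\<bar> < e / 4 \<and> A > 0"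
      using eventually_gt_at_top[of 0] by eventually_elim auto
    then obtain A where A: "\<bar>\<tau> A\<bar> < e / 4" "\<bar>LBINT x:{A<..}. \<bar>v x\<bar>\<bar> < e / 4" "A > 0"
      by (metis (no_types, lifting) eventually_at_top_linorder order_refl)
    obtain C where C: "\<And>n x. x \<in> {0<..A} \<Longrightarrow> \<bar>u n x\<bar> \<le> C" using bdd[of A] by blast
    have vm: "(\<lambda>x. indicator {0<..A} x *\<^sub>R v x) \<in> borel_measurable lborel"
    proof -
      have "set_integrable lborel {0<..A} v" by (rule set_integrable_subset[OF v]) auto
      then show ?thesis by (auto simp: set_integrable_def)
    qed
    have Ci: "integrable lborel (\<lambda>x. indicator {0<..A} x *\<^sub>R C)"
      using A by (intro integrable_scaleR_left integrable_real_indicator) auto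
    have "(\<lambda>n. LBINT x. indicator {0<..A} x *\<^sub>R u n x) \<longlonglongrightarrow> (LBINT x. indicator {0<..A} x *\<^sub>R v x)"
      by (rule integral_dominated_convergence[where w = "\<lambda>x. indicator {0<..A} x *\<^sub>R C"])
        (use vm Ci C lim in \<open>auto simp: indicator_def intro!: AE_I2\<close>)
    from tendstoD[OF this, of "e / 4"]
    have "\<forall>\<^sub>F n in sequentially. \<bar>(LBINT x:{0<..A}. u n x) - (LBINT x:{0<..A}. v x)\<bar> < e / 4"
      using e by (simp add: set_lebesgue_integral_def dist_real_def)
    then show "\<forall>\<^sub>F n in sequentially. dist (LBINT x:{0<..}. u n x) (LBINT x:{0<..}. v x) < e"
    proof eventually_elim
      case (elim n)
      have split: "(LBINT x:{0<..}. g x) = (LBINT x:{0<..A}. g x) + (LBINT x:{A<..}. g x)"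
        if "set_integrable lborel {0<..} g" for g :: "real \<Rightarrow> real"
      proof -
        have "{0<..} = {0<..A} \<union> {A<..}" using A by auto
        moreover have "(LBINT x:{0<..A} \<union> {A<..}. g x) = (LBINT x:{0<..A}. g x) + (LBINT x:{A<..}. g x)"
          by (rule set_integral_Un) (use A in \<open>auto intro!: set_integrable_subset[OF that]\<close>)
        ultimately show ?thesis by simp
      qed
      have "\<bar>LBINT x:{A<..}. v x\<bar> \<le> (LBINT x:{A<..}. \<bar>v x\<bar>)"
        using set_integral_norm_bound[of lborel "{A<..}" v] set_integrable_subset[OF v, of "{A<..}"] A by auto
      then show ?case
        using elim tail'[of A n] A split[OF v] split[OF int[of 0 n]] unfolding dist_real_def by linarith
    qed
  qed
qed

section \<open>Bias and second moment of the kernel\<close>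

text \<open>Here \<open>f\<close> and \<open>f'\<close> are set to 0 on the non-positive half-line,
  which makes them Borel functions with one global bound \<open>B\<close>. Derivatives are taken
  only at positive points, so \<open>f\<close> may jump at 0.\<close>

locale smooth_halfline_cdf =
  fixes F f f' :: "real \<Rightarrow> real" and B :: real
  assumes mono_F: "mono F"
    and F_at_0: "(F \<longlongrightarrow> 0) (at_right 0)"
    and F_at_top: "(F \<longlongrightarrow> 1) at_top"
    and DERIV_F: "\<And>x. x > 0 \<Longrightarrow> (F has_real_derivative f x) (at x)"
    and DERIV_f: "\<And>x. x > 0 \<Longrightarrow> (f has_real_derivative f' x) (at x)"
    and cont_f': "continuous_on {0<..} f'"
    and f_nonpos: "\<And>x. x \<le> 0 \<Longrightarrow> f x = 0"
    and f'_nonpos: "\<And>x. x \<le> 0 \<Longrightarrow> f' x = 0"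
    and f_bound: "\<And>x. \<bar>f x\<bar> \<le> B"
    and f'_bound: "\<And>x. \<bar>f' x\<bar> \<le> B"
begin

lemma B_nonneg: "B \<ge> 0"
  using f_bound[of 0] by linarith

lemma cont_f: "continuous_on {0<..} f"
  using DERIV_f by (intro continuous_at_imp_continuous_on ballI DERIV_isCont) auto

lemma borel_measurable_f [measurable]: "f \<in> borel_measurable borel"
  and borel_measurable_f' [measurable]: "f' \<in> borel_measurable borel"
proof -
  have m: "g \<in> borel_measurable borel" if "continuous_on {0<..} g" "\<And>x. x \<le> 0 \<Longrightarrow> g x = 0" for g :: "real \<Rightarrow> real"
  proof -
    have "(\<lambda>x. indicator {0<..} x *\<^sub>R g x) \<in> borel_measurable borel"
      by (intro borel_measurable_continuous_on_indicator that) auto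
    moreover have "(\<lambda>x. indicator {0<..} x *\<^sub>R g x) = g"
      by (rule ext) (use that in \<open>auto simp: indicator_def\<close>)
    ultimately show ?thesis by simp
  qed
  show "f \<in> borel_measurable borel" "f' \<in> borel_measurable borel"
    by (rule m; use cont_f f_nonpos cont_f' f'_nonpos in simp)+
qed

lemma borel_measurable_F [measurable]: "F \<in> borel_measurable borel"
  using mono_F by (rule borel_measurable_mono)

lemma f_nonneg: "f x \<ge> 0"
proof (cases "x > 0")
  case True
  then show ?thesis
    using mono_F by (intro mono_on_imp_deriv_nonneg[OF _ DERIV_F[OF True], of UNIV]) (auto intro: monoD mono_onI)
qed (use f_nonpos in auto)

lemma f_integral: "set_integrable lborel {0<..} f" "(LBINT t:{0<..}. f t) = 1"
proof -
  have "isCont f x" if "x > 0" for x using DERIV_f[OF that] by (rule DERIV_isCont)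
  then show "set_integrable lborel {0<..} f" "(LBINT t:{0<..}. f t) = 1"
    using FTC_halfline_nonneg[OF DERIV_F _ f_nonneg F_at_0 F_at_top] by auto
qed

lemma F_integral:
  assumes "x > 0"
  shows "(LBINT t:{0<..}. f t * indicator {..<x} t) = F x"
proof -
  have "continuous_on {0<..} F"
    using DERIV_F by (intro continuous_at_imp_continuous_on ballI DERIV_isCont) auto
  have a: "((F \<circ> real_of_ereal) \<longlongrightarrow> 0) (at_right 0)"
    unfolding zero_ereal_def by (subst ereal_tendsto_simps1) (use F_at_0 in simp)
  have "isCont F x" using DERIV_F[OF assms] by (rule DERIV_isCont)
  then have "(F \<longlongrightarrow> F x) (at_left x)"
    by (auto simp: isCont_def filterlim_at_split)
  then have b: "((F \<circ> real_of_ereal) \<longlongrightarrow> F x) (at_left (ereal x))"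
    by (subst ereal_tendsto_simps1)
  have "(LBINT t=0..ereal x. f t) = F x - 0"
    by (rule interval_integral_FTC_nonneg[OF _ _ _ _ a b])
      (use assms DERIV_F DERIV_f f_nonneg in \<open>auto intro: DERIV_isCont simp: zero_ereal_def\<close>)
  then show ?thesis
    using assms by (simp add: interval_integral_Ioo zero_ereal_def)
      (auto simp: set_lebesgue_integral_def indicator_def intro!: Bochner_Integration.integral_cong
        elim!: trans[rotated])
qed

lemma f_Lipschitz:
  assumes "x > 0" "t > 0"
  shows "\<bar>f t - f x\<bar> \<le> B * \<bar>t - x\<bar>"
proof -
  have "norm (f t - f x) \<le> B * norm (t - x)"
    by (rule field_differentiable_bound[of "{0<..}" f f'])
      (use DERIV_f f'_bound assms in \<open>auto intro: has_field_derivative_at_within\<close>)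
  then show ?thesis by simp
qed

text \<open>The indicator of \<open>{..<x}\<close> integrates to \<open>F x\<close> against
  \<open>f\<close>, so the first two moments of one kernel value are \<open>F x + bias b x\<close>
  and \<open>F x + sq_bias b x\<close>.\<close>

definition bias :: "real \<Rightarrow> real \<Rightarrow> real" where
  "bias b x = (LBINT t:{0<..}. f t * Kerr b x t)"

definition sq_bias :: "real \<Rightarrow> real \<Rightarrow> real" where
  "sq_bias b x = (LBINT t:{0<..}. f t * Kerr_sq b x t)"

lemma borel_measurable_bias [measurable]: "bias b \<in> borel_measurable borel"
  unfolding bias_def[abs_def] set_lebesgue_integral_def by measurable

lemma borel_measurable_sq_bias [measurable]: "sq_bias b \<in> borel_measurable borel"
proof -
  have [measurable]: "Measurable.pred (borel \<Otimes>\<^sub>M borel) (\<lambda>(x, t). t < (x::real))"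
    by measurable
  show ?thesis unfolding sq_bias_def[abs_def] set_lebesgue_integral_def lessThan_def by measurable
qed

lemma f_mult_integrable:
  assumes [measurable]: "\<kappa> \<in> borel_measurable borel" and "\<And>t. t > 0 \<Longrightarrow> \<bar>\<kappa> t\<bar> \<le> C"
  shows "set_integrable lborel {0<..} (\<lambda>t. f t * \<kappa> t)"
proof (rule set_integrable_bound)
  show "set_integrable lborel {0<..} (\<lambda>t. C * f t)"
    using f_integral(1) by (intro set_integrable_mult_right) auto
  show "set_borel_measurable lborel {0<..} (\<lambda>t. f t * \<kappa> t)"
    unfolding set_borel_measurable_def by measurable
  show "AE t in lborel. t \<in> {0<..} \<longrightarrow> norm (f t * \<kappa> t) \<le> norm (C * f t)"
  proof (intro AE_I2 impI)
    fix t :: real assume "t \<in> {0<..}"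
    then have "\<bar>\<kappa> t\<bar> \<le> \<bar>C\<bar>" using assms(2)[of t] by auto
    then show "norm (f t * \<kappa> t) \<le> norm (C * f t)"
      by (simp add: abs_mult mult.commute[of "\<bar>f t\<bar>"] mult_right_mono)
  qed
qed

lemma f_Kerr_integrable:
  assumes "b > 0" "x > 0"
  shows "set_integrable lborel {0<..} (\<lambda>t. f t * Kerr b x t)"
    "set_integrable lborel {0<..} (\<lambda>t. f t * \<bar>Kerr b x t\<bar>)"
    "set_integrable lborel {0<..} (\<lambda>t. f t * Kerr_sq b x t)"
proof -
  have 2: "\<bar>Kerr_sq b x t\<bar> \<le> 2" if "t > 0" for t
    using Kerr_square_le[OF assms, of t] Kerr_abs_le_1[OF assms, of t] that by linarith
  show "set_integrable lborel {0<..} (\<lambda>t. f t * Kerr_sq b x t)"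
    by (rule f_mult_integrable[OF _ 2]) auto
  show "set_integrable lborel {0<..} (\<lambda>t. f t * Kerr b x t)"
    "set_integrable lborel {0<..} (\<lambda>t. f t * \<bar>Kerr b x t\<bar>)"
    by (rule f_mult_integrable[where C = 1]; use Kerr_abs_le_1[OF assms] in auto)+
qed

lemma bias_abs_le:
  assumes "b > 0" "x > 0"
  shows "\<bar>bias b x\<bar> \<le> (LBINT t:{0<..}. f t * \<bar>Kerr b x t\<bar>)" "\<bar>bias b x\<bar> \<le> 1"
    "\<bar>sq_bias b x\<bar> \<le> 2 * (LBINT t:{0<..}. f t * \<bar>Kerr b x t\<bar>)"
proof -
  note I = f_Kerr_integrable[OF assms]
  show 1: "\<bar>bias b x\<bar> \<le> (LBINT t:{0<..}. f t * \<bar>Kerr b x t\<bar>)"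
    using set_integral_norm_bound[OF I(1)] f_nonneg by (simp add: bias_def abs_mult)
  have "(LBINT t:{0<..}. f t * \<bar>Kerr b x t\<bar>) \<le> (LBINT t:{0<..}. f t)"
    using f_nonneg Kerr_abs_le_1[OF assms] by (intro set_integral_mono I f_integral) (auto simp: mult_left_le)
  then show "\<bar>bias b x\<bar> \<le> 1" using 1 f_integral by simp
  have "\<bar>sq_bias b x\<bar> \<le> (LBINT t:{0<..}. f t * \<bar>Kerr_sq b x t\<bar>)"
    using set_integral_norm_bound[OF I(3)] f_nonneg by (simp add: sq_bias_def abs_mult)
  also have "\<dots> \<le> (LBINT t:{0<..}. 2 * (f t * \<bar>Kerr b x t\<bar>))"
  proof (rule set_integral_mono)
    show "set_integrable lborel {0<..} (\<lambda>t. f t * \<bar>Kerr_sq b x t\<bar>)"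
      using set_integrable_abs[OF I(3)] f_nonneg by (simp add: abs_mult)
    show "set_integrable lborel {0<..} (\<lambda>t. 2 * (f t * \<bar>Kerr b x t\<bar>))"
      using I(2) by (intro set_integrable_mult_right) auto
    fix t :: real assume "t \<in> {0<..}"
    then show "f t * \<bar>Kerr_sq b x t\<bar> \<le> 2 * (f t * \<bar>Kerr b x t\<bar>)"
      using mult_left_mono[OF Kerr_square_le[OF assms, of t] f_nonneg[of t]] by simp
  qed
  finally show "\<bar>sq_bias b x\<bar> \<le> 2 * (LBINT t:{0<..}. f t * \<bar>Kerr b x t\<bar>)" by simp
qed

end

text \<open>The exponents 1 and 3 make the absolute moments integer powers of
  \<open>b * (x + b)\<close>: the linear part costs order \<open>b\<close>, the cubic part order
  \<open>b\<^sup>2\<close>. The factor 2 in the bound on \<open>\<kappa>\<close> admits the squared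
  kernel. The numbers are 2 * 256, and 2 * 98304 rounded up.\<close>

lemma Kerr_remainder_le:
  assumes b: "b > 0" and x: "x > 0"
    and [measurable]: "\<rho> \<in> borel_measurable borel" "\<kappa> \<in> borel_measurable borel"
    and r: "\<And>t. t > 0 \<Longrightarrow> \<bar>\<rho> t\<bar> \<le> c * \<bar>t - x\<bar> + d * \<bar>t - x\<bar> ^ 3" and cd: "c \<ge> 0" "d \<ge> 0"
    and k: "\<And>t. t > 0 \<Longrightarrow> \<bar>\<kappa> t\<bar> \<le> 2 * \<bar>Kerr b x t\<bar>"
  shows "set_integrable lborel {0<..} (\<lambda>t. \<rho> t * \<kappa> t)"
    "\<bar>LBINT t:{0<..}. \<rho> t * \<kappa> t\<bar> \<le> 512 * c * (b * (x + b)) + 200000 * d * (b * (x + b))\<^sup>2"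
proof -
  let ?r = "512 * c * (b * (x + b)) + 200000 * d * (b * (x + b))\<^sup>2"
  let ?I = "\<lambda>m. \<integral>\<^sup>+t\<in>{0<..}. ennreal (\<bar>t - x\<bar> ^ m * \<bar>Kerr b x t\<bar>) \<partial>lborel"
  have s2: "sqrt (b * (x + b)) * sqrt (b * (x + b)) = b * (x + b)" using b x by simp
  have "?I 1 \<le> ennreal (256 * (b * (x + b)))"
    using Kerr_abs_moment[OF b x, of 1] s2 by (simp add: mult.assoc mult.left_commute)
  moreover have "?I 3 \<le> ennreal (98304 * (b * (x + b))\<^sup>2)"
  proof -
    have E: "(2 * fact 3 * (8 * sqrt (b * (x + b))) ^ 3 * (16 * sqrt (b * (x + b))))
        = 98304 * (sqrt (b * (x + b)) * sqrt (b * (x + b)))\<^sup>2"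
      by (simp add: fact_numeral power2_eq_square power3_eq_cube)
    show ?thesis using Kerr_abs_moment[OF b x, of 3] unfolding E s2 .
  qed
  ultimately have "ennreal (2 * c) * ?I 1 + ennreal (2 * d) * ?I 3
      \<le> ennreal (2 * c) * ennreal (256 * (b * (x + b))) + ennreal (2 * d) * ennreal (98304 * (b * (x + b))\<^sup>2)"
    by (intro add_mono mult_left_mono) auto
  also have "\<dots> = ennreal (2 * c * (256 * (b * (x + b))) + 2 * d * (98304 * (b * (x + b))\<^sup>2))"
    using b x cd by (simp add: ennreal_mult'[symmetric] ennreal_plus[symmetric] del: ennreal_plus)
  also have "\<dots> \<le> ennreal ?r"
    using cd b x by (intro ennreal_leI) (simp add: mult_right_mono)
  finally have le: "ennreal (2 * c) * ?I 1 + ennreal (2 * d) * ?I 3 \<le> ennreal ?r" .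
  have "(\<integral>\<^sup>+t. ennreal (norm (indicator {0<..} t *\<^sub>R (\<rho> t * \<kappa> t))) \<partial>lborel)
    \<le> (\<integral>\<^sup>+t. ennreal (2 * c) * (ennreal (\<bar>t - x\<bar> ^ 1 * \<bar>Kerr b x t\<bar>) * indicator {0<..} t)
          + ennreal (2 * d) * (ennreal (\<bar>t - x\<bar> ^ 3 * \<bar>Kerr b x t\<bar>) * indicator {0<..} t) \<partial>lborel)"
  proof (intro nn_integral_mono)
    fix t :: real
    show "ennreal (norm (indicator {0<..} t *\<^sub>R (\<rho> t * \<kappa> t)))
      \<le> ennreal (2 * c) * (ennreal (\<bar>t - x\<bar> ^ 1 * \<bar>Kerr b x t\<bar>) * indicator {0<..} t)
          + ennreal (2 * d) * (ennreal (\<bar>t - x\<bar> ^ 3 * \<bar>Kerr b x t\<bar>) * indicator {0<..} t)"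
    proof (cases "t > 0")
      case True
      have "\<bar>\<rho> t\<bar> * \<bar>\<kappa> t\<bar> \<le> (c * \<bar>t - x\<bar> + d * \<bar>t - x\<bar> ^ 3) * (2 * \<bar>Kerr b x t\<bar>)"
        using r[OF True] k[OF True] by (intro mult_mono) auto
      also have "\<dots> = 2 * c * (\<bar>t - x\<bar> ^ 1 * \<bar>Kerr b x t\<bar>) + 2 * d * (\<bar>t - x\<bar> ^ 3 * \<bar>Kerr b x t\<bar>)"
        by (simp add: algebra_simps)
      finally show ?thesis using True cd
        by (simp add: abs_mult ennreal_mult'[symmetric] ennreal_plus[symmetric] ennreal_leI del: ennreal_plus)
    qed simp
  qed
  also have "\<dots> = ennreal (2 * c) * ?I 1 + ennreal (2 * d) * ?I 3"
    by (simp add: nn_integral_add nn_integral_cmult)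
  also note le
  finally have le': "(\<integral>\<^sup>+t. ennreal (norm (indicator {0<..} t *\<^sub>R (\<rho> t * \<kappa> t))) \<partial>lborel) \<le> ennreal ?r" .
  show "set_integrable lborel {0<..} (\<lambda>t. \<rho> t * \<kappa> t)"
    unfolding set_integrable_def
    by (rule integrableI_bounded) (use le' le_less_trans[OF le' ennreal_less_top] in auto)
  have "ennreal \<bar>LBINT t:{0<..}. \<rho> t * \<kappa> t\<bar> \<le> ennreal ?r"
    using integral_norm_bound_ennreal[OF \<open>set_integrable lborel {0<..} (\<lambda>t. \<rho> t * \<kappa> t)\<close>[unfolded set_integrable_def]] le'
    by (simp add: set_lebesgue_integral_def)
  moreover have "?r \<ge> 0" using b x cd by simp
  ultimately show "\<bar>LBINT t:{0<..}. \<rho> t * \<kappa> t\<bar> \<le> ?r" by simp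
qed

section \<open>Pointwise limits\<close>

text \<open>The Gamma ratio at shape \<open>x / b + 1\<close> lies between
  \<open>1 / sqrt (x / b + 3 / 2)\<close> and \<open>1 / sqrt (x / b + 1)\<close>; multiplied by
  \<open>(x + b) / sqrt b\<close>, both ends tend to \<open>sqrt x\<close>.\<close>

lemma Gamma_ratio_scaled_tendsto:
  assumes x: "x > 0"
  shows "((\<lambda>b. (x + b) / sqrt pi * (Gamma (x / b + 1 + 1 / 2) / Gamma (x / b + 1 + 1)) / sqrt b)
    \<longlongrightarrow> sqrt x / sqrt pi) (at_right 0)"
proof (rule tendsto_sandwich)
  have ev: "\<forall>\<^sub>F b in at_right 0. b > (0::real)" by (rule eventually_at_right_less)
  show "\<forall>\<^sub>F b in at_right 0. (x + b) / sqrt pi * (Gamma (x / b + 1 + 1 / 2) / Gamma (x / b + 1 + 1)) / sqrt b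
     \<le> sqrt (x + b) / sqrt pi"
    using ev
  proof eventually_elim
    case (elim b)
    have "(x + b) / sqrt pi * (Gamma (x / b + 1 + 1 / 2) / Gamma (x / b + 1 + 1)) / sqrt b
      \<le> (x + b) / sqrt pi * (1 / sqrt (x / b + 1)) / sqrt b"
      using elim x
      by (intro divide_right_mono mult_left_mono Gamma_half_ratio_bounds) (auto simp: add_pos_pos)
    also have "sqrt (x / b + 1) = sqrt (x + b) / sqrt b"
      using elim by (simp add: real_sqrt_divide[symmetric] add_divide_distrib)
    also have "(x + b) / sqrt pi * (1 / (sqrt (x + b) / sqrt b)) / sqrt b = (x + b) / sqrt (x + b) / sqrt pi"
      using elim by simp
    also have "\<dots> = sqrt (x + b) / sqrt pi" using elim x by (simp add: real_div_sqrt)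
    finally show ?case .
  qed
  show "\<forall>\<^sub>F b in at_right 0. (x + b) / sqrt (x + 3 / 2 * b) / sqrt pi
      \<le> (x + b) / sqrt pi * (Gamma (x / b + 1 + 1 / 2) / Gamma (x / b + 1 + 1)) / sqrt b"
    using ev
  proof eventually_elim
    case (elim b)
    have "sqrt (x / b + 1 + 1 / 2) = sqrt (x + 3 / 2 * b) / sqrt b"
      using elim by (simp add: real_sqrt_divide[symmetric] add_divide_distrib)
    then have "(x + b) / sqrt (x + 3 / 2 * b) / sqrt pi = (x + b) / sqrt pi * (1 / sqrt (x / b + 1 + 1 / 2)) / sqrt b"
      using elim by simp
    also have "\<dots> \<le> (x + b) / sqrt pi * (Gamma (x / b + 1 + 1 / 2) / Gamma (x / b + 1 + 1)) / sqrt b"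
      using elim x
      by (intro divide_right_mono mult_left_mono Gamma_half_ratio_bounds) (auto simp: add_pos_pos)
    finally show ?case .
  qed
  have "((\<lambda>b. (x + b) / sqrt (x + 3 / 2 * b) / sqrt pi) \<longlongrightarrow> (x + 0) / sqrt (x + 3 / 2 * 0) / sqrt pi) (at_right 0)"
    using x by (intro tendsto_intros) auto
  then show "((\<lambda>b. (x + b) / sqrt (x + 3 / 2 * b) / sqrt pi) \<longlongrightarrow> sqrt x / sqrt pi) (at_right 0)"
    using x by (simp add: real_div_sqrt)
  have "((\<lambda>b. sqrt (x + b) / sqrt pi) \<longlongrightarrow> sqrt (x + 0) / sqrt pi) (at_right 0)"
    by (intro tendsto_intros) auto
  then show "((\<lambda>b. sqrt (x + b) / sqrt pi) \<longlongrightarrow> sqrt x / sqrt pi) (at_right 0)" by simp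
qed

context smooth_halfline_cdf
begin

definition asym_bias :: "real \<Rightarrow> real" where
  "asym_bias x = f x + x / 2 * f' x"

text \<open>First-order Taylor expansion integrated against the exact moments:
  \<open>f x * b + f' x * (b * (x + 2 * b) / 2)\<close> equals
  \<open>b * (asym_bias x + f' x * b)\<close>, and the growth bound on the remainder is passed on
  unchanged.\<close>

lemma bias_expansion:
  assumes x: "x > 0" and b: "b > 0"
    and r: "\<And>t. t > 0 \<Longrightarrow> \<bar>f t - f x - f' x * (t - x)\<bar> \<le> c * \<bar>t - x\<bar> + d * \<bar>t - x\<bar> ^ 3"
    and cd: "c \<ge> 0" "d \<ge> 0"
  shows "\<bar>bias b x - b * (asym_bias x + f' x * b)\<bar> \<le> 512 * c * (b * (x + b)) + 200000 * d * (b * (x + b))\<^sup>2"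
proof -
  note K = Kerr_moments[OF b x]
  let ?\<rho> = "\<lambda>t. f t - f x - f' x * (t - x)"
  have R: "set_integrable lborel {0<..} (\<lambda>t. ?\<rho> t * Kerr b x t)"
    "\<bar>LBINT t:{0<..}. ?\<rho> t * Kerr b x t\<bar> \<le> 512 * c * (b * (x + b)) + 200000 * d * (b * (x + b))\<^sup>2"
    by (rule Kerr_remainder_le[OF b x _ _ r cd]; simp)+
  have i: "set_integrable lborel {0<..} (\<lambda>t. f x * Kerr b x t)"
    "set_integrable lborel {0<..} (\<lambda>t. f' x * ((t - x) * Kerr b x t))"
    using K by (auto intro!: set_integrable_mult_right)
  have e: "f t * Kerr b x t = f x * Kerr b x t + f' x * ((t - x) * Kerr b x t) + ?\<rho> t * Kerr b x t" for t
    by (simp add: algebra_simps)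
  have "bias b x = f x * b + f' x * (b * (x + 2 * b) / 2) + (LBINT t:{0<..}. ?\<rho> t * Kerr b x t)"
    unfolding bias_def e
    using set_integral_add[OF i] R(1) i K by (subst set_integral_add(2)) simp_all
  then show ?thesis using R(2) by (simp add: asym_bias_def algebra_simps add_divide_distrib)
qed

text \<open>Near \<open>x\<close> differentiability makes the remainder
  \<open>c * \<bar>t - x\<bar>\<close> with small \<open>c\<close>. Farther away the Lipschitz bound
  is turned into a cubic one, whose contribution of order \<open>b\<^sup>2\<close> disappears after
  division by \<open>b\<close>.\<close>

lemma bias_tendsto:
  assumes x: "x > 0"
  shows "((\<lambda>b. bias b x / b) \<longlongrightarrow> asym_bias x) (at_right 0)"
proof (rule tendstoI)
  fix e :: real assume e: "e > 0"
  \<comment> \<open>Chosen so that \<open>512 * c * (x + 1) = e / 2\<close>.\<close>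
  define c where "c = e / (1024 * (x + 1))"
  have c: "c > 0" using e x by (simp add: c_def)
  have "(f has_derivative (\<lambda>h. f' x * h)) (at x)"
    using DERIV_f[OF x] by (simp add: has_field_derivative_def)
  then obtain \<delta> where d: "\<delta> > 0" and D: "\<And>t. \<bar>t - x\<bar> < \<delta> \<Longrightarrow> \<bar>f t - f x - f' x * (t - x)\<bar> \<le> c * \<bar>t - x\<bar>"
    using c unfolding has_derivative_at_alt by (metis real_norm_def)
  \<comment> \<open>For positive \<open>t\<close> the remainder is at most
    \<open>2 * B * \<bar>t - x\<bar>\<close>; this \<open>d\<close> lets the cubic dominate it from
    distance \<open>\<delta>\<close> on.\<close>
  define d where "d = 2 * B / \<delta>\<^sup>2"
  have d0: "d \<ge> 0" using B_nonneg by (simp add: d_def)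
  have r: "\<bar>f t - f x - f' x * (t - x)\<bar> \<le> c * \<bar>t - x\<bar> + d * \<bar>t - x\<bar> ^ 3" if t: "t > 0" for t
  proof (cases "\<bar>t - x\<bar> < \<delta>")
    case True
    then show ?thesis using D d0 by (intro add_increasing2) auto
  next
    case False
    have "\<bar>f' x * (t - x)\<bar> \<le> B * \<bar>t - x\<bar>"
      unfolding abs_mult using f'_bound by (intro mult_right_mono) auto
    then have "\<bar>f t - f x - f' x * (t - x)\<bar> \<le> 2 * B * \<bar>t - x\<bar> * 1"
      using f_Lipschitz[OF x t] by linarith
    also have "\<dots> \<le> 2 * B * \<bar>t - x\<bar> * (\<bar>t - x\<bar> / \<delta>)\<^sup>2"
      using False d B_nonneg by (intro mult_left_mono one_le_power) auto
    also have "\<dots> = d * \<bar>t - x\<bar> ^ 3" by (simp add: d_def power_divide power2_eq_square power3_eq_cube)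
    finally show ?thesis using c by (intro add_increasing) auto
  qed
  have "((\<lambda>b. \<bar>f' x\<bar> * b + 200000 * d * (b * (x + b)\<^sup>2)) \<longlongrightarrow> \<bar>f' x\<bar> * 0 + 200000 * d * (0 * (x + 0)\<^sup>2)) (at_right 0)"
    by (intro tendsto_intros)
  then have "((\<lambda>b. \<bar>f' x\<bar> * b + 200000 * d * (b * (x + b)\<^sup>2)) \<longlongrightarrow> 0) (at_right 0)" by simp
  then have "\<forall>\<^sub>F b in at_right 0. \<bar>f' x\<bar> * b + 200000 * d * (b * (x + b)\<^sup>2) < e / 2"
    using e by (intro order_tendstoD(2)[where y = 0]) auto
  moreover have "\<forall>\<^sub>F b in at_right 0. b \<in> {0<..<1::real}"
    by (rule eventually_at_right_real) simp
  ultimately show "\<forall>\<^sub>F b in at_right 0. dist (bias b x / b) (asym_bias x) < e"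
  proof eventually_elim
    case (elim b)
    then have b: "b > 0" "b < 1" by auto
    have "\<bar>bias b x / b - (asym_bias x + f' x * b)\<bar> = \<bar>bias b x - b * (asym_bias x + f' x * b)\<bar> / b"
    proof -
      have "bias b x / b - (asym_bias x + f' x * b) = (bias b x - b * (asym_bias x + f' x * b)) / b"
        using b by (simp add: diff_divide_distrib)
      then show ?thesis using b by (simp only: abs_divide abs_of_pos)
    qed
    also have "\<dots> \<le> (512 * c * (b * (x + b)) + 200000 * d * (b * (x + b))\<^sup>2) / b"
      using bias_expansion[OF x b(1) r] c d0 b by (intro divide_right_mono) auto
    also have "\<dots> = 512 * c * (x + b) + 200000 * d * (b * (x + b)\<^sup>2)"
      using b by (simp add: power2_eq_square field_simps)
    also have "512 * c * (x + b) \<le> 512 * c * (x + 1)" using c b by (intro mult_left_mono) auto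
    also have "512 * c * (x + 1) = e / 2" using x by (simp add: c_def field_simps)
    finally have "\<bar>bias b x / b - (asym_bias x + f' x * b)\<bar> \<le> e / 2 + 200000 * d * (b * (x + b)\<^sup>2)" by simp
    moreover have "\<bar>f' x * b\<bar> = \<bar>f' x\<bar> * b" using b by (simp add: abs_mult)
    ultimately have "\<bar>bias b x / b - asym_bias x\<bar> < e" using elim(1) by linarith
    then show ?case by (simp add: dist_real_def)
  qed
qed

lemma bias_sqrt_tendsto:
  assumes "x > 0"
  shows "((\<lambda>b. bias b x / sqrt b) \<longlongrightarrow> 0) (at_right 0)"
proof -
  have "((\<lambda>b. bias b x / b * sqrt b) \<longlongrightarrow> asym_bias x * sqrt 0) (at_right 0)"
    using bias_tendsto[OF assms] by (intro tendsto_intros)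
  moreover have "\<forall>\<^sub>F b in at_right 0. bias b x / b * sqrt b = bias b x / sqrt b"
    using eventually_at_right_less[of 0]
  proof eventually_elim
    case (elim b)
    have "bias b x / b * sqrt b = bias b x * (sqrt b / b)" by simp
    also have "\<dots> = bias b x / sqrt b"
      using sqrt_divide_self_eq[of b] elim by (simp add: divide_inverse)
    finally show ?case .
  qed
  ultimately show ?thesis by (simp add: tendsto_cong)
qed

text \<open>Freezing \<open>f\<close> at \<open>x\<close> leaves the exact integral of the
  squared-kernel error, governed by the Gamma ratio. The Lipschitz remainder is of order
  \<open>b * (x + b)\<close> and vanishes after division by \<open>sqrt b\<close>.\<close>

lemma sq_bias_tendsto:
  assumes x: "x > 0"
  shows "((\<lambda>b. sq_bias b x / sqrt b) \<longlongrightarrow> - (sqrt x * f x / sqrt pi)) (at_right 0)"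
proof -
  let ?g = "\<lambda>b. (x + b) / sqrt pi * (Gamma (x / b + 1 + 1 / 2) / Gamma (x / b + 1 + 1))"
  have "((\<lambda>b. sq_bias b x / sqrt b - f x * (sqrt b - ?g b / sqrt b)) \<longlongrightarrow> 0) (at_right 0)"
  proof (rule Lim_null_comparison)
    show "\<forall>\<^sub>F b in at_right 0. norm (sq_bias b x / sqrt b - f x * (sqrt b - ?g b / sqrt b))
        \<le> 512 * B * (sqrt b * (x + b))"
      using eventually_at_right_less[of 0]
    proof eventually_elim
      case (elim b)
      note b = this
      note K = Kerr_moments[OF b x]
      let ?\<kappa> = "\<lambda>t. Kerr_sq b x t"
      have R: "set_integrable lborel {0<..} (\<lambda>t. (f t - f x) * ?\<kappa> t)"
        "\<bar>LBINT t:{0<..}. (f t - f x) * ?\<kappa> t\<bar> \<le> 512 * B * (b * (x + b)) + 200000 * 0 * (b * (x + b))\<^sup>2"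
        by (rule Kerr_remainder_le[OF b x, where \<rho> = "\<lambda>t. f t - f x" and \<kappa> = ?\<kappa> and c = B and d = 0];
          use f_Lipschitz[OF x] B_nonneg Kerr_square_le[OF b x] in simp)+
      have i: "set_integrable lborel {0<..} (\<lambda>t. f x * ?\<kappa> t)"
        using K by (auto intro!: set_integrable_mult_right)
      have e: "f t * ?\<kappa> t = f x * ?\<kappa> t + (f t - f x) * ?\<kappa> t" for t
        by (simp add: algebra_simps)
      have "sq_bias b x = f x * (b - ?g b) + (LBINT t:{0<..}. (f t - f x) * ?\<kappa> t)"
        unfolding sq_bias_def e using set_integral_add(2)[OF i R(1)] K(6) by simp
      then have "\<bar>sq_bias b x - f x * (b - ?g b)\<bar> \<le> 512 * B * (b * (x + b))" using R(2) by simp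
      then have "\<bar>sq_bias b x - f x * (b - ?g b)\<bar> / sqrt b \<le> 512 * B * (b * (x + b)) / sqrt b"
        using b by (intro divide_right_mono) auto
      also have "512 * B * (b * (x + b)) / sqrt b = 512 * B * ((b / sqrt b) * (x + b))" by simp
      also have "b / sqrt b = sqrt b" using b by (simp add: real_div_sqrt)
      finally have "\<bar>sq_bias b x - f x * (b - ?g b)\<bar> / sqrt b \<le> 512 * B * (sqrt b * (x + b))" .
      moreover have "sq_bias b x / sqrt b - f x * (sqrt b - ?g b / sqrt b) = (sq_bias b x - f x * (b - ?g b)) / sqrt b"
      proof -
        have "f x * (b - g) / r = f x * (b / r - g / r)" for g r :: real
          by (simp add: diff_divide_distrib right_diff_distrib)
        from this[of "?g b" "sqrt b"]
        have "f x * (b - ?g b) / sqrt b = f x * (b / sqrt b - ?g b / sqrt b)" .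
        then show ?thesis using b by (simp only: diff_divide_distrib[of "sq_bias b x"] real_div_sqrt less_imp_le)
      qed
      ultimately show ?case using b by (simp only: real_norm_def abs_divide) simp
    qed
    have "((\<lambda>b. 512 * B * (sqrt b * (x + b))) \<longlongrightarrow> 512 * B * (sqrt 0 * (x + 0))) (at_right 0)"
      by (intro tendsto_intros)
    then show "((\<lambda>b. 512 * B * (sqrt b * (x + b))) \<longlongrightarrow> 0) (at_right 0)" by simp
  qed
  moreover have "((\<lambda>b. f x * (sqrt b - ?g b / sqrt b)) \<longlongrightarrow> f x * (sqrt 0 - sqrt x / sqrt pi)) (at_right 0)"
    by (intro tendsto_intros Gamma_ratio_scaled_tendsto x)
  ultimately have "((\<lambda>b. (sq_bias b x / sqrt b - f x * (sqrt b - ?g b / sqrt b)) + f x * (sqrt b - ?g b / sqrt b))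
      \<longlongrightarrow> 0 + f x * (sqrt 0 - sqrt x / sqrt pi)) (at_right 0)"
    by (rule tendsto_add)
  then show ?thesis by (simp add: mult.commute)
qed

end

section \<open>The integrated variance\<close>

lemma tail_factor_integral_tendsto_0:
  fixes h :: "real \<Rightarrow> real"
  assumes h: "set_integrable lborel {0<..} h"
  shows "set_integrable lborel {0<..} (\<lambda>s. h s * tail_factor A s)"
    "((\<lambda>A. LBINT s:{0<..}. h s * tail_factor A s) \<longlongrightarrow> 0) at_top"
proof -
  have hi: "integrable lborel (\<lambda>s. indicator {0<..} s *\<^sub>R h s)" using h by (simp add: set_integrable_def)
  have m: "(\<lambda>s. indicator {0<..} s *\<^sub>R (h s * tail_factor A s)) \<in> borel_measurable lborel" for A
  proof -
    have "(\<lambda>s. (indicator {0<..} s *\<^sub>R h s) * tail_factor A s) \<in> borel_measurable lborel"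
      using hi by measurable
    then show ?thesis by (simp add: mult.assoc)
  qed
  have le: "norm (indicator {0<..} s *\<^sub>R (h s * tail_factor A s)) \<le> norm (indicator {0<..} s *\<^sub>R h s)" for s A
    using tail_factor_bounds[of s A] by (auto simp: indicator_def abs_mult mult_left_le)
  show "set_integrable lborel {0<..} (\<lambda>s. h s * tail_factor A s)"
    unfolding set_integrable_def by (rule Bochner_Integration.integrable_bound[OF hi m]) (use le in auto)
  have "((\<lambda>A. LBINT s. indicator {0<..} s *\<^sub>R (h s * tail_factor A s)) \<longlongrightarrow> (LBINT s::real. (0::real))) at_top"
  proof (rule integral_dominated_convergence_at_top[where w = "\<lambda>s. norm (indicator {0<..} s *\<^sub>R h s)"])
    show "AE s in lborel. ((\<lambda>A. indicator {0<..} s *\<^sub>R (h s * tail_factor A s)) \<longlongrightarrow> 0) at_top"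
    proof (intro AE_I2)
      fix s :: real
      show "((\<lambda>A. indicator {0<..} s *\<^sub>R (h s * tail_factor A s)) \<longlongrightarrow> 0) at_top"
        using tendsto_mult_right_zero[OF tail_factor_tendsto[of s], of "h s"]
        by (cases "s > 0") auto
    qed
  qed (use hi m le in \<open>auto intro!: eventuallyI\<close>)
  then show "((\<lambda>A. LBINT s:{0<..}. h s * tail_factor A s) \<longlongrightarrow> 0) at_top"
    by (simp add: set_lebesgue_integral_def)
qed

context smooth_halfline_cdf
begin

text \<open>What remains of \<open>n\<close> times the variance at \<open>x\<close> after removing
  \<open>F x * (1 - F x)\<close>: expand
  \<open>F x + sq_bias b x - (F x + bias b x)\<^sup>2\<close>.\<close>

definition var_err :: "real \<Rightarrow> real \<Rightarrow> real" where
  "var_err b x = sq_bias b x - 2 * F x * bias b x - (bias b x)\<^sup>2"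

lemma borel_measurable_var_err [measurable]: "var_err b \<in> borel_measurable borel"
  unfolding var_err_def[abs_def] by measurable

lemma F_bounds:
  assumes "x > 0"
  shows "0 \<le> F x" "F x \<le> 1"
proof -
  show "0 \<le> F x"
    unfolding F_integral[OF assms, symmetric] set_lebesgue_integral_def
    using f_nonneg by (intro Bochner_Integration.integral_nonneg) auto
  show "F x \<le> 1"
    by (rule tendsto_lowerbound[OF F_at_top])
      (auto intro!: eventually_mono[OF eventually_ge_at_top[of x]] monoD[OF mono_F])
qed

lemma f_abs_Kerr_le:
  assumes "b > 0" "x > 0"
  shows "(LBINT t:{0<..}. f t * \<bar>Kerr b x t\<bar>) \<le> 32 * B * sqrt (b * (x + b))"
proof -
  have K: "set_integrable lborel {0<..} (\<lambda>t. \<bar>Kerr b x t\<bar>)"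
    using set_integrable_abs[OF Kerr_moments(1)[OF assms]] .
  have "ennreal (LBINT t:{0<..}. \<bar>Kerr b x t\<bar>) = (\<integral>\<^sup>+t\<in>{0<..}. ennreal (\<bar>t - x\<bar> ^ 0 * \<bar>Kerr b x t\<bar>) \<partial>lborel)"
    using set_nn_integral_of_integrable[OF K] by simp
  also have "\<dots> \<le> ennreal (32 * sqrt (b * (x + b)))"
    using Kerr_abs_moment[OF assms, of 0] by simp
  finally have 1: "(LBINT t:{0<..}. \<bar>Kerr b x t\<bar>) \<le> 32 * sqrt (b * (x + b))"
    using assms by simp
  have "(LBINT t:{0<..}. f t * \<bar>Kerr b x t\<bar>) \<le> (LBINT t:{0<..}. B * \<bar>Kerr b x t\<bar>)"
    using f_bound f_Kerr_integrable(2)[OF assms] K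
    by (intro set_integral_mono set_integrable_mult_right mult_right_mono) (auto intro: order_trans[OF abs_ge_self])
  also have "\<dots> \<le> B * (32 * sqrt (b * (x + b)))"
    using 1 B_nonneg by (simp add: mult_left_mono)
  finally show ?thesis by simp
qed

text \<open>The 5 is 2 + 2 + 1, one summand for each term of \<open>var_err\<close>, using
  \<open>F x \<le> 1\<close> and \<open>\<bar>bias b x\<bar> \<le> 1\<close>.\<close>

lemma var_err_abs_le:
  assumes "b > 0" "x > 0"
  shows "\<bar>var_err b x\<bar> \<le> 5 * (LBINT t:{0<..}. f t * \<bar>Kerr b x t\<bar>)"
proof -
  note b = bias_abs_le[OF assms]
  have "\<bar>2 * F x * bias b x\<bar> = 2 * (F x * \<bar>bias b x\<bar>)"
    using F_bounds[OF assms(2)] by (simp add: abs_mult)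
  moreover have "F x * \<bar>bias b x\<bar> \<le> \<bar>bias b x\<bar>" using F_bounds[OF assms(2)] by (simp add: mult_left_le_one_le)
  moreover have "(bias b x)\<^sup>2 \<le> \<bar>bias b x\<bar>"
    using mult_left_le_one_le[of "\<bar>bias b x\<bar>" "\<bar>bias b x\<bar>"] b(2) by (simp add: power2_eq_square)
  moreover have "(bias b x)\<^sup>2 \<ge> 0" by simp
  ultimately show ?thesis using b(1,3) unfolding var_err_def by linarith
qed

text \<open>Tonelli moves the integral over \<open>x\<close> inside, where the error for a fixed
  data point \<open>t\<close> decays at a rate attached to \<open>t\<close>. The square-root moment
  of \<open>f\<close> enters through the kernel width at \<open>t\<close>.\<close>

lemma f_abs_Kerr_tail:
  assumes b: "0 < b" "b \<le> 1" and A: "A \<ge> 0"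
    and sq: "set_integrable lborel {0<..} (\<lambda>t. sqrt (t + 1) * f t)"
  shows "(\<integral>\<^sup>+x\<in>{A<..}. ennreal (LBINT t:{0<..}. f t * \<bar>Kerr b x t\<bar>) \<partial>lborel)
    \<le> ennreal (64 * sqrt b * (LBINT t:{0<..}. sqrt (t + 1) * f t * tail_factor A t))"
proof -
  let ?h = "\<lambda>t. sqrt (t + 1) * f t * tail_factor A t"
  have "(\<integral>\<^sup>+x\<in>{A<..}. ennreal (LBINT t:{0<..}. f t * \<bar>Kerr b x t\<bar>) \<partial>lborel)
      = (\<integral>\<^sup>+x. \<integral>\<^sup>+t. ennreal (f t) * (ennreal \<bar>Kerr b x t\<bar> * indicator {A<..} x) * indicator {0<..} t \<partial>lborel \<partial>lborel)"
  proof (intro nn_integral_cong)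
    fix x :: real
    show "ennreal (LBINT t:{0<..}. f t * \<bar>Kerr b x t\<bar>) * indicator {A<..} x
      = (\<integral>\<^sup>+t. ennreal (f t) * (ennreal \<bar>Kerr b x t\<bar> * indicator {A<..} x) * indicator {0<..} t \<partial>lborel)"
    proof (cases "x > A")
      case True
      then have "ennreal (LBINT t:{0<..}. f t * \<bar>Kerr b x t\<bar>) = (\<integral>\<^sup>+t\<in>{0<..}. ennreal (f t * \<bar>Kerr b x t\<bar>) \<partial>lborel)"
        using A b f_nonneg
        by (intro set_nn_integral_of_integrable[symmetric] f_Kerr_integrable) auto
      then show ?thesis using True f_nonneg by (simp add: ennreal_mult' mult_ac)
    qed simp
  qed
  also have "\<dots> = (\<integral>\<^sup>+t. \<integral>\<^sup>+x. ennreal (f t) * (ennreal \<bar>Kerr b x t\<bar> * indicator {A<..} x) * indicator {0<..} t \<partial>lborel \<partial>lborel)"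
    by (intro lborel_pair.Fubini') measurable
  also have "\<dots> \<le> (\<integral>\<^sup>+t. ennreal (64 * sqrt b) * (ennreal (?h t) * indicator {0<..} t) \<partial>lborel)"
  proof (intro nn_integral_mono)
    fix t :: real
    show "(\<integral>\<^sup>+x. ennreal (f t) * (ennreal \<bar>Kerr b x t\<bar> * indicator {A<..} x) * indicator {0<..} t \<partial>lborel)
      \<le> ennreal (64 * sqrt b) * (ennreal (?h t) * indicator {0<..} t)"
    proof (cases "t > 0")
      case True
      have "(\<integral>\<^sup>+x. ennreal (f t) * (ennreal \<bar>Kerr b x t\<bar> * indicator {A<..} x) * indicator {0<..} t \<partial>lborel)
        = ennreal (f t) * (\<integral>\<^sup>+x\<in>{A<..}. ennreal \<bar>Kerr b x t\<bar> \<partial>lborel)"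
        using True by (simp add: nn_integral_cmult)
      also have "\<dots> \<le> ennreal (f t) * ennreal (64 * sqrt b * (sqrt (t + 1) * tail_factor A t))"
        by (intro mult_left_mono nn_integral_Kerr_tail[OF b True refl A]) auto
      also have "\<dots> = ennreal (64 * sqrt b) * ennreal (?h t)"
        using f_nonneg[of t] b by (simp add: ennreal_mult'[symmetric] mult_ac)
      finally show ?thesis using True by simp
    qed simp
  qed
  also have "\<dots> = ennreal (64 * sqrt b) * (\<integral>\<^sup>+t\<in>{0<..}. ennreal (?h t) \<partial>lborel)"
    by (intro nn_integral_cmult) measurable
  also have "(\<integral>\<^sup>+t\<in>{0<..}. ennreal (?h t) \<partial>lborel)
      = ennreal (LBINT t:{0<..}. ?h t)"
    using f_nonneg tail_factor_bounds
    by (intro set_nn_integral_of_integrable tail_factor_integral_tendsto_0(1)[OF sq]) auto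
  also have "ennreal (64 * sqrt b) * \<dots> = ennreal (64 * sqrt b * (LBINT t:{0<..}. ?h t))"
    using b by (intro ennreal_mult'[symmetric]) auto
  finally show ?thesis .
qed

lemma var_err_integral_asymptotics:
  assumes \<beta>: "\<And>n. 0 < \<beta> n" "\<And>n. \<beta> n \<le> 1" "\<beta> \<longlonglongrightarrow> 0"
    and sq: "set_integrable lborel {0<..} (\<lambda>x. sqrt x * f x)"
  shows "set_integrable lborel {0<..} (var_err (\<beta> n))"
    and "(\<lambda>n. (LBINT x:{0<..}. var_err (\<beta> n) x) / sqrt (\<beta> n)) \<longlonglongrightarrow> - (LBINT x:{0<..}. sqrt x * f x / sqrt pi)"
proof -
  have sq1: "set_integrable lborel {0<..} (\<lambda>t. sqrt (t + 1) * f t)"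
  proof (rule set_integrable_bound)
    show "set_integrable lborel {0<..} (\<lambda>t. sqrt t * f t + f t)"
      by (intro set_integral_add sq f_integral)
    show "set_borel_measurable lborel {0<..} (\<lambda>t. sqrt (t + 1) * f t)"
      unfolding set_borel_measurable_def by measurable
    show "AE t in lborel. t \<in> {0<..} \<longrightarrow> norm (sqrt (t + 1) * f t) \<le> norm (sqrt t * f t + f t)"
    proof (intro AE_I2 impI)
      fix t :: real assume "t \<in> {0<..}"
      then have "sqrt (t + 1) \<le> sqrt t + 1" using sqrt_add_le_add_sqrt[of t 1] by simp
      then have "sqrt (t + 1) * f t \<le> (sqrt t + 1) * f t" using f_nonneg by (intro mult_right_mono)
      then show "norm (sqrt (t + 1) * f t) \<le> norm (sqrt t * f t + f t)"
        using f_nonneg[of t] \<open>t \<in> {0<..}\<close> by (simp add: algebra_simps)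
    qed
  qed
  have at: "filterlim \<beta> (at_right 0) sequentially"
    using \<beta> by (intro tendsto_imp_filterlim_at_right) auto
  let ?u = "\<lambda>n x. var_err (\<beta> n) x / sqrt (\<beta> n)"
  \<comment> \<open>320 = 5 * 64, from the bound on \<open>var_err\<close> and from the tail
    estimate; the factors \<open>sqrt (\<beta> n)\<close> cancel, so the tail bound is uniform in
    \<open>n\<close>.\<close>
  let ?\<tau> = "\<lambda>A. 320 * (LBINT t:{0<..}. sqrt (t + 1) * f t * tail_factor A t)"
  have sb: "sqrt (\<beta> n) > 0" for n using \<beta>(1) by simp
  have lim: "(\<lambda>n. ?u n x) \<longlonglongrightarrow> - (sqrt x * f x / sqrt pi)" if x: "x > 0" for x
  proof -
    have s: "(\<lambda>n. sq_bias (\<beta> n) x / sqrt (\<beta> n)) \<longlonglongrightarrow> - (sqrt x * f x / sqrt pi)"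
      and b: "(\<lambda>n. bias (\<beta> n) x / sqrt (\<beta> n)) \<longlonglongrightarrow> 0"
      by (rule filterlim_compose[OF sq_bias_tendsto[OF x] at] filterlim_compose[OF bias_sqrt_tendsto[OF x] at])+
    have "(\<lambda>n. sq_bias (\<beta> n) x / sqrt (\<beta> n) - 2 * F x * (bias (\<beta> n) x / sqrt (\<beta> n))
        - (bias (\<beta> n) x / sqrt (\<beta> n))\<^sup>2 * sqrt (\<beta> n))
        \<longlonglongrightarrow> - (sqrt x * f x / sqrt pi) - 2 * F x * 0 - 0\<^sup>2 * sqrt 0"
      by (intro tendsto_intros s b \<beta>)
    moreover have "?u n x = sq_bias (\<beta> n) x / sqrt (\<beta> n) - 2 * F x * (bias (\<beta> n) x / sqrt (\<beta> n))
        - (bias (\<beta> n) x / sqrt (\<beta> n))\<^sup>2 * sqrt (\<beta> n)" for n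
    proof -
      have "(q / r)\<^sup>2 * r = q\<^sup>2 / r" if "r > 0" for q r :: real
        using that by (simp add: power2_eq_square)
      from this[OF sb[of n]] show ?thesis by (simp add: var_err_def diff_divide_distrib)
    qed
    ultimately show ?thesis by simp
  qed
  have bdd: "\<exists>C. \<forall>n. \<forall>x\<in>{0<..A}. \<bar>?u n x\<bar> \<le> C" for A
  proof (intro exI[of _ "160 * B * sqrt (A + 1)"] allI ballI)
    fix n x assume x: "x \<in> {0<..A}"
    have "\<bar>var_err (\<beta> n) x\<bar> \<le> 5 * (32 * B * sqrt (\<beta> n * (x + \<beta> n)))"
      using var_err_abs_le[of "\<beta> n" x] f_abs_Kerr_le[of "\<beta> n" x] x \<beta>(1)[of n] by simp
    also have "\<dots> \<le> 5 * (32 * B * sqrt (\<beta> n * (A + 1)))"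
      using x \<beta>(1,2)[of n] B_nonneg by (intro mult_left_mono real_sqrt_le_mono add_mono) auto
    also have "\<dots> = 160 * B * sqrt (A + 1) * sqrt (\<beta> n)" by (simp add: real_sqrt_mult)
    finally show "\<bar>?u n x\<bar> \<le> 160 * B * sqrt (A + 1)"
      using sb[of n] by (simp add: abs_divide pos_divide_le_eq)
  qed
  have tail: "(\<integral>\<^sup>+x\<in>{A<..}. ennreal \<bar>?u n x\<bar> \<partial>lborel) \<le> ennreal (?\<tau> A)" if A: "A \<ge> 0" for A n
  proof -
    have [measurable]: "(\<lambda>x. LBINT t:{0<..}. f t * \<bar>Kerr (\<beta> n) x t\<bar>) \<in> borel_measurable borel"
      unfolding set_lebesgue_integral_def by measurable
    have "(\<integral>\<^sup>+x\<in>{A<..}. ennreal \<bar>?u n x\<bar> \<partial>lborel)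
      \<le> (\<integral>\<^sup>+x. ennreal (5 / sqrt (\<beta> n)) * (ennreal (LBINT t:{0<..}. f t * \<bar>Kerr (\<beta> n) x t\<bar>) * indicator {A<..} x) \<partial>lborel)"
    proof (intro nn_integral_mono)
      fix x :: real
      show "ennreal \<bar>?u n x\<bar> * indicator {A<..} x
        \<le> ennreal (5 / sqrt (\<beta> n)) * (ennreal (LBINT t:{0<..}. f t * \<bar>Kerr (\<beta> n) x t\<bar>) * indicator {A<..} x)"
      proof (cases "x > A")
        case True
        have "\<bar>?u n x\<bar> = \<bar>var_err (\<beta> n) x\<bar> / sqrt (\<beta> n)" using sb[of n] by (simp add: abs_divide)
        also have "\<dots> \<le> 5 * (LBINT t:{0<..}. f t * \<bar>Kerr (\<beta> n) x t\<bar>) / sqrt (\<beta> n)"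
          using var_err_abs_le[of "\<beta> n" x] True A \<beta>(1) less_imp_le[OF sb[of n]] by (intro divide_right_mono) auto
        finally show ?thesis using True sb[of n] by (simp add: ennreal_mult'[symmetric] ennreal_leI)
      qed simp
    qed
    also have "\<dots> = ennreal (5 / sqrt (\<beta> n)) * (\<integral>\<^sup>+x\<in>{A<..}. ennreal (LBINT t:{0<..}. f t * \<bar>Kerr (\<beta> n) x t\<bar>) \<partial>lborel)"
      by (intro nn_integral_cmult) measurable
    also have "\<dots> \<le> ennreal (5 / sqrt (\<beta> n)) * ennreal (64 * sqrt (\<beta> n) * (LBINT t:{0<..}. sqrt (t + 1) * f t * tail_factor A t))"
      by (intro mult_left_mono f_abs_Kerr_tail \<beta> A sq1) auto
    also have "\<dots> = ennreal (?\<tau> A)"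
      using sb[of n] by (simp add: ennreal_mult'[symmetric])
    finally show ?thesis .
  qed
  have tau: "(?\<tau> \<longlongrightarrow> 0) at_top"
    using tail_factor_integral_tendsto_0(2)[OF sq1] by (rule tendsto_mult_right_zero)
  have v: "set_integrable lborel {0<..} (\<lambda>x. - (sqrt x * f x / sqrt pi))"
  proof -
    have "set_integrable lborel {0<..} (\<lambda>x. (- 1 / sqrt pi) * (sqrt x * f x))"
      using sq by (intro set_integrable_mult_right)
    then show ?thesis by simp
  qed
  have um: "?u n \<in> borel_measurable borel" for n by measurable
  note T = tight_dominated_convergence[of ?u, OF um v lim bdd tail tau]
  have "set_integrable lborel {0<..} (\<lambda>x. sqrt (\<beta> n) * ?u n x)"
    by (intro set_integrable_mult_right T(1))
  then show "set_integrable lborel {0<..} (var_err (\<beta> n))" using sb[of n] by simp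
  show "(\<lambda>n. (LBINT x:{0<..}. var_err (\<beta> n) x) / sqrt (\<beta> n)) \<longlonglongrightarrow> - (LBINT x:{0<..}. sqrt x * f x / sqrt pi)"
    using T(2) by (simp add: set_lebesgue_integral_def)
qed

end

section \<open>The integrated squared bias\<close>

text \<open>The points on the far side of \<open>s\<close> as seen from \<open>x\<close>. Read the
  other way, \<open>t \<in> beyond x s\<close> says that \<open>s\<close> lies between
  \<open>x\<close> and \<open>t\<close>, the range over which \<open>f'\<close> is integrated to
  give the increment of \<open>f\<close>.\<close>

definition beyond :: "real \<Rightarrow> real \<Rightarrow> real set" where
  "beyond x s = {t. 0 < t \<and> (x \<le> s \<and> s \<le> t \<or> t \<le> s \<and> s \<le> x)}"

definition Kerr_beyond :: "real \<Rightarrow> real \<Rightarrow> real \<Rightarrow> ennreal" where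
  "Kerr_beyond b x s = (\<integral>\<^sup>+t\<in>beyond x s. ennreal \<bar>Kerr b x t\<bar> \<partial>lborel)"

lemma beyond_measurable [measurable (raw)]:
  assumes [measurable]: "f \<in> borel_measurable N" "g \<in> borel_measurable N" "h \<in> borel_measurable N"
  shows "Measurable.pred N (\<lambda>w. h w \<in> beyond (f w) (g w))"
  unfolding beyond_def mem_Collect_eq by measurable

lemma borel_measurable_Kerr_beyond [measurable (raw)]:
  assumes [measurable]: "f \<in> borel_measurable N" "g \<in> borel_measurable N"
  shows "(\<lambda>w. Kerr_beyond b (f w) (g w)) \<in> borel_measurable N"
  unfolding Kerr_beyond_def by measurable

text \<open>The error is non-positive before \<open>x\<close> and non-negative from \<open>x\<close>
  on. Hence the signed first moment about \<open>x\<close>, known exactly, is also the absolute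
  one.\<close>

lemma Kerr_sign:
  assumes "b > 0" "x > 0" "t > 0"
  shows "(t - x) * Kerr b x t = \<bar>t - x\<bar> * \<bar>Kerr b x t\<bar>"
proof -
  have "0 \<le> (t - x) * Kerr b x t"
    using Kbar_Gam_bounds[OF assms(1,2), of t] assms(3)
    by (cases "t < x") (auto simp: Kerr_def mult_nonpos_nonpos mult_nonneg_nonneg)
  then show ?thesis by (simp add: abs_mult[symmetric])
qed

lemma emeasure_between:
  assumes "x > 0" "t > 0"
  shows "emeasure lborel {s. t \<in> beyond x s} = ennreal \<bar>t - x\<bar>"
proof -
  have "{s. t \<in> beyond x s} = {min x t..max x t}"
    using assms by (auto simp: beyond_def min_def max_def)
  then show ?thesis by (auto simp: min_def max_def)
qed

text \<open>By Tonelli each \<open>t\<close> is counted for all \<open>s\<close> between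
  \<open>x\<close> and \<open>t\<close>, a set of length \<open>\<bar>t - x\<bar>\<close>; the total
  mass is therefore the first moment of the error about \<open>x\<close>.\<close>

lemma integral_Kerr_beyond:
  assumes b: "b > 0" and x: "x > 0"
  shows "(\<integral>\<^sup>+s. Kerr_beyond b x s \<partial>lborel) = ennreal (b * (x + 2 * b) / 2)"
proof -
  have "(\<integral>\<^sup>+s. Kerr_beyond b x s \<partial>lborel)
      = (\<integral>\<^sup>+t. \<integral>\<^sup>+s. ennreal \<bar>Kerr b x t\<bar> * indicator (beyond x s) t \<partial>lborel \<partial>lborel)"
    unfolding Kerr_beyond_def by (intro lborel_pair.Fubini') measurable
  also have "\<dots> = (\<integral>\<^sup>+t\<in>{0<..}. ennreal ((t - x) * Kerr b x t) \<partial>lborel)"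
  proof (intro nn_integral_cong)
    fix t :: real
    show "(\<integral>\<^sup>+s. ennreal \<bar>Kerr b x t\<bar> * indicator (beyond x s) t \<partial>lborel)
      = ennreal ((t - x) * Kerr b x t) * indicator {0<..} t"
    proof (cases "t > 0")
      case True
      have "(\<integral>\<^sup>+s. ennreal \<bar>Kerr b x t\<bar> * indicator (beyond x s) t \<partial>lborel)
        = (\<integral>\<^sup>+s. ennreal \<bar>Kerr b x t\<bar> * indicator {s. t \<in> beyond x s} s \<partial>lborel)"
        by (intro nn_integral_cong) (auto simp: indicator_def)
      also have "\<dots> = ennreal \<bar>Kerr b x t\<bar> * ennreal \<bar>t - x\<bar>"
        by (subst nn_integral_cmult_indicator) (simp_all add: emeasure_between[OF x True])
      also have "\<dots> = ennreal ((t - x) * Kerr b x t)"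
        unfolding Kerr_sign[OF b x True] by (simp add: ennreal_mult mult.commute)
      finally show ?thesis using True by simp
    next
      case False
      then show ?thesis by (auto simp: beyond_def indicator_def)
    qed
  qed
  also have "\<dots> = ennreal (LBINT t:{0<..}. (t - x) * Kerr b x t)"
    using Kerr_sign[OF b x] by (intro set_nn_integral_of_integrable Kerr_moments[OF b x]) simp
  also have "\<dots> = ennreal (b * (x + 2 * b) / 2)" by (simp only: Kerr_moments(4)[OF b x])
  finally show ?thesis .
qed

context smooth_halfline_cdf
begin

lemma f_increment_le:
  assumes x: "x > 0" and t: "t > 0"
  shows "ennreal \<bar>f t - f x\<bar> \<le> (\<integral>\<^sup>+s\<in>{s. t \<in> beyond x s}. ennreal \<bar>f' s\<bar> \<partial>lborel)"
proof -
  have e: "{s. t \<in> beyond x s} = {min x t..max x t}"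
    using assms by (auto simp: beyond_def min_def max_def)
  have c: "continuous_on {min x t..max x t} f'"
    by (rule continuous_on_subset[OF cont_f']) (use x t in auto)
  have i: "set_integrable lborel {min x t..max x t} f'"
    using c by (rule borel_integrable_atLeastAtMost')
  have I: "(LBINT s:{p..q}. f' s) = f q - f p" if "0 < p" "p \<le> q" for p q
  proof -
    have "continuous_on {min p q..max p q} f'"
      by (rule continuous_on_subset[OF cont_f']) (use that in auto)
    then have "(LBINT s=p..q. f' s) = f q - f p"
      using that
      by (intro interval_integral_FTC_finite)
        (auto intro!: has_field_derivative_at_within DERIV_f simp: has_real_derivative_iff_has_vector_derivative[symmetric])
    then show ?thesis using that by (simp add: interval_integral_Icc)
  qed
  have "\<bar>f t - f x\<bar> = \<bar>LBINT s:{min x t..max x t}. f' s\<bar>"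
    using I[of x t] I[of t x] x t by (cases "x \<le> t") (auto simp: min_def max_def)
  also have "ennreal \<dots> \<le> (\<integral>\<^sup>+s. ennreal (norm (indicator {min x t..max x t} s *\<^sub>R f' s)) \<partial>lborel)"
    unfolding set_lebesgue_integral_def real_norm_def[symmetric]
    by (rule integral_norm_bound_ennreal[OF i[unfolded set_integrable_def]])
  also have "\<dots> = (\<integral>\<^sup>+s\<in>{s. t \<in> beyond x s}. ennreal \<bar>f' s\<bar> \<partial>lborel)"
    unfolding e by (intro nn_integral_cong) (auto simp: indicator_def)
  finally show ?thesis .
qed

text \<open>As \<open>Kerr b x\<close> has integral \<open>b\<close>, subtracting
  \<open>b * f x\<close> leaves the integral of \<open>(f t - f x) * Kerr b x t\<close>, which sees
  \<open>f\<close> only through its increments and hence through \<open>f'\<close>.\<close>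

definition bias_rem :: "real \<Rightarrow> real \<Rightarrow> real" where
  "bias_rem b x = bias b x - b * f x"

text \<open>Cauchy--Schwarz with respect to the weight \<open>Kerr_beyond b x s ds\<close>, whose total mass is the
  exact second moment: this puts \<open>f'\<close> into the bound only through \<open>f'\<^sup>2\<close>.\<close>

lemma bias_rem_square_le:
  assumes b: "b > 0" and x: "x > 0"
  shows "ennreal ((bias_rem b x / b)\<^sup>2)
    \<le> ennreal ((x + 2 * b) / (2 * b)) * (\<integral>\<^sup>+s. ennreal ((f' s)\<^sup>2) * Kerr_beyond b x s \<partial>lborel)"
proof -
  note K = Kerr_moments[OF b x]
  have i: "set_integrable lborel {0<..} (\<lambda>t. f x * Kerr b x t)"
    using K by (auto intro!: set_integrable_mult_right)
  have R: "bias_rem b x = (LBINT t:{0<..}. (f t - f x) * Kerr b x t)"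
    using set_integral_diff(2)[OF f_Kerr_integrable(1)[OF b x] i] K(2)
    by (simp add: bias_rem_def bias_def left_diff_distrib mult.commute[of b])
  have Ri: "set_integrable lborel {0<..} (\<lambda>t. (f t - f x) * Kerr b x t)"
    using set_integral_diff(1)[OF f_Kerr_integrable(1)[OF b x] i] by (simp add: left_diff_distrib)
  have "ennreal \<bar>bias_rem b x\<bar> \<le> (\<integral>\<^sup>+t. ennreal (norm (indicator {0<..} t *\<^sub>R ((f t - f x) * Kerr b x t))) \<partial>lborel)"
    unfolding R set_lebesgue_integral_def real_norm_def[symmetric]
    by (rule integral_norm_bound_ennreal[OF Ri[unfolded set_integrable_def]])
  also have "\<dots> \<le> (\<integral>\<^sup>+t. \<integral>\<^sup>+s. ennreal \<bar>f' s\<bar> * (ennreal \<bar>Kerr b x t\<bar> * indicator (beyond x s) t) \<partial>lborel \<partial>lborel)"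
  proof (intro nn_integral_mono)
    fix t :: real
    show "ennreal (norm (indicator {0<..} t *\<^sub>R ((f t - f x) * Kerr b x t)))
      \<le> (\<integral>\<^sup>+s. ennreal \<bar>f' s\<bar> * (ennreal \<bar>Kerr b x t\<bar> * indicator (beyond x s) t) \<partial>lborel)"
    proof (cases "t > 0")
      case True
      have "ennreal (norm (indicator {0<..} t *\<^sub>R ((f t - f x) * Kerr b x t))) = ennreal \<bar>Kerr b x t\<bar> * ennreal \<bar>f t - f x\<bar>"
        using True by (simp add: abs_mult ennreal_mult mult.commute)
      also have "\<dots> \<le> ennreal \<bar>Kerr b x t\<bar> * (\<integral>\<^sup>+s\<in>{s. t \<in> beyond x s}. ennreal \<bar>f' s\<bar> \<partial>lborel)"
        by (intro mult_left_mono f_increment_le x True) auto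
      also have "\<dots> = (\<integral>\<^sup>+s. ennreal \<bar>Kerr b x t\<bar> * (ennreal \<bar>f' s\<bar> * indicator {s. t \<in> beyond x s} s) \<partial>lborel)"
        by (intro nn_integral_cmult[symmetric]) measurable
      also have "\<dots> = (\<integral>\<^sup>+s. ennreal \<bar>f' s\<bar> * (ennreal \<bar>Kerr b x t\<bar> * indicator (beyond x s) t) \<partial>lborel)"
        by (intro nn_integral_cong) (auto simp: indicator_def mult.commute)
      finally show ?thesis .
    qed simp
  qed
  also have "\<dots> = (\<integral>\<^sup>+s. \<integral>\<^sup>+t. ennreal \<bar>f' s\<bar> * (ennreal \<bar>Kerr b x t\<bar> * indicator (beyond x s) t) \<partial>lborel \<partial>lborel)"
    by (rule lborel_pair.Fubini'[symmetric]) measurable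
  also have "\<dots> = (\<integral>\<^sup>+s. Kerr_beyond b x s * (ennreal \<bar>f' s\<bar> * 1) \<partial>lborel)"
    by (intro nn_integral_cong) (simp add: nn_integral_cmult Kerr_beyond_def mult.commute)
  \<comment> \<open>\<open>Kerr_beyond b x\<close> becomes the density of a measure, and the
    explicit factor 1 is the second function in Cauchy--Schwarz.\<close>
  also have "\<dots> = (\<integral>\<^sup>+s. ennreal \<bar>f' s\<bar> * 1 \<partial>density lborel (Kerr_beyond b x))"
    by (subst nn_integral_density) auto
  finally have "(ennreal \<bar>bias_rem b x\<bar>)\<^sup>2 \<le> (\<integral>\<^sup>+s. ennreal \<bar>f' s\<bar> * 1 \<partial>density lborel (Kerr_beyond b x))\<^sup>2"
    by (intro power_mono) auto
  also have "\<dots> \<le> (\<integral>\<^sup>+s. (ennreal \<bar>f' s\<bar>)\<^sup>2 \<partial>density lborel (Kerr_beyond b x)) * (\<integral>\<^sup>+s. 1\<^sup>2 \<partial>density lborel (Kerr_beyond b x))"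
    by (rule Cauchy_Schwarz_nn_integral) auto
  also have "(\<integral>\<^sup>+s. 1\<^sup>2 \<partial>density lborel (Kerr_beyond b x)) = ennreal (b * (x + 2 * b) / 2)"
    unfolding integral_Kerr_beyond[OF b x, symmetric] by (subst nn_integral_density) auto
  also have "(\<integral>\<^sup>+s. (ennreal \<bar>f' s\<bar>)\<^sup>2 \<partial>density lborel (Kerr_beyond b x)) = (\<integral>\<^sup>+s. ennreal ((f' s)\<^sup>2) * Kerr_beyond b x s \<partial>lborel)" (is "_ = ?J")
    by (subst nn_integral_density) (auto intro!: nn_integral_cong simp: ennreal_power mult.commute)
  finally have "ennreal (1 / b\<^sup>2) * (ennreal \<bar>bias_rem b x\<bar>)\<^sup>2 \<le> ennreal (1 / b\<^sup>2) * (?J * ennreal (b * (x + 2 * b) / 2))"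
    by (intro mult_left_mono) auto
  moreover have "ennreal (1 / b\<^sup>2) * (ennreal \<bar>bias_rem b x\<bar>)\<^sup>2 = ennreal ((bias_rem b x / b)\<^sup>2)"
    by (simp add: ennreal_power ennreal_mult'[symmetric] power_divide)
  moreover have "ennreal (1 / b\<^sup>2) * (?J * ennreal (b * (x + 2 * b) / 2))
      = ennreal (1 / b\<^sup>2) * ennreal (b * (x + 2 * b) / 2) * ?J" by (simp add: mult_ac)
  moreover have "ennreal (1 / b\<^sup>2) * ennreal (b * (x + 2 * b) / 2) = ennreal ((x + 2 * b) / (2 * b))"
    using b x by (simp add: ennreal_mult'[symmetric] power2_eq_square)
  ultimately show ?thesis by simp
qed

text \<open>After Tonelli the inner integral runs over \<open>x\<close> for fixed \<open>s\<close>
  and has a bound free of \<open>b\<close>, so the rescaled remainder is controlled uniformly in the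
  bandwidth.\<close>

lemma bias_rem_tail:
  assumes b: "0 < b" "b \<le> 1" and A: "A \<ge> 0"
    and h: "set_integrable lborel {0<..} (\<lambda>s. (s + 1)\<^sup>2 * (f' s)\<^sup>2)"
  shows "(\<integral>\<^sup>+x\<in>{A<..}. ennreal ((bias_rem b x / b)\<^sup>2) \<partial>lborel)
    \<le> ennreal (9216 * (LBINT s:{0<..}. (s + 1)\<^sup>2 * (f' s)\<^sup>2 * tail_factor A s))"
proof -
  let ?h = "\<lambda>s. (s + 1)\<^sup>2 * (f' s)\<^sup>2 * tail_factor A s"
  let ?c = "\<lambda>x. ennreal ((x + 2 * b) / (2 * b))"
  have "(\<integral>\<^sup>+x\<in>{A<..}. ennreal ((bias_rem b x / b)\<^sup>2) \<partial>lborel)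
    \<le> (\<integral>\<^sup>+x. \<integral>\<^sup>+s. ennreal ((f' s)\<^sup>2) * (?c x * Kerr_beyond b x s * indicator {A<..} x) \<partial>lborel \<partial>lborel)"
  proof (intro nn_integral_mono)
    fix x :: real
    show "ennreal ((bias_rem b x / b)\<^sup>2) * indicator {A<..} x
      \<le> (\<integral>\<^sup>+s. ennreal ((f' s)\<^sup>2) * (?c x * Kerr_beyond b x s * indicator {A<..} x) \<partial>lborel)"
    proof (cases "x > A")
      case True
      then have "ennreal ((bias_rem b x / b)\<^sup>2) \<le> ?c x * (\<integral>\<^sup>+s. ennreal ((f' s)\<^sup>2) * Kerr_beyond b x s \<partial>lborel)"
        using bias_rem_square_le[OF b(1), of x] A by simp
      also have "\<dots> = (\<integral>\<^sup>+s. ?c x * (ennreal ((f' s)\<^sup>2) * Kerr_beyond b x s) \<partial>lborel)"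
        by (intro nn_integral_cmult[symmetric]) measurable
      finally show ?thesis using True by (simp add: mult_ac)
    qed simp
  qed
  also have "\<dots> = (\<integral>\<^sup>+s. \<integral>\<^sup>+x. ennreal ((f' s)\<^sup>2) * (?c x * Kerr_beyond b x s * indicator {A<..} x) \<partial>lborel \<partial>lborel)"
    by (intro lborel_pair.Fubini') measurable
  also have "\<dots> \<le> (\<integral>\<^sup>+s. ennreal 9216 * (ennreal (?h s) * indicator {0<..} s) \<partial>lborel)"
  proof (intro nn_integral_mono)
    fix s :: real
    show "(\<integral>\<^sup>+x. ennreal ((f' s)\<^sup>2) * (?c x * Kerr_beyond b x s * indicator {A<..} x) \<partial>lborel)
      \<le> ennreal 9216 * (ennreal (?h s) * indicator {0<..} s)"
    proof (cases "s > 0")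
      case True
      have "(\<integral>\<^sup>+x. ennreal ((f' s)\<^sup>2) * (?c x * Kerr_beyond b x s * indicator {A<..} x) \<partial>lborel)
        = ennreal ((f' s)\<^sup>2) * (\<integral>\<^sup>+x\<in>{A<..}. ?c x * Kerr_beyond b x s \<partial>lborel)"
        by (intro nn_integral_cmult) measurable
      also have "\<dots> \<le> ennreal ((f' s)\<^sup>2) * ennreal (9216 * ((s + 1)\<^sup>2 * tail_factor A s))"
        unfolding Kerr_beyond_def beyond_def
        by (intro mult_left_mono nn_integral_Kerr_beyond_tail[OF b True refl A]) auto
      also have "\<dots> = ennreal 9216 * ennreal (?h s)"
        by (subst (1 2) ennreal_mult'[symmetric]) (auto simp: mult_ac)
      finally show ?thesis using True by simp
    qed (simp add: f'_nonpos)
  qed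
  also have "\<dots> = ennreal 9216 * (\<integral>\<^sup>+s\<in>{0<..}. ennreal (?h s) \<partial>lborel)"
    by (intro nn_integral_cmult) measurable
  also have "(\<integral>\<^sup>+s\<in>{0<..}. ennreal (?h s) \<partial>lborel)
      = ennreal (LBINT s:{0<..}. ?h s)"
    using tail_factor_bounds
    by (intro set_nn_integral_of_integrable tail_factor_integral_tendsto_0(1)[OF h]) auto
  also have "ennreal 9216 * \<dots> = ennreal (9216 * (LBINT s:{0<..}. ?h s))"
    by (intro ennreal_mult'[symmetric]) auto
  finally show ?thesis .
qed

lemma f_square_integrable: "set_integrable lborel {0<..} (\<lambda>x. (f x)\<^sup>2)"
  using f_mult_integrable[OF borel_measurable_f f_bound] by (simp add: power2_eq_square)

text \<open>For \<open>s \<ge> 1\<close> one has \<open>s + 1 \<le> 2 * s\<close> and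
  \<open>2 * s * f' s = 4 * (asym_bias s - f s)\<close>. Near 0 the weight is not comparable to
  \<open>s\<close>, and boundedness of \<open>f'\<close> on a set of finite length takes
  over.\<close>

lemma weighted_f'_square_integrable:
  assumes g: "set_integrable lborel {0<..} (\<lambda>x. (asym_bias x)\<^sup>2)"
  shows "set_integrable lborel {0<..} (\<lambda>s. (s + 1)\<^sup>2 * (f' s)\<^sup>2)"
proof (rule set_integrable_bound)
  let ?w = "\<lambda>s. 32 * ((asym_bias s)\<^sup>2 + (f s)\<^sup>2) + 4 * B\<^sup>2 * indicator {..<1} s"
  have "set_integrable lborel {0<..} (\<lambda>s::real. 4 * B\<^sup>2 * indicator {..<1} s)"
    using integral_below(1)[of 1 "\<lambda>_. 4 * B\<^sup>2" "\<lambda>s. 4 * B\<^sup>2 * s"]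
    by (auto intro!: derivative_eq_intros)
  then show "set_integrable lborel {0<..} ?w"
    by (rule set_integral_add(1)[rotated]) (intro set_integrable_mult_right set_integral_add(1) g f_square_integrable)
  show "set_borel_measurable lborel {0<..} (\<lambda>s. (s + 1)\<^sup>2 * (f' s)\<^sup>2)"
    unfolding set_borel_measurable_def by measurable
  show "AE s in lborel. s \<in> {0<..} \<longrightarrow> norm ((s + 1)\<^sup>2 * (f' s)\<^sup>2) \<le> norm (?w s)"
  proof (intro AE_I2 impI)
    fix s :: real assume s: "s \<in> {0<..}"
    have "(s + 1)\<^sup>2 * (f' s)\<^sup>2 \<le> ?w s"
    proof (cases "s < 1")
      case True
      have "(s + 1)\<^sup>2 \<le> 2\<^sup>2" using s True by (intro power_mono) auto
      moreover have "(f' s)\<^sup>2 \<le> B\<^sup>2" using f'_bound[of s] by (metis abs_ge_zero power2_abs power_mono)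
      ultimately have "(s + 1)\<^sup>2 * (f' s)\<^sup>2 \<le> 2\<^sup>2 * B\<^sup>2" by (intro mult_mono) auto
      then have "(s + 1)\<^sup>2 * (f' s)\<^sup>2 \<le> 32 * ((asym_bias s)\<^sup>2 + (f s)\<^sup>2) + 2\<^sup>2 * B\<^sup>2"
        by (intro add_increasing) auto
      then show ?thesis using True by simp
    next
      case False
      have "(s + 1)\<^sup>2 \<le> (2 * s)\<^sup>2" using False by (intro power_mono) auto
      then have "(s + 1)\<^sup>2 * (f' s)\<^sup>2 \<le> (2 * s)\<^sup>2 * (f' s)\<^sup>2" by (intro mult_right_mono) auto
      also have "\<dots> = 16 * (asym_bias s - f s)\<^sup>2" by (simp add: asym_bias_def power2_eq_square)
      also have "\<dots> \<le> 16 * (2 * ((asym_bias s)\<^sup>2 + (f s)\<^sup>2))"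
        using zero_le_power2[of "asym_bias s + f s"] by (simp add: power2_sum power2_diff)
      finally show ?thesis using False by simp
    qed
    then show "norm ((s + 1)\<^sup>2 * (f' s)\<^sup>2) \<le> norm (?w s)" by simp
  qed
qed

lemma bias_integral_asymptotics:
  assumes \<beta>: "\<And>n. 0 < \<beta> n" "\<And>n. \<beta> n \<le> 1" "\<beta> \<longlonglongrightarrow> 0"
    and g: "set_integrable lborel {0<..} (\<lambda>x. (asym_bias x)\<^sup>2)"
  shows "set_integrable lborel {0<..} (\<lambda>x. (bias (\<beta> n) x)\<^sup>2)"
    and "(\<lambda>n. (LBINT x:{0<..}. (bias (\<beta> n) x)\<^sup>2) / (\<beta> n)\<^sup>2) \<longlonglongrightarrow> (LBINT x:{0<..}. (asym_bias x)\<^sup>2)"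
proof -
  note h = weighted_f'_square_integrable[OF g]
  have at: "filterlim \<beta> (at_right 0) sequentially"
    using \<beta> by (intro tendsto_imp_filterlim_at_right) auto
  let ?u = "\<lambda>n x. (bias (\<beta> n) x / \<beta> n)\<^sup>2"
  let ?\<tau>1 = "\<lambda>A. LBINT x:{A<..}. \<bar>(f x)\<^sup>2\<bar>"
  let ?\<tau>2 = "\<lambda>A. LBINT s:{0<..}. (s + 1)\<^sup>2 * (f' s)\<^sup>2 * tail_factor A s"
  let ?\<tau> = "\<lambda>A. 2 * ?\<tau>1 A + 2 * (9216 * ?\<tau>2 A)"
  have lim: "(\<lambda>n. ?u n x) \<longlonglongrightarrow> (asym_bias x)\<^sup>2" if x: "x > 0" for x
    by (intro tendsto_power filterlim_compose[OF bias_tendsto[OF x] at])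
  have bdd: "\<exists>C. \<forall>n. \<forall>x\<in>{0<..A}. \<bar>?u n x\<bar> \<le> C" for A
  \<comment> \<open>The summands bound, in order, \<open>f x\<close>, \<open>x / 2 * f' x\<close>,
    the correction \<open>f' x * \<beta> n\<close> and the Taylor remainder.\<close>
  proof (intro exI[of _ "(B + A / 2 * B + B + 1024 * B * (A + 1))\<^sup>2"] allI ballI)
    fix n x assume x: "x \<in> {0<..A}"
    let ?b = "\<beta> n"
    have b: "?b > 0" "?b \<le> 1" using \<beta> by auto
    have fx: "\<bar>f' x * y\<bar> \<le> B * \<bar>y\<bar>" for y
      unfolding abs_mult using f'_bound by (intro mult_right_mono) auto
    \<comment> \<open>The expansion is used with the crude remainder bound
      \<open>2 * B * \<bar>t - x\<bar>\<close> and no cubic part: not small, but uniform for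
      \<open>x \<le> A\<close>.\<close>
    have "\<bar>bias ?b x - ?b * (asym_bias x + f' x * ?b)\<bar> \<le> 512 * (2 * B) * (?b * (x + ?b)) + 200000 * 0 * (?b * (x + ?b))\<^sup>2"
    proof (rule bias_expansion)
      fix t :: real assume t: "t > 0"
      then have "\<bar>f t - f x\<bar> \<le> B * \<bar>t - x\<bar>" using f_Lipschitz x by auto
      then show "\<bar>f t - f x - f' x * (t - x)\<bar> \<le> 2 * B * \<bar>t - x\<bar> + 0 * \<bar>t - x\<bar> ^ 3"
        using fx[of "t - x"] by linarith
    qed (use x b B_nonneg in auto)
    moreover have "bias ?b x / ?b - (asym_bias x + f' x * ?b) = (bias ?b x - ?b * (asym_bias x + f' x * ?b)) / ?b"
      using b by (simp add: diff_divide_distrib)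
    ultimately have "\<bar>bias ?b x / ?b - (asym_bias x + f' x * ?b)\<bar> \<le> 1024 * B * (x + ?b)"
      using b by (simp add: abs_divide pos_divide_le_eq mult_ac)
    also have "\<dots> \<le> 1024 * B * (A + 1)" using x b B_nonneg by (intro mult_left_mono) auto
    finally have 1: "\<bar>bias ?b x / ?b - (asym_bias x + f' x * ?b)\<bar> \<le> 1024 * B * (A + 1)" .
    have 2: "\<bar>f' x * ?b\<bar> \<le> B"
      using fx[of ?b] b B_nonneg mult_left_le[of ?b B] by simp
    have "x / 2 * \<bar>f' x\<bar> \<le> A / 2 * B" using x f'_bound B_nonneg by (intro mult_mono) auto
    then have 3: "\<bar>x / 2 * f' x\<bar> \<le> A / 2 * B" using x by (simp add: abs_mult)
    have "\<bar>bias ?b x / ?b\<bar> \<le> B + A / 2 * B + B + 1024 * B * (A + 1)"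
      using 1 2 3 f_bound[of x] unfolding asym_bias_def by linarith
    then have "\<bar>bias ?b x / ?b\<bar>\<^sup>2 \<le> (B + A / 2 * B + B + 1024 * B * (A + 1))\<^sup>2"
      by (intro power_mono) auto
    then show "\<bar>?u n x\<bar> \<le> (B + A / 2 * B + B + 1024 * B * (A + 1))\<^sup>2"
      by (simp only: power2_abs abs_power2)
  qed
  have tail: "(\<integral>\<^sup>+x\<in>{A<..}. ennreal \<bar>?u n x\<bar> \<partial>lborel) \<le> ennreal (?\<tau> A)" if A: "A \<ge> 0" for A n
  proof -
    have f2: "set_integrable lborel {A<..} (\<lambda>x. \<bar>(f x)\<^sup>2\<bar>)"
      by (rule set_integrable_subset[of _ "{0<..}"]) (use A f_square_integrable in auto)
    have m: "(\<lambda>x. bias_rem (\<beta> n) x) \<in> borel_measurable borel"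
      unfolding bias_rem_def by measurable
    have "(\<integral>\<^sup>+x\<in>{A<..}. ennreal \<bar>?u n x\<bar> \<partial>lborel)
      \<le> (\<integral>\<^sup>+x. ennreal 2 * (ennreal \<bar>(f x)\<^sup>2\<bar> * indicator {A<..} x)
          + ennreal 2 * (ennreal ((bias_rem (\<beta> n) x / \<beta> n)\<^sup>2) * indicator {A<..} x) \<partial>lborel)"
    proof (intro nn_integral_mono)
      fix x :: real
      have "bias (\<beta> n) x / \<beta> n = f x + bias_rem (\<beta> n) x / \<beta> n"
        using \<beta>(1)[of n] by (simp add: bias_rem_def diff_divide_distrib)
      \<comment> \<open>The bias is split into \<open>f x\<close> and the remainder so that each
        square has its own tail bound.\<close>
      then have "?u n x \<le> 2 * (f x)\<^sup>2 + 2 * (bias_rem (\<beta> n) x / \<beta> n)\<^sup>2"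
        using zero_le_power2[of "f x - bias_rem (\<beta> n) x / \<beta> n"] by (simp add: power2_sum power2_diff)
      then have "ennreal (?u n x) \<le> ennreal (2 * (f x)\<^sup>2 + 2 * (bias_rem (\<beta> n) x / \<beta> n)\<^sup>2)"
        by (rule ennreal_leI)
      also have "\<dots> = ennreal 2 * ennreal ((f x)\<^sup>2) + ennreal 2 * ennreal ((bias_rem (\<beta> n) x / \<beta> n)\<^sup>2)"
        by (subst ennreal_plus) (simp_all only: ennreal_mult' zero_le_numeral zero_le_power2 mult_nonneg_nonneg)
      finally show "ennreal \<bar>?u n x\<bar> * indicator {A<..} x
        \<le> ennreal 2 * (ennreal \<bar>(f x)\<^sup>2\<bar> * indicator {A<..} x)
          + ennreal 2 * (ennreal ((bias_rem (\<beta> n) x / \<beta> n)\<^sup>2) * indicator {A<..} x)"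
        by (auto simp: indicator_def)
    qed
    also have "\<dots> = ennreal 2 * (\<integral>\<^sup>+x\<in>{A<..}. ennreal \<bar>(f x)\<^sup>2\<bar> \<partial>lborel)
        + ennreal 2 * (\<integral>\<^sup>+x\<in>{A<..}. ennreal ((bias_rem (\<beta> n) x / \<beta> n)\<^sup>2) \<partial>lborel)"
      using m by (subst nn_integral_add) (simp_all add: nn_integral_cmult)
    also have "\<dots> \<le> ennreal 2 * ennreal (?\<tau>1 A) + ennreal 2 * ennreal (9216 * ?\<tau>2 A)"
      using set_nn_integral_of_integrable[OF f2] bias_rem_tail[OF \<beta>(1,2) A h]
      by (intro add_mono mult_left_mono) auto
    also have "\<dots> = ennreal (?\<tau> A)"
    proof -
      have "?\<tau>1 A \<ge> 0" "?\<tau>2 A \<ge> 0"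
        unfolding set_lebesgue_integral_def using tail_factor_bounds
        by (auto intro!: Bochner_Integration.integral_nonneg simp: indicator_def)
      moreover have "ennreal 2 * ennreal p + ennreal 2 * ennreal q = ennreal (2 * p + 2 * q)"
        if "p \<ge> 0" "q \<ge> 0" for p q
        using that by (simp add: ennreal_mult')
      ultimately show ?thesis by simp
    qed
    finally show ?thesis .
  qed
  have "(?\<tau> \<longlongrightarrow> 2 * 0 + 2 * (9216 * 0)) at_top"
    by (intro tendsto_intros tail_factor_integral_tendsto_0(2)[OF h] set_integral_tail_tendsto_0[OF f_square_integrable])
  then have tau: "(?\<tau> \<longlongrightarrow> 0) at_top" by simp
  have um: "?u n \<in> borel_measurable borel" for n by measurable
  note T = tight_dominated_convergence[of ?u, OF um g lim bdd tail tau]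
  have b0: "(\<beta> n)\<^sup>2 > 0" for n using \<beta>(1)[of n] by simp
  have "set_integrable lborel {0<..} (\<lambda>x. (\<beta> n)\<^sup>2 * ?u n x)"
    by (intro set_integrable_mult_right T(1))
  then show "set_integrable lborel {0<..} (\<lambda>x. (bias (\<beta> n) x)\<^sup>2)"
    using \<beta>(1)[of n] by (simp add: power_divide)
  show "(\<lambda>n. (LBINT x:{0<..}. (bias (\<beta> n) x)\<^sup>2) / (\<beta> n)\<^sup>2) \<longlonglongrightarrow> (LBINT x:{0<..}. (asym_bias x)\<^sup>2)"
    using T(2) by (simp add: set_lebesgue_integral_def power_divide)
qed

end

section \<open>Moments of the estimator\<close>

text \<open>Independence of \<open>Z i\<close> from the partial sum kills the cross term;
  integrability is carried through the induction because splitting the expectation needs it.\<close>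

lemma (in prob_space) sum_square_indep:
  fixes Z :: "'i \<Rightarrow> 'a \<Rightarrow> real"
  assumes "finite I" "indep_vars (\<lambda>_. borel) Z I"
    and "\<And>i. i \<in> I \<Longrightarrow> integrable M (Z i)" "\<And>i. i \<in> I \<Longrightarrow> integrable M (\<lambda>\<omega>. (Z i \<omega>)\<^sup>2)"
    and "\<And>i. i \<in> I \<Longrightarrow> expectation (Z i) = 0" "\<And>i. i \<in> I \<Longrightarrow> expectation (\<lambda>\<omega>. (Z i \<omega>)\<^sup>2) = v"
  shows "integrable M (\<lambda>\<omega>. (\<Sum>i\<in>I. Z i \<omega>)\<^sup>2) \<and> expectation (\<lambda>\<omega>. (\<Sum>i\<in>I. Z i \<omega>)\<^sup>2) = real (card I) * v"
  using assms
proof (induction I rule: finite_induct)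
  case (insert i I)
  let ?S = "\<lambda>\<omega>. \<Sum>j\<in>I. Z j \<omega>"
  have IH: "integrable M (\<lambda>\<omega>. (?S \<omega>)\<^sup>2)" "expectation (\<lambda>\<omega>. (?S \<omega>)\<^sup>2) = real (card I) * v"
    using insert.IH indep_vars_subset[OF insert.prems(1), of I] insert.prems by auto
  have ind: "indep_var borel (Z i) borel ?S"
    using insert by (intro indep_vars_sum)
  have iS: "integrable M ?S" using insert.prems by (intro Bochner_Integration.integrable_sum) auto
  have iZ: "integrable M (Z i)" "integrable M (\<lambda>\<omega>. (Z i \<omega>)\<^sup>2)" using insert.prems by auto
  have c: "integrable M (\<lambda>\<omega>. Z i \<omega> * ?S \<omega>)" "expectation (\<lambda>\<omega>. Z i \<omega> * ?S \<omega>) = 0"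
    using indep_var_integrable[OF ind iZ(1) iS] indep_var_lebesgue_integral[OF ind iZ(1) iS] insert.prems by auto
  have e: "(\<Sum>j\<in>insert i I. Z j \<omega>)\<^sup>2 = (Z i \<omega>)\<^sup>2 + 2 * (Z i \<omega> * ?S \<omega>) + (?S \<omega>)\<^sup>2" for \<omega>
    using insert by (simp add: power2_sum mult.assoc)
  show ?case
    unfolding e using insert IH c iZ by (simp add: algebra_simps)
qed simp

context smooth_halfline_cdf
begin

text \<open>The distribution function of the law with density \<open>f\<close>, from which the law
  of the observations will be identified.\<close>

lemma density_f:
  "prob_space (density lborel f)"
  "x > 0 \<Longrightarrow> measure (density lborel f) {..x} = F x"
  "x \<le> 0 \<Longrightarrow> measure (density lborel f) {..x} = 0"
proof -
  have f0: "(\<integral>\<^sup>+t. ennreal (f t) * indicator A t \<partial>lborel) = (\<integral>\<^sup>+t\<in>{0<..}. ennreal (f t * indicator A t) \<partial>lborel)" for A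
    using f_nonpos by (intro nn_integral_cong) (auto simp: indicator_def not_less)
  have "emeasure (density lborel f) UNIV = (\<integral>\<^sup>+t\<in>{0<..}. ennreal (f t * indicator UNIV t) \<partial>lborel)"
    unfolding f0[symmetric] by (rule emeasure_density) auto
  also have "\<dots> = 1"
    using set_nn_integral_of_integrable[OF f_integral(1)] f_integral(2) f_nonneg by simp
  finally show "prob_space (density lborel f)" by (intro prob_spaceI) simp
  have m: "emeasure (density lborel f) {..x} = (\<integral>\<^sup>+t\<in>{0<..}. ennreal (f t * indicator {..<x} t) \<partial>lborel)"
  proof -
    have "emeasure (density lborel f) {..x} = (\<integral>\<^sup>+t\<in>{0<..}. ennreal (f t * indicator {..x} t) \<partial>lborel)"
      by (subst emeasure_density) (auto simp: f0)
    also have "\<dots> = (\<integral>\<^sup>+t\<in>{0<..}. ennreal (f t * indicator {..<x} t) \<partial>lborel)"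
      by (intro nn_integral_cong_AE, rule AE_mp[OF AE_lborel_singleton[of x]]) (auto simp: indicator_def)
    finally show ?thesis .
  qed
  show "measure (density lborel f) {..x} = F x" if "x > 0"
  proof -
    have "(\<integral>\<^sup>+t\<in>{0<..}. ennreal (f t * indicator {..<x} t) \<partial>lborel) = ennreal (F x)"
      unfolding F_integral[OF that, symmetric]
      by (intro set_nn_integral_of_integrable f_mult_integrable[where C = 1]) (auto simp: f_nonneg indicator_def)
    then show ?thesis using m F_bounds[OF that] by (simp add: measure_def)
  qed
  show "measure (density lborel f) {..x} = 0" if "x \<le> 0"
  proof -
    have "(\<integral>\<^sup>+t\<in>{0<..}. ennreal (f t * indicator {..<x} t) \<partial>lborel) = (\<integral>\<^sup>+t. 0 \<partial>(lborel :: real measure))"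
      using that by (intro nn_integral_cong) (auto simp: indicator_def)
    then show ?thesis using m by (simp add: measure_def)
  qed
qed

end

locale gamma_kernel_sample = smooth_halfline_cdf F f f' B + prob_space M
  for F f f' :: "real \<Rightarrow> real" and B :: real and M :: "'a measure" +
  fixes X :: "nat \<Rightarrow> 'a \<Rightarrow> real"
  assumes indep: "indep_vars (\<lambda>_. borel) X {1..}"
    and distr_X: "\<And>i. i \<ge> 1 \<Longrightarrow> distr M borel (X i) = density lborel f"
begin

lemma X_measurable: "i \<ge> 1 \<Longrightarrow> X i \<in> borel_measurable M"
  using indep by (auto simp: indep_vars_def)

text \<open>A bound for \<open>h\<close> on the positive half-line suffices, since the density
  vanishes elsewhere; this is where the kernel is controlled.\<close>

lemma expectation_X:
  assumes i: "i \<ge> 1" and [measurable]: "h \<in> borel_measurable borel" and C: "\<And>t. t > 0 \<Longrightarrow> \<bar>h t\<bar> \<le> C"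
  shows "integrable M (\<lambda>\<omega>. h (X i \<omega>))" "expectation (\<lambda>\<omega>. h (X i \<omega>)) = (LBINT t:{0<..}. f t * h t)"
proof -
  have e: "f t * h t = indicator {0<..} t *\<^sub>R (f t * h t)" for t
    using f_nonpos[of t] by (cases "t > 0") auto
  have I: "integrable lborel (\<lambda>t. f t * h t)"
    using f_mult_integrable[where \<kappa> = h, OF assms(2) C] unfolding set_integrable_def e[symmetric] .
  have "integrable (distr M borel (X i)) h"
    unfolding distr_X[OF i] using I f_nonneg by (subst integrable_density) auto
  then show "integrable M (\<lambda>\<omega>. h (X i \<omega>))"
    using X_measurable[OF i] by (subst (asm) integrable_distr_eq) auto
  have "expectation (\<lambda>\<omega>. h (X i \<omega>)) = integral\<^sup>L (distr M borel (X i)) h"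
    using X_measurable[OF i] by (intro integral_distr[symmetric]) auto
  also have "\<dots> = (LBINT t. f t * h t)"
    unfolding distr_X[OF i] using f_nonneg by (subst integral_density) auto
  also have "\<dots> = (LBINT t:{0<..}. f t * h t)"
    unfolding set_lebesgue_integral_def e[symmetric] ..
  finally show "expectation (\<lambda>\<omega>. h (X i \<omega>)) = (LBINT t:{0<..}. f t * h t)" .
qed

context
  fixes b x :: real
  assumes b: "b > 0" and x: "x > 0"
begin

lemma expectation_Kbar:
  assumes i: "i \<ge> 1"
  shows "integrable M (\<lambda>\<omega>. Kbar_Gam (X i \<omega>) (x / b + 1) b)"
    "expectation (\<lambda>\<omega>. Kbar_Gam (X i \<omega>) (x / b + 1) b) = F x + bias b x"
    "integrable M (\<lambda>\<omega>. (Kbar_Gam (X i \<omega>) (x / b + 1) b)\<^sup>2)"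
    "expectation (\<lambda>\<omega>. (Kbar_Gam (X i \<omega>) (x / b + 1) b)\<^sup>2) = F x + sq_bias b x"
proof -
  let ?K = "\<lambda>t. Kbar_Gam t (x / b + 1) b"
  have K: "\<bar>?K t\<bar> \<le> 1" "\<bar>(?K t)\<^sup>2\<bar> \<le> 1" if "t > 0" for t
    using Kbar_Gam_bounds[OF b x, of t] that by (auto simp: power_le_one)
  have m: "?K \<in> borel_measurable borel" "(\<lambda>t. (?K t)\<^sup>2) \<in> borel_measurable borel" by measurable
  show "integrable M (\<lambda>\<omega>. ?K (X i \<omega>))" "integrable M (\<lambda>\<omega>. (?K (X i \<omega>))\<^sup>2)"
    using expectation_X(1)[OF i m(1) K(1)] expectation_X(1)[OF i m(2) K(2)] by auto
  have Fi: "set_integrable lborel {0<..} (\<lambda>t. f t * indicator {..<x} t)"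
    by (rule f_mult_integrable[where C = 1]) (auto simp: indicator_def)
  have "(LBINT t:{0<..}. f t * ?K t) = (LBINT t:{0<..}. f t * indicator {..<x} t + f t * Kerr b x t)"
    by (intro set_lebesgue_integral_cong) (auto simp: Kerr_def algebra_simps)
  also have "\<dots> = F x + bias b x"
    using set_integral_add(2)[OF Fi f_Kerr_integrable(1)[OF b x]] F_integral[OF x] by (simp add: bias_def)
  finally show "expectation (\<lambda>\<omega>. ?K (X i \<omega>)) = F x + bias b x"
    using expectation_X(2)[OF i m(1) K(1)] by simp
  have "(LBINT t:{0<..}. f t * (?K t)\<^sup>2)
      = (LBINT t:{0<..}. f t * indicator {..<x} t + f t * ((?K t)\<^sup>2 - indicator {..<x} t))"
    by (intro set_lebesgue_integral_cong) (auto simp: algebra_simps)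
  also have "\<dots> = F x + sq_bias b x"
    using set_integral_add(2)[OF Fi f_Kerr_integrable(3)[OF b x]] F_integral[OF x] by (simp add: sq_bias_def)
  finally show "expectation (\<lambda>\<omega>. (?K (X i \<omega>))\<^sup>2) = F x + sq_bias b x"
    using expectation_X(2)[OF i m(2) K(2)] by simp
qed

text \<open>Everything is expressed through the centred kernel values \<open>Z i\<close>,
  independent with mean 0 and second moment \<open>?v\<close>. In the bias-variance decomposition
  the mixed term is a multiple of their sum and has expectation 0.\<close>

lemma Fhat_moments:
  assumes n: "n \<ge> 1"
  shows "expectation (Fhat_Gam X n b x) = F x + bias b x"
    "variance (Fhat_Gam X n b x) = (F x * (1 - F x) + var_err b x) / real n"
    "integrable M (\<lambda>\<omega>. (Fhat_Gam X n b x \<omega> - F x)\<^sup>2)"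
    "expectation (\<lambda>\<omega>. (Fhat_Gam X n b x \<omega> - F x)\<^sup>2) = variance (Fhat_Gam X n b x) + (Bias M (Fhat_Gam X n b) F x)\<^sup>2"
proof -
  let ?K = "\<lambda>t. Kbar_Gam t (x / b + 1) b"
  let ?m = "F x + bias b x"
  let ?v = "F x * (1 - F x) + var_err b x"
  define Z where "Z i \<omega> = ?K (X i \<omega>) - ?m" for i \<omega>
  have Zi: "integrable M (Z i)" "expectation (Z i) = 0" "integrable M (\<lambda>\<omega>. (Z i \<omega>)\<^sup>2)"
    "expectation (\<lambda>\<omega>. (Z i \<omega>)\<^sup>2) = ?v" if i: "i \<ge> 1" for i
  proof -
    note E = expectation_Kbar[OF i]
    show "integrable M (Z i)" "expectation (Z i) = 0"
      unfolding Z_def[abs_def] using E by (auto simp: prob_space)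
    have e: "(Z i \<omega>)\<^sup>2 = (?K (X i \<omega>))\<^sup>2 - 2 * ?m * ?K (X i \<omega>) + ?m\<^sup>2" for \<omega>
      by (simp add: Z_def power2_eq_square algebra_simps)
    show "integrable M (\<lambda>\<omega>. (Z i \<omega>)\<^sup>2)" unfolding e using E by auto
    have "expectation (\<lambda>\<omega>. (Z i \<omega>)\<^sup>2) = (F x + sq_bias b x) - 2 * ?m * ?m + ?m\<^sup>2"
      unfolding e using E by (simp add: prob_space)
    then show "expectation (\<lambda>\<omega>. (Z i \<omega>)\<^sup>2) = ?v"
      by (simp add: var_err_def power2_eq_square algebra_simps)
  qed
  have "indep_vars (\<lambda>_. borel) (\<lambda>i \<omega>. (\<lambda>t. ?K t - ?m) (X i \<omega>)) {1..n}"
    by (rule indep_vars_compose2[OF indep_vars_subset[OF indep]]) auto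
  then have "indep_vars (\<lambda>_. borel) Z {1..n}" by (simp add: Z_def[abs_def])
  then have S: "integrable M (\<lambda>\<omega>. (\<Sum>i\<in>{1..n}. Z i \<omega>)\<^sup>2)"
    "expectation (\<lambda>\<omega>. (\<Sum>i\<in>{1..n}. Z i \<omega>)\<^sup>2) = real n * ?v"
    using sum_square_indep[of "{1..n}" Z ?v] Zi by auto
  have Fh: "Fhat_Gam X n b x \<omega> = ?m + (\<Sum>i\<in>{1..n}. Z i \<omega>) / real n" for \<omega>
    using n by (simp add: Fhat_Gam_def Z_def sum_subtractf field_simps)
  have iS: "integrable M (\<lambda>\<omega>. \<Sum>i\<in>{1..n}. Z i \<omega>)" "expectation (\<lambda>\<omega>. \<Sum>i\<in>{1..n}. Z i \<omega>) = 0"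
    using Zi by (auto intro!: Bochner_Integration.integrable_sum simp: Bochner_Integration.integral_sum)
  show E: "expectation (Fhat_Gam X n b x) = ?m"
    unfolding Fh using iS by (simp add: prob_space)
  have V: "(Fhat_Gam X n b x \<omega> - ?m)\<^sup>2 = (\<Sum>i\<in>{1..n}. Z i \<omega>)\<^sup>2 / (real n)\<^sup>2" for \<omega>
    unfolding Fh by (simp add: power_divide)
  show Var: "variance (Fhat_Gam X n b x) = ?v / real n"
    unfolding E V using S n by (simp add: power2_eq_square)
  have B: "Bias M (Fhat_Gam X n b) F x = bias b x" by (simp add: Bias_def E)
  have D: "(Fhat_Gam X n b x \<omega> - F x)\<^sup>2 = (Fhat_Gam X n b x \<omega> - ?m)\<^sup>2
      + 2 * bias b x / real n * (\<Sum>i\<in>{1..n}. Z i \<omega>) + (bias b x)\<^sup>2" for \<omega>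
    unfolding Fh by (simp add: power2_eq_square algebra_simps)
  have iV: "integrable M (\<lambda>\<omega>. (Fhat_Gam X n b x \<omega> - ?m)\<^sup>2)" unfolding V using S by auto
  show "integrable M (\<lambda>\<omega>. (Fhat_Gam X n b x \<omega> - F x)\<^sup>2)"
    unfolding D using iV iS by (intro Bochner_Integration.integrable_add integrable_mult_right) auto
  show "expectation (\<lambda>\<omega>. (Fhat_Gam X n b x \<omega> - F x)\<^sup>2) = variance (Fhat_Gam X n b x) + (Bias M (Fhat_Gam X n b) F x)\<^sup>2"
    unfolding D B E using iV iS by (simp add: prob_space)
qed

lemma Bias_eq: "n \<ge> 1 \<Longrightarrow> Bias M (Fhat_Gam X n b) F x = bias b x"
  using Fhat_moments(1) by (simp add: Bias_def)

end

text \<open>Tonelli followed by the pointwise decomposition; with extended non-negative integrals it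
  also holds when both sides are infinite.\<close>

lemma MISE_decomposition:
  assumes b: "b > 0" and n: "n \<ge> 1"
  shows "MISE M (Fhat_Gam X n b) F =
      (\<integral>\<^sup>+x\<in>{0<..}. ennreal (variance (Fhat_Gam X n b x)) \<partial>lborel)
      + (\<integral>\<^sup>+x\<in>{0<..}. ennreal ((Bias M (Fhat_Gam X n b) F x)\<^sup>2) \<partial>lborel)" (is "_ = ?V + ?B")
proof -
  interpret pair_sigma_finite M lborel ..
  have [measurable]: "(\<lambda>(\<omega>, x). Fhat_Gam X n b x \<omega>) \<in> borel_measurable (M \<Otimes>\<^sub>M lborel)"
    unfolding Fhat_Gam_def case_prod_beta
  proof (intro borel_measurable_times borel_measurable_const borel_measurable_sum)
    fix i assume "i \<in> {1..n}"
    then have [measurable]: "X i \<in> borel_measurable M" by (intro X_measurable) auto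
    show "(\<lambda>w. Kbar_Gam (X i (fst w)) (snd w / b + 1) b) \<in> borel_measurable (M \<Otimes>\<^sub>M lborel)"
      by measurable
  qed
  have "MISE M (Fhat_Gam X n b) F
      = (\<integral>\<^sup>+x. \<integral>\<^sup>+\<omega>. ennreal ((Fhat_Gam X n b x \<omega> - F x)\<^sup>2) * indicator {0<..} x \<partial>M \<partial>lborel)"
    unfolding MISE_def by (intro Fubini'[symmetric]) measurable
  also have "\<dots> = (\<integral>\<^sup>+x. ennreal (variance (Fhat_Gam X n b x)) * indicator {0<..} x
      + ennreal ((Bias M (Fhat_Gam X n b) F x)\<^sup>2) * indicator {0<..} x \<partial>lborel)"
  proof (intro nn_integral_cong)
    fix x :: real
    show "(\<integral>\<^sup>+\<omega>. ennreal ((Fhat_Gam X n b x \<omega> - F x)\<^sup>2) * indicator {0<..} x \<partial>M)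
      = ennreal (variance (Fhat_Gam X n b x)) * indicator {0<..} x
      + ennreal ((Bias M (Fhat_Gam X n b) F x)\<^sup>2) * indicator {0<..} x"
    proof (cases "x > 0")
      case True
      note m = Fhat_moments[OF b True n]
      have "(\<integral>\<^sup>+\<omega>. ennreal ((Fhat_Gam X n b x \<omega> - F x)\<^sup>2) \<partial>M)
        = ennreal (expectation (\<lambda>\<omega>. (Fhat_Gam X n b x \<omega> - F x)\<^sup>2))"
        by (intro nn_integral_eq_integral m(3)) auto
      also have "\<dots> = ennreal (variance (Fhat_Gam X n b x)) + ennreal ((Bias M (Fhat_Gam X n b) F x)\<^sup>2)"
        unfolding m(4) by (intro ennreal_plus variance_positive) auto
      finally show ?thesis using True by simp
    qed simp
  qed
  also have "\<dots> = ?V + ?B"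
  proof (intro nn_integral_add)
    \<comment> \<open>Measurability of the variance in \<open>x\<close> is read off its closed form,
      available on the support of the indicator.\<close>
    have "(\<lambda>x. ennreal ((F x * (1 - F x) + var_err b x) / real n) * indicator {0<..} x) \<in> borel_measurable lborel"
      by measurable
    also have "(\<lambda>x. ennreal ((F x * (1 - F x) + var_err b x) / real n) * indicator {0<..} x)
        = (\<lambda>x. ennreal (variance (Fhat_Gam X n b x)) * indicator {0<..} x)"
      by (rule ext) (auto simp: Fhat_moments(2)[OF b _ n] indicator_def)
    finally show "(\<lambda>x. ennreal (variance (Fhat_Gam X n b x)) * indicator {0<..} x) \<in> borel_measurable lborel" .
    have "(\<lambda>x. ennreal ((bias b x)\<^sup>2) * indicator {0<..} x) \<in> borel_measurable lborel"
      by measurable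
    also have "(\<lambda>x. ennreal ((bias b x)\<^sup>2) * indicator {0<..} x)
        = (\<lambda>x. ennreal ((Bias M (Fhat_Gam X n b) F x)\<^sup>2) * indicator {0<..} x)"
      by (rule ext) (auto simp: Bias_eq[OF b _ n] indicator_def)
    finally show "(\<lambda>x. ennreal ((Bias M (Fhat_Gam X n b) F x)\<^sup>2) * indicator {0<..} x) \<in> borel_measurable lborel" .
  qed
  finally show ?thesis .
qed

end

section \<open>The expansion of the MISE and its minimizer\<close>

text \<open>The integral of \<open>g\<close> may be infinite. The negative part of \<open>w\<close>
  is moved to the other side, where only non-negative integrals are added; the finite integrals of
  the two parts are then cancelled in the extended reals.\<close>

lemma enn2ereal_nn_integral_perturb:
  fixes g w :: "'b \<Rightarrow> real"
  assumes [measurable]: "g \<in> borel_measurable N" and w: "integrable N w"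
    and g: "\<And>x. 0 \<le> g x" and gw: "\<And>x. 0 \<le> g x + w x"
  shows "enn2ereal (\<integral>\<^sup>+x. ennreal (g x + w x) \<partial>N) = enn2ereal (\<integral>\<^sup>+x. ennreal (g x) \<partial>N) + ereal (\<integral>x. w x \<partial>N)"
    (is "enn2ereal ?a = enn2ereal ?b + _")
proof -
  have [measurable]: "w \<in> borel_measurable N" using w by auto
  let ?p = "\<lambda>x. max 0 (w x)" and ?m = "\<lambda>x. max 0 (- w x)"
  have i: "integrable N ?p" "integrable N ?m" using w by auto
  have P: "(\<integral>\<^sup>+x. ennreal (?p x) \<partial>N) = ennreal (\<integral>x. ?p x \<partial>N)" "(\<integral>\<^sup>+x. ennreal (?m x) \<partial>N) = ennreal (\<integral>x. ?m x \<partial>N)"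
    by (intro nn_integral_eq_integral i; auto)+
  have pos: "0 \<le> (\<integral>x. ?p x \<partial>N)" "0 \<le> (\<integral>x. ?m x \<partial>N)"
    by (intro Bochner_Integration.integral_nonneg; auto)+
  have "(\<integral>x. w x \<partial>N) = (\<integral>x. ?p x - ?m x \<partial>N)"
    by (intro Bochner_Integration.integral_cong) auto
  then have W: "(\<integral>x. w x \<partial>N) = (\<integral>x. ?p x \<partial>N) - (\<integral>x. ?m x \<partial>N)" using i by simp
  have "?a + ennreal (\<integral>x. ?m x \<partial>N) = (\<integral>\<^sup>+x. ennreal (g x + w x) + ennreal (?m x) \<partial>N)"
    unfolding P[symmetric] by (intro nn_integral_add[symmetric]) auto
  also have "\<dots> = (\<integral>\<^sup>+x. ennreal (g x) + ennreal (?p x) \<partial>N)"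
    using g gw by (intro nn_integral_cong) (auto simp: ennreal_plus[symmetric] max_def simp del: ennreal_plus)
  also have "\<dots> = ?b + ennreal (\<integral>x. ?p x \<partial>N)"
    unfolding P[symmetric] by (intro nn_integral_add) auto
  finally have e: "?a + ennreal (\<integral>x. ?m x \<partial>N) = ?b + ennreal (\<integral>x. ?p x \<partial>N)" .
  have "enn2ereal ?a + ereal (\<integral>x. ?m x \<partial>N) = enn2ereal ?b + ereal (\<integral>x. ?p x \<partial>N)"
    using arg_cong[OF e, of enn2ereal] by (simp only: plus_ennreal.rep_eq enn2ereal_ennreal pos)
  moreover have "a = b + ereal (p - m)" if "a + ereal m = b + ereal p" for a b :: ereal and m p
    using that by (cases a; cases b) auto
  ultimately show ?thesis unfolding W by blast
qed

lemma ereal_expansion_regroup: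
  assumes "c > 0"
  shows "ereal c * (I + ereal w) + ereal s
    = ereal c * I - ereal (c * r * v) + ereal p + ereal (c * (w + r * v)) + ereal (s - p)"
proof (cases I)
  case (real i)
  have "c * (i + w) + s = c * i - c * r * v + p + c * (w + r * v) + (s - p)"
    by algebra
  then show ?thesis unfolding real plus_ereal.simps times_ereal.simps minus_ereal_def uminus_ereal.simps by simp
next
  case PInf
  then show ?thesis using assms by simp
next
  case MInf
  then show ?thesis using assms by simp
qed

lemma divide_by_scaled:
  "s \<noteq> 0 \<Longrightarrow> N \<noteq> 0 \<Longrightarrow> 1 / N * (w + s * v) / (1 / N * s) = w / s + (v :: real)"
  by (simp add: field_simps)

text \<open>The objective after rescaling, with \<open>u\<close> the square root of \<open>b\<close>
  over its optimal value. The factor \<open>(u - 1)\<^sup>2\<close> in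
  \<open>u ^ 4 - 4 * u + 3\<close> shows the minimum and its uniqueness without calculus.\<close>

lemma quartic_ge: "u ^ 4 - 4 * u \<ge> (- 3 :: real)" "u ^ 4 - 4 * u = (- 3 :: real) \<longleftrightarrow> u = 1"
proof -
  have f: "u ^ 4 - 4 * u + 3 = (u - 1)\<^sup>2 * ((u + 1)\<^sup>2 + 2)" by algebra
  have p: "(u + 1)\<^sup>2 + 2 > 0" by (simp add: add_nonneg_pos)
  then have "(u - 1)\<^sup>2 * ((u + 1)\<^sup>2 + 2) \<ge> 0" by simp
  then show "u ^ 4 - 4 * u \<ge> - 3" using f by linarith
  have "u ^ 4 - 4 * u = - 3 \<longleftrightarrow> (u - 1)\<^sup>2 * ((u + 1)\<^sup>2 + 2) = 0" using f by linarith
  also have "\<dots> \<longleftrightarrow> u = 1" using p by auto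
  finally show "u ^ 4 - 4 * u = - 3 \<longleftrightarrow> u = 1" .
qed

context gamma_kernel_sample
begin

text \<open>An identity for fixed \<open>n\<close> and \<open>b\<close>: the two added reals are
  exactly the integrated errors of variance and squared bias, so the asymptotics reduce to two real
  limits.\<close>

lemma MISE_exact:
  assumes b: "b > 0" and n: "n \<ge> 1"
    and V: "set_integrable lborel {0<..} (var_err b)" and S: "set_integrable lborel {0<..} (\<lambda>x. (bias b x)\<^sup>2)"
  shows "enn2ereal (MISE M (Fhat_Gam X n b) F) = MISE_main F f f' n b
    + ereal (1 / real n * ((LBINT x:{0<..}. var_err b x) + sqrt b * var_const f))
    + ereal ((LBINT x:{0<..}. (bias b x)\<^sup>2) - b\<^sup>2 * bias_const f f')"
proof -
  let ?W = "LBINT x:{0<..}. var_err b x" and ?S = "LBINT x:{0<..}. (bias b x)\<^sup>2"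
  let ?g = "\<lambda>x. indicator {0<..} x * (F x * (1 - F x))" and ?w = "\<lambda>x. indicator {0<..} x *\<^sub>R var_err b x"
  have F: "0 \<le> F x * (1 - F x)" if "x > 0" for x using F_bounds[OF that] by simp
  \<comment> \<open>Non-negativity comes from the variance itself, not from an estimate of
    \<open>var_err\<close>.\<close>
  have vge: "0 \<le> F x * (1 - F x) + var_err b x" if "x > 0" for x
  proof -
    have "0 \<le> (F x * (1 - F x) + var_err b x) / real n"
      unfolding Fhat_moments(2)[OF b that n, symmetric] by (rule variance_positive)
    then show ?thesis using n by (simp add: zero_le_divide_iff)
  qed
  have "(\<integral>\<^sup>+x\<in>{0<..}. ennreal (variance (Fhat_Gam X n b x)) \<partial>lborel)
      = (\<integral>\<^sup>+x. ennreal (1 / real n) * ennreal (?g x + ?w x) \<partial>lborel)"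
    by (intro nn_integral_cong)
      (auto simp: Fhat_moments(2)[OF b _ n] indicator_def ennreal_mult'[symmetric])
  also have "\<dots> = ennreal (1 / real n) * (\<integral>\<^sup>+x. ennreal (?g x + ?w x) \<partial>lborel)"
    by (intro nn_integral_cmult) measurable
  finally have "enn2ereal (\<integral>\<^sup>+x\<in>{0<..}. ennreal (variance (Fhat_Gam X n b x)) \<partial>lborel)
      = ereal (1 / real n) * enn2ereal (\<integral>\<^sup>+x. ennreal (?g x + ?w x) \<partial>lborel)"
    by (simp add: times_ennreal.rep_eq)
  also have "enn2ereal (\<integral>\<^sup>+x. ennreal (?g x + ?w x) \<partial>lborel) = enn2ereal (\<integral>\<^sup>+x. ennreal (?g x) \<partial>lborel) + ereal ?W"
    unfolding set_lebesgue_integral_def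
  proof (rule enn2ereal_nn_integral_perturb)
    show "integrable lborel ?w" using V by (simp add: set_integrable_def)
  qed (use F vge in \<open>auto simp: indicator_def\<close>)
  also have "(\<integral>\<^sup>+x. ennreal (?g x) \<partial>lborel) = int_FF F"
    unfolding int_FF_def by (intro nn_integral_cong) (auto simp: indicator_def)
  finally have 1: "enn2ereal (\<integral>\<^sup>+x\<in>{0<..}. ennreal (variance (Fhat_Gam X n b x)) \<partial>lborel)
      = ereal (1 / real n) * (enn2ereal (int_FF F) + ereal ?W)" .
  have "(\<integral>\<^sup>+x\<in>{0<..}. ennreal ((Bias M (Fhat_Gam X n b) F x)\<^sup>2) \<partial>lborel) = (\<integral>\<^sup>+x\<in>{0<..}. ennreal ((bias b x)\<^sup>2) \<partial>lborel)"
    by (intro nn_integral_cong) (auto simp: Bias_eq[OF b _ n] indicator_def)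
  also have "\<dots> = ennreal ?S" by (intro set_nn_integral_of_integrable S) auto
  finally have 2: "enn2ereal (\<integral>\<^sup>+x\<in>{0<..}. ennreal ((Bias M (Fhat_Gam X n b) F x)\<^sup>2) \<partial>lborel) = ereal ?S"
    by (simp add: set_lebesgue_integral_def enn2ereal_ennreal)
  have "enn2ereal (MISE M (Fhat_Gam X n b) F)
      = enn2ereal (\<integral>\<^sup>+x\<in>{0<..}. ennreal (variance (Fhat_Gam X n b x)) \<partial>lborel)
      + enn2ereal (\<integral>\<^sup>+x\<in>{0<..}. ennreal ((Bias M (Fhat_Gam X n b) F x)\<^sup>2) \<partial>lborel)"
    unfolding MISE_decomposition[OF b n] by (rule plus_ennreal.rep_eq)
  also have "\<dots> = ereal (1 / real n) * (enn2ereal (int_FF F) + ereal ?W) + ereal ?S"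
    by (simp only: 1 2)
  also have "\<dots> = MISE_main F f f' n b + ereal (1 / real n * (?W + sqrt b * var_const f)) + ereal (?S - b\<^sup>2 * bias_const f f')"
    unfolding MISE_main_def by (rule ereal_expansion_regroup) (use n in simp)
  finally show ?thesis .
qed

lemma MISE_expansion:
  fixes b :: "nat \<Rightarrow> real"
  assumes b: "\<And>n. n \<ge> 1 \<Longrightarrow> b n > 0" "b \<longlonglongrightarrow> 0"
    and sq: "set_integrable lborel {0<..} (\<lambda>x. sqrt x * f x)"
    and g: "set_integrable lborel {0<..} (\<lambda>x. (f x + x / 2 * f' x)\<^sup>2)"
  shows "\<exists>e1 e2 :: nat \<Rightarrow> real. e1 \<in> o(\<lambda>n. 1 / real n * sqrt (b n)) \<and> e2 \<in> o(\<lambda>n. (b n)\<^sup>2) \<and>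
      (\<forall>\<^sub>F n in sequentially. enn2ereal (MISE M (Fhat_Gam X n (b n)) F) =
         MISE_main F f f' n (b n) + ereal (e1 n) + ereal (e2 n))"
proof -
  \<comment> \<open>\<open>\<beta>\<close> agrees with \<open>b\<close> from some index on but lies
    in \<open>{0<..1}\<close> for every \<open>n\<close>, as the integrated limits require; the
    default 1 also covers \<open>n = 0\<close>, where \<open>b\<close> is unconstrained.\<close>
  define \<beta> where "\<beta> n = (if n \<ge> 1 \<and> b n \<le> 1 then b n else 1)" for n
  have "\<forall>\<^sub>F n in sequentially. b n < 1" using b(2) by (intro order_tendstoD(2)) auto
  then have ev: "\<forall>\<^sub>F n in sequentially. \<beta> n = b n \<and> n \<ge> 1"
    using eventually_ge_at_top[of 1] by eventually_elim (simp add: \<beta>_def)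
  have \<beta>: "0 < \<beta> n" "\<beta> n \<le> 1" for n using b(1)[of n] by (auto simp: \<beta>_def)
  have \<beta>0: "\<beta> \<longlonglongrightarrow> 0"
    by (rule Lim_transform_eventually[OF b(2)]) (use ev in \<open>auto elim: eventually_mono\<close>)
  note g' = g[folded asym_bias_def]
  note V = var_err_integral_asymptotics[OF \<beta> \<beta>0 sq]
  note S = bias_integral_asymptotics[OF \<beta> \<beta>0 g']
  define e1 where "e1 n = 1 / real n * ((LBINT x:{0<..}. var_err (\<beta> n) x) + sqrt (\<beta> n) * var_const f)" for n
  define e2 where "e2 n = (LBINT x:{0<..}. (bias (\<beta> n) x)\<^sup>2) - (\<beta> n)\<^sup>2 * bias_const f f'" for n
  have "e1 \<in> o(\<lambda>n. 1 / real n * sqrt (b n))"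
  proof (rule smalloI_tendsto)
    have "(\<lambda>n. (LBINT x:{0<..}. var_err (\<beta> n) x) / sqrt (\<beta> n) + var_const f)
        \<longlonglongrightarrow> - (LBINT x:{0<..}. sqrt x * f x / sqrt pi) + var_const f"
      by (intro tendsto_intros V(2))
    then have "(\<lambda>n. (LBINT x:{0<..}. var_err (\<beta> n) x) / sqrt (\<beta> n) + var_const f) \<longlonglongrightarrow> 0"
      by (simp add: var_const_def)
    then show "(\<lambda>n. e1 n / (1 / real n * sqrt (b n))) \<longlonglongrightarrow> 0"
    proof (rule Lim_transform_eventually)
      show "\<forall>\<^sub>F n in sequentially. (LBINT x:{0<..}. var_err (\<beta> n) x) / sqrt (\<beta> n) + var_const f
          = e1 n / (1 / real n * sqrt (b n))"
        using ev
      proof eventually_elim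
        case (elim n)
        have nz: "sqrt (\<beta> n) \<noteq> 0" "real n \<noteq> 0" using \<beta>(1)[of n] elim by auto
        have "sqrt (b n) = sqrt (\<beta> n)" using elim by simp
        then show ?case
          using divide_by_scaled[OF nz, of "LBINT x:{0<..}. var_err (\<beta> n) x" "var_const f"]
          by (simp only: e1_def)
      qed
    qed
    show "\<forall>\<^sub>F n in sequentially. 1 / real n * sqrt (b n) \<noteq> 0"
      using eventually_ge_at_top[of 1] by eventually_elim (use b(1) in force)
  qed
  moreover have "e2 \<in> o(\<lambda>n. (b n)\<^sup>2)"
  proof (rule smalloI_tendsto)
    have "(\<lambda>n. (LBINT x:{0<..}. (bias (\<beta> n) x)\<^sup>2) / (\<beta> n)\<^sup>2 - bias_const f f')
        \<longlonglongrightarrow> (LBINT x:{0<..}. (asym_bias x)\<^sup>2) - bias_const f f'"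
      by (intro tendsto_intros S(2))
    then have "(\<lambda>n. (LBINT x:{0<..}. (bias (\<beta> n) x)\<^sup>2) / (\<beta> n)\<^sup>2 - bias_const f f') \<longlonglongrightarrow> 0"
      by (simp add: bias_const_def asym_bias_def)
    then show "(\<lambda>n. e2 n / (b n)\<^sup>2) \<longlonglongrightarrow> 0"
    proof (rule Lim_transform_eventually)
      show "\<forall>\<^sub>F n in sequentially. (LBINT x:{0<..}. (bias (\<beta> n) x)\<^sup>2) / (\<beta> n)\<^sup>2 - bias_const f f' = e2 n / (b n)\<^sup>2"
        using ev
      proof eventually_elim
        case (elim n)
        have "(\<beta> n)\<^sup>2 \<noteq> 0" using \<beta>(1)[of n] by simp
        then show ?case using elim by (simp add: e2_def diff_divide_distrib)
      qed
    qed
    show "\<forall>\<^sub>F n in sequentially. (b n)\<^sup>2 \<noteq> 0"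
      using eventually_ge_at_top[of 1] by eventually_elim (use b(1) in force)
  qed
  moreover have "\<forall>\<^sub>F n in sequentially. enn2ereal (MISE M (Fhat_Gam X n (b n)) F) =
         MISE_main F f f' n (b n) + ereal (e1 n) + ereal (e2 n)"
    using ev
  proof eventually_elim
    case (elim n)
    then show ?case using MISE_exact[OF \<beta>(1)[of n] _ V(1) S(1), of n] by (simp add: e1_def e2_def)
  qed
  ultimately show ?thesis by blast
qed

text \<open>Otherwise \<open>f\<close> would vanish almost everywhere on the half-line, against
  total mass 1. It makes the optimal bandwidth positive.\<close>

lemma var_const_pos:
  assumes sq: "set_integrable lborel {0<..} (\<lambda>x. sqrt x * f x)"
  shows "var_const f > 0"
proof -
  have n: "0 \<le> indicator {0<..} x *\<^sub>R (sqrt x * f x)" for x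
    using f_nonneg by (auto simp: indicator_def)
  have "(LBINT x:{0<..}. sqrt x * f x) \<noteq> 0"
  proof
    assume "(LBINT x:{0<..}. sqrt x * f x) = 0"
    then have "AE x in lborel. indicator {0<..} x *\<^sub>R (sqrt x * f x) = 0"
      using sq n unfolding set_lebesgue_integral_def set_integrable_def
      by (subst (asm) integral_nonneg_eq_0_iff_AE) auto
    then have "AE x in lborel. indicator {0<..} x *\<^sub>R f x = 0"
      by eventually_elim (auto simp: indicator_def)
    then have "(LBINT x:{0<..}. f x) = 0"
      unfolding set_lebesgue_integral_def by (rule integral_eq_zero_AE)
    then show False using f_integral by simp
  qed
  moreover have "0 \<le> (LBINT x:{0<..}. sqrt x * f x)"
    unfolding set_lebesgue_integral_def using n by (intro Bochner_Integration.integral_nonneg) auto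
  ultimately show ?thesis by (simp add: var_const_def)
qed

end

section \<open>Minimising the two terms that depend on the bandwidth\<close>

lemma MISE_main_eq:
  assumes "n \<ge> 1"
  shows "MISE_main F f f' n b = ereal (1 / real n) * enn2ereal (int_FF F)
    + ereal (b\<^sup>2 * bias_const f f' - 1 / real n * sqrt b * var_const f)"
  unfolding MISE_main_def using assms by (cases "enn2ereal (int_FF F)") auto

context
  fixes f f' :: "real \<Rightarrow> real" and n :: nat
  assumes V: "var_const f > 0" and C: "bias_const f f' > 0" and n: "n \<ge> 1"
begin

lemma b_opt_pos: "b_opt f f' n > 0"
  using V C n by (simp add: b_opt_def)

text \<open>The stationarity equation of the two terms depending on \<open>b\<close>, multiplied by
  \<open>2 * b\<close>.\<close>

lemma sqrt_b_opt: "1 / real n * sqrt (b_opt f f' n) * var_const f = 4 * bias_const f f' * (b_opt f f' n)\<^sup>2"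
proof -
  \<comment> \<open>In terms of \<open>q\<close> the optimal bandwidth is
    \<open>q powr (- (2 / 3))\<close>, so its square root is \<open>q\<close> times its
    square.\<close>
  define q where "q = 4 * bias_const f f' * real n / var_const f"
  have q: "q > 0" using V C n by (simp add: q_def)
  have b: "b_opt f f' n = q powr (- (2 / 3))"
    using V C n by (simp add: b_opt_def q_def powr_mult[symmetric] mult_ac)
  have s: "sqrt (b_opt f f' n) = q powr (- (1 / 3))"
    unfolding b by (subst powr_half_sqrt[symmetric]) (simp_all add: powr_powr)
  have "(b_opt f f' n)\<^sup>2 = q powr (- (1 / 3) + - 1)"
    unfolding b power2_eq_square powr_add[symmetric] by simp
  also have "\<dots> = q powr (- (1 / 3)) * q powr - 1" by (rule powr_add)
  also have "q powr - 1 = 1 / q" using q by (simp add: powr_minus_divide)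
  finally have "sqrt (b_opt f f' n) = q * (b_opt f f' n)\<^sup>2" using q s by simp
  then have "1 / real n * sqrt (b_opt f f' n) * var_const f = q * var_const f / real n * (b_opt f f' n)\<^sup>2"
    by simp
  also have "q * var_const f / real n = 4 * bias_const f f'" using V n by (simp add: q_def)
  finally show ?thesis .
qed

text \<open>In units of \<open>b_opt\<close>, stationarity gives both terms the common factor
  \<open>bias_const f f' * (b_opt f f' n)\<^sup>2\<close>; the quartic remains.\<close>

lemma main_terms_scaled:
  assumes b: "b > 0"
  shows "b\<^sup>2 * bias_const f f' - 1 / real n * sqrt b * var_const f
    = bias_const f f' * (b_opt f f' n)\<^sup>2 * (sqrt (b / b_opt f f' n) ^ 4 - 4 * sqrt (b / b_opt f f' n))"
proof -
  let ?b = "b_opt f f' n"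
  have "sqrt b = sqrt (b / ?b) * sqrt ?b" using b_opt_pos by (simp add: real_sqrt_divide)
  then have "1 / real n * sqrt b * var_const f = sqrt (b / ?b) * (1 / real n * sqrt ?b * var_const f)"
    by simp
  also have "\<dots> = sqrt (b / ?b) * (4 * bias_const f f' * ?b\<^sup>2)" unfolding sqrt_b_opt ..
  finally have "1 / real n * sqrt b * var_const f = sqrt (b / ?b) * (4 * bias_const f f' * ?b\<^sup>2)" .
  moreover have "sqrt (b / ?b) ^ 4 = (b / ?b)\<^sup>2"
  proof -
    have "sqrt (b / ?b) ^ 4 = ((sqrt (b / ?b))\<^sup>2)\<^sup>2" by (simp flip: power_mult)
    also have "(sqrt (b / ?b))\<^sup>2 = b / ?b" using b b_opt_pos by (intro real_sqrt_pow2) auto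
    finally show ?thesis .
  qed
  moreover have "b\<^sup>2 = ?b\<^sup>2 * (b / ?b)\<^sup>2" using b_opt_pos by (simp add: power_divide)
  moreover have "p * w * k - r * (4 * k * p) = k * p * (w - 4 * r)" for p w k r :: real
    by (simp add: algebra_simps)
  ultimately show ?thesis by simp
qed

lemma b_opt_minimizes:
  assumes b: "b > 0"
  shows "- 3 * (bias_const f f' * (b_opt f f' n)\<^sup>2) \<le> b\<^sup>2 * bias_const f f' - 1 / real n * sqrt b * var_const f"
    and "b\<^sup>2 * bias_const f f' - 1 / real n * sqrt b * var_const f = - 3 * (bias_const f f' * (b_opt f f' n)\<^sup>2) \<longleftrightarrow> b = b_opt f f' n"
proof -
  let ?k = "bias_const f f' * (b_opt f f' n)\<^sup>2" and ?u = "sqrt (b / b_opt f f' n)"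
  have k: "?k > 0" using C b_opt_pos by simp
  have "?k * (- 3) \<le> ?k * (?u ^ 4 - 4 * ?u)"
    using k quartic_ge(1)[of ?u] by (intro mult_left_mono) auto
  then show "- 3 * ?k \<le> b\<^sup>2 * bias_const f f' - 1 / real n * sqrt b * var_const f"
    unfolding main_terms_scaled[OF b] by (simp only: mult.commute)
  have "?k * (?u ^ 4 - 4 * ?u) = - 3 * ?k \<longleftrightarrow> ?u ^ 4 - 4 * ?u = - 3"
    using k mult_cancel_left[of ?k "?u ^ 4 - 4 * ?u" "- 3"] by (simp only: mult.commute[of "- 3"]) auto
  also have "\<dots> \<longleftrightarrow> ?u = 1" by (rule quartic_ge(2))
  also have "\<dots> \<longleftrightarrow> b = b_opt f f' n" using b_opt_pos by auto
  finally show "b\<^sup>2 * bias_const f f' - 1 / real n * sqrt b * var_const f = - 3 * ?k \<longleftrightarrow> b = b_opt f f' n"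
    unfolding main_terms_scaled[OF b] .
qed

lemma b_opt_square: "(b_opt f f' n)\<^sup>2 = real n powr (- (4 / 3)) * (4 * bias_const f f' / var_const f) powr (- (4 / 3))"
  unfolding b_opt_def power_mult_distrib by (simp add: power2_eq_square powr_add[symmetric])

text \<open>With C and V for the two constants, 4 C (4 C / V)^(-4/3) is V^(4/3) (4 C)^(-1/3); the 4
  borrowed for this turns the 3 of the quartic minimum into 3/4.\<close>

lemma b_opt_value:
  "3 * (bias_const f f' * (b_opt f f' n)\<^sup>2)
    = real n powr (- (4 / 3)) * (3 / 4) * (var_const f ^ 4 / (4 * bias_const f f')) powr (1 / 3)"
proof -
  let ?C = "bias_const f f'" and ?V = "var_const f"
  have "(4 * ?C / ?V) powr (- (4 / 3)) = ?V powr (4 / 3) / (4 * ?C) powr (4 / 3)"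
    using V C by (simp add: powr_divide powr_minus_divide)
  also have "(4 * ?C) powr (4 / 3) = (4 * ?C) powr (1 / 3) * (4 * ?C)"
    using C powr_add[of "4 * ?C" "1 / 3" 1] by simp
  also have "?V powr (4 / 3) = (?V ^ 4) powr (1 / 3)"
  proof -
    have "(?V ^ 4) powr (1 / 3) = (?V powr 4) powr (1 / 3)" using V by simp
    also have "\<dots> = ?V powr (4 / 3)" by (simp only: powr_powr) simp
    finally show ?thesis ..
  qed
  finally have "4 * ?C * (4 * ?C / ?V) powr (- (4 / 3)) = (?V ^ 4 / (4 * ?C)) powr (1 / 3)"
    using V C by (simp add: powr_divide)
  then show ?thesis unfolding b_opt_square by (simp add: algebra_simps)
qed

text \<open>Uniqueness is tied to a finite \<open>int_FF F\<close>: if it is infinite, the expansion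
  is infinite for every \<open>b\<close>, and every positive \<open>b\<close> is a
  minimiser.\<close>

lemma asymp_optimal_b_opt:
  "asymp_optimal F f f' n (b_opt f f' n)"
  "int_FF F < \<infinity> \<Longrightarrow> asymp_optimal F f f' n \<beta> \<Longrightarrow> \<beta> = b_opt f f' n"
proof -
  have eq: "(b_opt f f' n)\<^sup>2 * bias_const f f' - 1 / real n * sqrt (b_opt f f' n) * var_const f
      = - 3 * (bias_const f f' * (b_opt f f' n)\<^sup>2)"
    using b_opt_minimizes(2)[OF b_opt_pos] by blast
  have le: "MISE_main F f f' n (b_opt f f' n) \<le> MISE_main F f f' n y" if "y > 0" for y
    unfolding MISE_main_eq[OF n] eq using b_opt_minimizes(1)[OF that]
    by (intro add_left_mono) simp
  then show "asymp_optimal F f f' n (b_opt f f' n)"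
    using b_opt_pos unfolding asymp_optimal_def is_arg_min_def by (meson leD)
  assume fin: "int_FF F < \<infinity>" and opt: "asymp_optimal F f f' n \<beta>"
  have \<beta>: "\<beta> > 0" "MISE_main F f f' n \<beta> \<le> MISE_main F f f' n (b_opt f f' n)"
    using opt b_opt_pos unfolding asymp_optimal_def is_arg_min_def by (meson not_less)+
  obtain r where r: "0 \<le> r" "int_FF F = ennreal r" using fin by (cases "int_FF F") auto
  have "\<beta>\<^sup>2 * bias_const f f' - 1 / real n * sqrt \<beta> * var_const f \<le> - 3 * (bias_const f f' * (b_opt f f' n)\<^sup>2)"
    using \<beta>(2) r unfolding MISE_main_eq[OF n] eq by (simp add: enn2ereal_ennreal)
  then show "\<beta> = b_opt f f' n"
    using b_opt_minimizes[OF \<beta>(1)] by linarith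
qed

end

section \<open>The expansion at the optimal bandwidth\<close>

lemma b_opt_tendsto_0: "b_opt f f' \<longlonglongrightarrow> 0"
proof -
  have "(\<lambda>n. real n powr (- (2 / 3))) \<longlonglongrightarrow> 0" by real_asymp
  then have "(\<lambda>n. real n powr (- (2 / 3)) * (4 * bias_const f f' / var_const f) powr (- (2 / 3))) \<longlonglongrightarrow> 0"
    by (rule tendsto_mult_left_zero)
  then show ?thesis by (simp add: b_opt_def[abs_def])
qed

text \<open>By stationarity both error scales, \<open>1 / real n * sqrt b\<close> and
  \<open>b\<^sup>2\<close>, become constant multiples of \<open>real n powr (- (4 / 3))\<close> at
  \<open>b_opt\<close>, so the two errors merge into one.\<close>

lemma (in gamma_kernel_sample) MISE_b_opt:
  assumes sq: "set_integrable lborel {0<..} (\<lambda>x. sqrt x * f x)"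
    and g: "set_integrable lborel {0<..} (\<lambda>x. (f x + x / 2 * f' x)\<^sup>2)"
    and C: "bias_const f f' > 0"
  shows "\<exists>e :: nat \<Rightarrow> real. e \<in> o(\<lambda>n. real n powr (- (4 / 3))) \<and>
    (\<forall>\<^sub>F n in sequentially. enn2ereal (MISE M (Fhat_Gam X n (b_opt f f' n)) F) =
       ereal (1 / real n) * enn2ereal (int_FF F)
       - ereal (real n powr (- (4 / 3)) * (3 / 4) * (var_const f ^ 4 / (4 * bias_const f f')) powr (1 / 3))
       + ereal (e n))"
proof -
  note V = var_const_pos[OF sq]
  let ?b = "b_opt f f'" and ?n = "\<lambda>n. real n powr (- (4 / 3))"
  let ?q = "(4 * bias_const f f' / var_const f) powr (- (4 / 3))"
  obtain e1 e2 where e1: "e1 \<in> o(\<lambda>n. 1 / real n * sqrt (?b n))" and e2: "e2 \<in> o(\<lambda>n. (?b n)\<^sup>2)"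
    and E: "\<forall>\<^sub>F n in sequentially. enn2ereal (MISE M (Fhat_Gam X n (?b n)) F) =
       MISE_main F f f' n (?b n) + ereal (e1 n) + ereal (e2 n)"
    using MISE_expansion[OF b_opt_pos[OF V C] b_opt_tendsto_0 sq g] by blast
  have ge1: "\<forall>\<^sub>F n in sequentially. n \<ge> (1::nat)" by (rule eventually_ge_at_top)
  have "\<forall>\<^sub>F n in sequentially. (?b n)\<^sup>2 = ?q * ?n n"
    using ge1 by eventually_elim (simp add: b_opt_square[OF V C] mult.commute)
  then have "(\<lambda>n. (?b n)\<^sup>2) \<in> O(?n)"
    by (intro bigoI[where c = ?q]) (auto elim!: eventually_mono)
  then have "e2 \<in> o(?n)" using e2 by (rule landau_o.small_big_trans[rotated])
  moreover have "e1 \<in> o(?n)"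
  proof (rule landau_o.small_big_trans[OF e1])
    have "\<forall>\<^sub>F n in sequentially. 1 / real n * sqrt (?b n) = 4 * bias_const f f' / var_const f * ?q * ?n n"
      using ge1
    proof eventually_elim
      case (elim n)
      have "1 / real n * sqrt (?b n) = 4 * bias_const f f' / var_const f * (?b n)\<^sup>2"
        using sqrt_b_opt[OF V C elim] V by (simp add: field_simps)
      then show ?case by (simp add: b_opt_square[OF V C elim] mult_ac)
    qed
    moreover have "(\<lambda>n. k * ?n n) \<in> O(?n)" for k :: real
      by (cases "k = 0") simp_all
    ultimately show "(\<lambda>n. 1 / real n * sqrt (?b n)) \<in> O(?n)"
      by (rule landau_o.big.in_cong[THEN iffD2])
  qed
  ultimately have "(\<lambda>n. e1 n + e2 n) \<in> o(?n)" by (intro sum_in_smallo)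
  moreover have "\<forall>\<^sub>F n in sequentially. enn2ereal (MISE M (Fhat_Gam X n (?b n)) F) =
       ereal (1 / real n) * enn2ereal (int_FF F)
       - ereal (?n n * (3 / 4) * (var_const f ^ 4 / (4 * bias_const f f')) powr (1 / 3))
       + ereal (e1 n + e2 n)"
    using E ge1
  proof eventually_elim
    case (elim n)
    have eq: "(?b n)\<^sup>2 * bias_const f f' - 1 / real n * sqrt (?b n) * var_const f
        = - (?n n * (3 / 4) * (var_const f ^ 4 / (4 * bias_const f f')) powr (1 / 3))"
      unfolding b_opt_value[OF V C elim(2), symmetric]
      using b_opt_minimizes(2)[OF V C elim(2) b_opt_pos[OF V C elim(2)]] by simp
    show ?case
      unfolding elim(1) MISE_main_eq[OF elim(2)] eq
      by (cases "ereal (1 / real n) * enn2ereal (int_FF F)") auto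
  qed
  ultimately show ?thesis by blast
qed

theorem proposition4p3:
  fixes M :: "'a measure" and X :: "nat \<Rightarrow> 'a \<Rightarrow> real"
    and F f f' :: "real \<Rightarrow> real" and b :: "nat \<Rightarrow> real"
  assumes "prob_space M"
    and "prob_space.indep_vars M (\<lambda>_. borel) X {1..}"
    and "\<And>i. i \<ge> 1 \<Longrightarrow> cdf (distr M borel (X i)) = F"
    and "\<And>x. x \<le> 0 \<Longrightarrow> F x = 0"
    and "\<And>x. x > 0 \<Longrightarrow> (F has_real_derivative f x) (at x)"
    and "\<And>x. x > 0 \<Longrightarrow> (f has_real_derivative f' x) (at x)"
    and "continuous_on {0<..} f" and "continuous_on {0<..} f'"
    and "bounded (f ` {0<..})" and "bounded (f' ` {0<..})"
    and "\<And>n. n \<ge> 1 \<Longrightarrow> b n > 0" and "b \<longlonglongrightarrow> 0"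
    and "set_integrable lborel {0<..} (\<lambda>x. sqrt x * f x)"
    and "set_integrable lborel {0<..} (\<lambda>x. (f x + x / 2 * f' x)\<^sup>2)"
  shows
    "(\<forall>n\<ge>1. MISE M (Fhat_Gam X n (b n)) F =
        (\<integral>\<^sup>+x\<in>{0<..}. ennreal (prob_space.variance M (Fhat_Gam X n (b n) x)) \<partial>lborel)
        + (\<integral>\<^sup>+x\<in>{0<..}. ennreal ((Bias M (Fhat_Gam X n (b n)) F x)\<^sup>2) \<partial>lborel))
     \<and> (\<exists>e1 e2 :: nat \<Rightarrow> real.
          e1 \<in> o(\<lambda>n. 1 / real n * sqrt (b n)) \<and> e2 \<in> o(\<lambda>n. (b n)\<^sup>2) \<and>
          (\<forall>\<^sub>F n in sequentially. enn2ereal (MISE M (Fhat_Gam X n (b n)) F) =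
             MISE_main F f f' n (b n) + ereal (e1 n) + ereal (e2 n)))
     \<and> (bias_const f f' > 0 \<longrightarrow>
          (\<forall>n\<ge>1. asymp_optimal F f f' n (b_opt f f' n)
             \<and> (int_FF F < \<infinity> \<longrightarrow> (\<forall>\<beta>. asymp_optimal F f f' n \<beta> \<longrightarrow> \<beta> = b_opt f f' n)))
          \<and> (\<exists>e :: nat \<Rightarrow> real.
               e \<in> o(\<lambda>n. real n powr (- (4 / 3))) \<and>
               (\<forall>\<^sub>F n in sequentially. enn2ereal (MISE M (Fhat_Gam X n (b_opt f f' n)) F) =
                  ereal (1 / real n) * enn2ereal (int_FF F)
                  - ereal (real n powr (- (4 / 3)) * (3 / 4)
                      * (var_const f ^ 4 / (4 * bias_const f f')) powr (1 / 3))
                  + ereal (e n))))"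
proof -
  interpret prob_space M by fact
  \<comment> \<open>\<open>f\<close> and \<open>f'\<close> are constrained only on the positive
    half-line; their extensions by 0 are Borel on the whole line and give the same integrals over
    \<open>{0<..}\<close>.\<close>
  define g where "g x = (if x > 0 then f x else 0)" for x
  define g' where "g' x = (if x > 0 then f' x else 0)" for x
  have rv: "X i \<in> borel_measurable M" if "i \<ge> 1" for i
    using assms(2) that by (auto simp: indep_vars_def)
  interpret D: real_distribution "distr M borel (X 1)"
    by (intro real_distribution_distr rv) simp
  have cdf: "cdf (distr M borel (X 1)) = F" by (rule assms(3)) simp
  obtain B1 B2 where B: "\<And>x. x > 0 \<Longrightarrow> \<bar>f x\<bar> \<le> B1" "\<And>x. x > 0 \<Longrightarrow> \<bar>f' x\<bar> \<le> B2"
    using assms(9,10) unfolding bounded_iff by auto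
  define B where "B = max 0 (max B1 B2)"
  have near: "\<forall>\<^sub>F y in nhds x. y > 0" if "x > 0" for x :: real
    using that by (intro order_tendstoD(1)[OF filterlim_ident]) auto
  have smooth: "smooth_halfline_cdf F g g' B"
  proof
    show "mono F" unfolding cdf[symmetric] by (intro monoI D.cdf_nondecreasing)
    have "continuous (at_right 0) F" unfolding cdf[symmetric] by (rule D.cdf_is_right_cont)
    then show "(F \<longlongrightarrow> 0) (at_right 0)" using assms(4)[of 0] by (simp add: continuous_within)
    show "(F \<longlongrightarrow> 1) at_top" unfolding cdf[symmetric] by (rule D.cdf_lim_at_top_prob)
    show "(F has_real_derivative g x) (at x)" if "x > 0" for x
      using assms(5)[OF that] that by (simp add: g_def)
    show "(g has_real_derivative g' x) (at x)" if "x > 0" for x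
    proof -
      have "\<forall>\<^sub>F y in nhds x. f y = g y"
        using near[OF that] by eventually_elim (simp add: g_def)
      then show ?thesis
        using assms(6)[OF that] that DERIV_cong_ev[of x x f g "f' x" "g' x"] by (simp add: g'_def)
    qed
    show "continuous_on {0<..} g'"
      using assms(8) by (subst continuous_on_cong[where g = f']) (auto simp: g'_def)
    show "\<bar>g x\<bar> \<le> B" "\<bar>g' x\<bar> \<le> B" for x
      using B[of x] by (auto simp: g_def g'_def B_def)
  qed (auto simp: g_def g'_def)
  then interpret S: smooth_halfline_cdf F g g' B .
  \<comment> \<open>A law on the line is determined by its distribution function; this turns the
    hypothesis on \<open>F\<close> into a density.\<close>
  have distr: "distr M borel (X i) = density lborel g" if i: "i \<ge> 1" for i
  proof (rule cdf_unique)
    show "real_distribution (distr M borel (X i))" by (intro real_distribution_distr rv i)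
    have "prob_space (density lborel g)" by (rule S.density_f)
    then show "real_distribution (density lborel g)"
      by (simp add: real_distribution_def real_distribution_axioms_def)
    have "cdf (density lborel g) x = F x" for x
      using S.density_f(2,3)[of x] assms(4)[of x] by (cases "x > 0") (auto simp: cdf_def)
    then show "cdf (distr M borel (X i)) = cdf (density lborel g)"
      unfolding assms(3)[OF i] by auto
  qed
  interpret gamma_kernel_sample F g g' B M X
    by unfold_locales (use assms(2) distr in auto)
  have const: "var_const f = var_const g" "bias_const f f' = bias_const g g'"
    unfolding var_const_def bias_const_def
    by (intro set_lebesgue_integral_cong; simp add: g_def g'_def)+
  have MM: "MISE_main F f f' n y = MISE_main F g g' n y" for n y
    by (simp add: MISE_main_def const)
  have bo: "b_opt f f' n = b_opt g g' n" for n
    by (simp add: b_opt_def const)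
  have ao: "asymp_optimal F f f' n = asymp_optimal F g g' n" for n
    by (simp add: asymp_optimal_def MM[abs_def])
  have sq: "set_integrable lborel {0<..} (\<lambda>x. sqrt x * g x)"
    using assms(13) by (subst set_integrable_cong[OF refl refl, where f' = "\<lambda>x. sqrt x * f x"]) (auto simp: g_def)
  have g2: "set_integrable lborel {0<..} (\<lambda>x. (g x + x / 2 * g' x)\<^sup>2)"
    using assms(14)
    by (subst set_integrable_cong[OF refl refl, where f' = "\<lambda>x. (f x + x / 2 * f' x)\<^sup>2"]) (auto simp: g_def g'_def)
  show ?thesis
    unfolding const bo ao MM
    using MISE_decomposition[OF assms(11)] MISE_expansion[OF assms(11,12) sq g2]
      MISE_b_opt[OF sq g2] asymp_optimal_b_opt[OF var_const_pos[OF sq]]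
    by (intro conjI impI allI) blast+
qed

end
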